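(* Assume $q$ takes values in $(0,1)$. Then for every $h\in\mathcal H$, $\hat T(h)$ restricts to a bounded operator on $\ell^2(P,\delta)$, and $\langle\hat T(h)f,g\rangle_\delta=\langle f,\hat T(h^* )g\rangle_\delta$ for all $h\in\mathcal H$ and $f,g\in\ell^2(P,\delta)$.
   Context: Let $R$ be an irreducible reduced crystallographic root system of rank $n$ spanning a real Euclidean space $V$ with inner product $\langle\cdot,\cdot\rangle$; $\alpha^\vee:=2\alpha/\langle\alpha,\alpha\rangle$; $P$ the weight lattice; $R^+$ positive roots with simple roots $\alpha_1,\dots,\alpha_n$; $P^+$ the dominant weights; $C:=\{x:\langle x,\alpha^\vee\rangle>0\ \forall\alpha\in R^+\}$; $A:=\{x:0<\langle x,\alpha^\vee\rangle<1\ \forall\alpha\in R^+\}$; $\alpha_0\in R^+$ with $\alpha_0^\vee$ the highest root of $R^\vee$. $W_0$ finite Weyl group, $W$ extended affine Weyl group generated by $W_0$ and translations $t_\lambda$ ($\lambda\in P$); $s_0$ reflection in $V_0:=\{\langle x,\alpha_0^\vee\rangle=1\}$, $s_j$ reflection in $V_j:=\{\langle x,\alpha_j^\vee\rangle=0\}$; $\ell(w)$ = number of hyperplanes $\{\langle x,\alpha^\vee\rangle=k\}$ separating $A$ and $wA$; $\Omega:=\{u\in W:uA=A\}$. For $\lambda\in P$, $v_\lambda$ is the shortest element of $W_0$ mapping $\lambda$ into $-\overline C$ and $u_\lambda:=t_\lambda v_\lambda^{-1}$. $q:W\to\mathbb R\setminus\{0\}$ length multiplicative ($q_{ww'}=q_wq_{w'}$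 if lengths add, $q_w=1$ if $\ell(w)=0$), $q_j:=q_{s_j}$. $\mathcal H$: complex algebra with basis $T_w$ ($w\in W$), $(T_j-q_j)(T_j+q_j^{-1})=0$, $T_{ww'}=T_wT_{w'}$ if lengths add; $*$ is the antilinear anti-involution of $\mathcal H$ with $T_w^*=T_{w^{-1}}$. $C(P)$: functions $P\to\mathbb C$, $(wf)(\lambda)=f(w^{-1}\lambda)$. $\hat T$ is the representation of $\mathcal H$ on $C(P)$ with $T_j\mapsto q_j+\chi_j(s_j-1)$ ($0\le j\le n$; $\chi_j(\lambda)=q_j$ if $V_j$ separates $\lambda$ and $A$, $1$ if $\lambda\in V_j$, $q_j^{-1}$ otherwise) and $T_u\mapsto u$ ($u\in\Omega$). Set $\mathcal N_0:=\sum_{w\in W_0}q_w^2$, $\delta_\lambda:=\mathcal N_0^{-1}q_{u_\lambda}^{-2}$, $\langle f,g\rangle_\delta:=\sum_{\lambda\in P}f(\lambda)\overline{g(\lambda)}\delta_\lambda$, and $\ell^2(P,\delta):=\{f\in C(P):\langle f,f\rangle_\delta<\infty\}$. *)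

theory Defs
  imports "HOL-Analysis.Analysis"
begin

definition coroot :: "'v::euclidean_space \<Rightarrow> 'v" where
  "coroot a = (2 / (a \<bullet> a)) *\<^sub>R a"

definition refl :: "'v::euclidean_space \<Rightarrow> 'v \<Rightarrow> 'v" where
  "refl a x = x - (x \<bullet> coroot a) *\<^sub>R a"

definition root_system :: "'v::euclidean_space set \<Rightarrow> bool" where
  "root_system R \<longleftrightarrow>
     finite R \<and> 0 \<notin> R \<and> span R = UNIV \<and>
     (\<forall>a\<in>R. refl a ` R \<subseteq> R) \<and>
     (\<forall>a\<in>R. \<forall>b\<in>R. b \<bullet> coroot a \<in> \<int>) \<and>
     (\<forall>a\<in>R. \<forall>c::real. c *\<^sub>R a \<in> R \<longrightarrow> c = 1 \<or> c = -1) \<and>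
     \<not> (\<exists>R1 R2. R1 \<noteq> {} \<and> R2 \<noteq> {} \<and> R = R1 \<union> R2 \<and>
            (\<forall>a\<in>R1. \<forall>b\<in>R2. a \<bullet> b = 0))"

text \<open>A positive system is given by a regular vector x0.\<close>
definition regular :: "'v::euclidean_space set \<Rightarrow> 'v \<Rightarrow> bool" where
  "regular R x0 \<longleftrightarrow> (\<forall>a\<in>R. x0 \<bullet> a \<noteq> 0)"

definition pos_roots :: "'v::euclidean_space set \<Rightarrow> 'v \<Rightarrow> 'v set" where
  "pos_roots R x0 = {a\<in>R. x0 \<bullet> a > 0}"

definition simple_roots :: "'v::euclidean_space set \<Rightarrow> 'v \<Rightarrow> 'v set" where
  "simple_roots R x0 = {a \<in> pos_roots R x0.
      \<not> (\<exists>b\<in>pos_roots R x0. \<exists>c\<in>pos_roots R x0. a = b + c)}"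

definition alpha0 :: "'v::euclidean_space set \<Rightarrow> 'v \<Rightarrow> 'v" where
  "alpha0 R x0 = (THE a. a \<in> pos_roots R x0 \<and>
      (\<forall>b\<in>pos_roots R x0. \<exists>m::'v \<Rightarrow> nat.
          coroot a - coroot b = (\<Sum>s\<in>simple_roots R x0. of_nat (m s) *\<^sub>R coroot s)))"

definition weights :: "'v::euclidean_space set \<Rightarrow> 'v set" where
  "weights R = {l. \<forall>a\<in>R. l \<bullet> coroot a \<in> \<int>}"

definition chamberC :: "'v::euclidean_space set \<Rightarrow> 'v \<Rightarrow> 'v set" where
  "chamberC R x0 = {x. \<forall>a\<in>pos_roots R x0. x \<bullet> coroot a > 0}"

definition alcoveA :: "'v::euclidean_space set \<Rightarrow> 'v \<Rightarrow> 'v set" where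
  "alcoveA R x0 = {x. \<forall>a\<in>pos_roots R x0. 0 < x \<bullet> coroot a \<and> x \<bullet> coroot a < 1}"

definition W0 :: "'v::euclidean_space set \<Rightarrow> ('v \<Rightarrow> 'v) set" where
  "W0 R = {foldr (\<circ>) (map refl as) id | as. set as \<subseteq> R}"

definition transl :: "'v::euclidean_space \<Rightarrow> 'v \<Rightarrow> 'v" where
  "transl l = (\<lambda>x. x + l)"

definition Wext :: "'v::euclidean_space set \<Rightarrow> ('v \<Rightarrow> 'v) set" where
  "Wext R = {foldr (\<circ>) gs id | gs. set gs \<subseteq> W0 R \<union> transl ` weights R}"

definition len :: "'v::euclidean_space set \<Rightarrow> 'v \<Rightarrow> ('v \<Rightarrow> 'v) \<Rightarrow> nat" where
  "len R x0 w = card {H. \<exists>a\<in>pos_roots R x0. \<exists>k::int.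
      H = {x. x \<bullet> coroot a = of_int k} \<and>
      (((\<forall>x\<in>alcoveA R x0. x \<bullet> coroot a < of_int k) \<and>
        (\<forall>y\<in>w ` alcoveA R x0. y \<bullet> coroot a > of_int k)) \<or>
       ((\<forall>x\<in>alcoveA R x0. x \<bullet> coroot a > of_int k) \<and>
        (\<forall>y\<in>w ` alcoveA R x0. y \<bullet> coroot a < of_int k)))}"

definition Omega :: "'v::euclidean_space set \<Rightarrow> 'v \<Rightarrow> ('v \<Rightarrow> 'v) set" where
  "Omega R x0 = {u \<in> Wext R. u ` alcoveA R x0 = alcoveA R x0}"

text \<open>Generators s_0,...,s_n, encoded by the hyperplane (b,k): {x. x . b^vee = k}.
  s_0 corresponds to (alpha0, 1), s_j (j \<ge> 1) to (alpha_j, 0).\<close>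
definition gens :: "'v::euclidean_space set \<Rightarrow> 'v \<Rightarrow> ('v \<times> int) set" where
  "gens R x0 = insert (alpha0 R x0, 1) ((\<lambda>a. (a, 0)) ` simple_roots R x0)"

definition sgen :: "'v::euclidean_space \<times> int \<Rightarrow> 'v \<Rightarrow> 'v" where
  "sgen j x = x - (x \<bullet> coroot (fst j) - of_int (snd j)) *\<^sub>R fst j"

definition chi :: "'v::euclidean_space set \<Rightarrow> 'v \<Rightarrow> (('v \<Rightarrow> 'v) \<Rightarrow> real)
                    \<Rightarrow> 'v \<times> int \<Rightarrow> 'v \<Rightarrow> complex" where
  "chi R x0 q j l =
     (let b = fst j; k = of_int (snd j) in
      if l \<bullet> coroot b = k then 1
      else if (l \<bullet> coroot b < k \<and> (\<forall>x\<in>alcoveA R x0. x \<bullet> coroot b > k)) \<or>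
              (l \<bullet> coroot b > k \<and> (\<forall>x\<in>alcoveA R x0. x \<bullet> coroot b < k))
           then complex_of_real (q (sgen j))
           else complex_of_real (inverse (q (sgen j))))"

definition act :: "('v \<Rightarrow> 'v) \<Rightarrow> ('v \<Rightarrow> complex) \<Rightarrow> 'v \<Rightarrow> complex" where
  "act w f l = f (inv w l)"

definition Tgen :: "'v::euclidean_space set \<Rightarrow> 'v \<Rightarrow> (('v \<Rightarrow> 'v) \<Rightarrow> real)
                    \<Rightarrow> 'v \<times> int \<Rightarrow> ('v \<Rightarrow> complex) \<Rightarrow> 'v \<Rightarrow> complex" where
  "Tgen R x0 q j f l =
     complex_of_real (q (sgen j)) * f l + chi R x0 q j l * (act (sgen j) f l - f l)"

text \<open>hat T(T_w) = hat T(T_u) hat T(T_{j1}) ... hat T(T_{jr}) for a reduced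
  expression w = u s_{j1} ... s_{jr}, u in Omega.\<close>
definition hatT_basis :: "'v::euclidean_space set \<Rightarrow> 'v \<Rightarrow> (('v \<Rightarrow> 'v) \<Rightarrow> real)
                    \<Rightarrow> ('v \<Rightarrow> 'v) \<Rightarrow> ('v \<Rightarrow> complex) \<Rightarrow> 'v \<Rightarrow> complex" where
  "hatT_basis R x0 q w = (SOME T. \<exists>u js. u \<in> Omega R x0 \<and> set js \<subseteq> gens R x0 \<and>
      length js = len R x0 w \<and> w = u \<circ> foldr (\<circ>) (map sgen js) id \<and>
      T = act u \<circ> foldr (\<circ>) (map (Tgen R x0 q) js) id)"

text \<open>Elements of the Hecke algebra h = sum_w c_w T_w are given by finitely
  supported coefficient functions c on W.\<close>
definition hecke_elem :: "'v::euclidean_space set \<Rightarrow> (('v \<Rightarrow> 'v) \<Rightarrow> complex) \<Rightarrow> bool" where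
  "hecke_elem R c \<longleftrightarrow> finite {w. c w \<noteq> 0} \<and> {w. c w \<noteq> 0} \<subseteq> Wext R"

definition hatT :: "'v::euclidean_space set \<Rightarrow> 'v \<Rightarrow> (('v \<Rightarrow> 'v) \<Rightarrow> real)
                    \<Rightarrow> (('v \<Rightarrow> 'v) \<Rightarrow> complex) \<Rightarrow> ('v \<Rightarrow> complex) \<Rightarrow> 'v \<Rightarrow> complex" where
  "hatT R x0 q c f = (\<lambda>l. \<Sum>w\<in>{w. c w \<noteq> 0}. c w * hatT_basis R x0 q w f l)"

definition hstar :: "'v::euclidean_space set \<Rightarrow> (('v \<Rightarrow> 'v) \<Rightarrow> complex) \<Rightarrow> ('v \<Rightarrow> 'v) \<Rightarrow> complex" where
  "hstar R c = (\<lambda>v. if v \<in> Wext R then cnj (c (inv v)) else 0)"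

definition N0 :: "'v::euclidean_space set \<Rightarrow> (('v \<Rightarrow> 'v) \<Rightarrow> real) \<Rightarrow> real" where
  "N0 R q = (\<Sum>w\<in>W0 R. (q w)\<^sup>2)"

definition vlam :: "'v::euclidean_space set \<Rightarrow> 'v \<Rightarrow> 'v \<Rightarrow> 'v \<Rightarrow> 'v" where
  "vlam R x0 l = (THE v. v \<in> W0 R \<and> v l \<in> uminus ` closure (chamberC R x0) \<and>
      (\<forall>v'\<in>W0 R. v' l \<in> uminus ` closure (chamberC R x0) \<longrightarrow> len R x0 v \<le> len R x0 v'))"

definition ulam :: "'v::euclidean_space set \<Rightarrow> 'v \<Rightarrow> 'v \<Rightarrow> 'v \<Rightarrow> 'v" where
  "ulam R x0 l = transl l \<circ> inv (vlam R x0 l)"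

definition delta :: "'v::euclidean_space set \<Rightarrow> 'v \<Rightarrow> (('v \<Rightarrow> 'v) \<Rightarrow> real) \<Rightarrow> 'v \<Rightarrow> real" where
  "delta R x0 q l = 1 / (N0 R q * (q (ulam R x0 l))\<^sup>2)"

definition l2 :: "'v::euclidean_space set \<Rightarrow> 'v \<Rightarrow> (('v \<Rightarrow> 'v) \<Rightarrow> real) \<Rightarrow> ('v \<Rightarrow> complex) set" where
  "l2 R x0 q = {f. (\<lambda>l. (cmod (f l))\<^sup>2 * delta R x0 q l) summable_on weights R}"

definition normsq :: "'v::euclidean_space set \<Rightarrow> 'v \<Rightarrow> (('v \<Rightarrow> 'v) \<Rightarrow> real) \<Rightarrow> ('v \<Rightarrow> complex) \<Rightarrow> real" where
  "normsq R x0 q f = (\<Sum>\<^sub>\<infinity>l\<in>weights R. (cmod (f l))\<^sup>2 * delta R x0 q l)"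

definition inner_delta :: "'v::euclidean_space set \<Rightarrow> 'v \<Rightarrow> (('v \<Rightarrow> 'v) \<Rightarrow> real)
                    \<Rightarrow> ('v \<Rightarrow> complex) \<Rightarrow> ('v \<Rightarrow> complex) \<Rightarrow> complex" where
  "inner_delta R x0 q f g =
     (\<Sum>\<^sub>\<infinity>l\<in>weights R. f l * cnj (g l) * complex_of_real (delta R x0 q l))"

end

theory Submission
  imports Defs
begin

text \<open>
  Write \<open>S\<close> for the reflections in the walls of the alcove. For a weight \<open>l\<close>, \<open>u\<^sub>l\<close> is the unique
  group element sending \<open>0\<close> to \<open>l\<close> whose inverse moves the alcove into the dominant chamber; hence
  \<open>u\<^bsub>s l\<^esub> = s u\<^sub>l\<close> whenever \<open>s \<in> S\<close> moves \<open>l\<close>, and \<open>\<chi>\<^sub>s \<delta>\<close> is invariant under \<open>s\<close>. So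
  \<open>T\<^sub>s = (q\<^sub>s - \<chi>\<^sub>s) + \<chi>\<^sub>s s\<close> is bounded and self-adjoint, while length-zero elements act unitarily.

  The operator of \<open>T\<^sub>w\<close> is a product along a reduced word, so its adjoint is the product along the
  reversed word, and one needs that the product does not depend on the word. Instead of braid
  relations, embed functions on weights into functions on the group by \<open>f \<mapsto> (w \<mapsto> f (w 0) / q\<^sub>w)\<close>.
  There \<open>T\<^sub>s\<close> is inverted by an operator commuting with its right-handed analogues. An operator
  commuting with all right-handed ones is determined by the values \<open>G \<mapsto> (Z G) 1\<close>, and for the inverse
  of the product along a reduced word of \<open>w\<close> these are \<open>G \<mapsto> G w\<close>.
\<close>

section \<open>Finite root systems\<close>

text \<open>\<open>hatT_basis\<close> picks some reduced word, so the word picked for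
  \<open>inv w\<close> need not be the reversal of the one picked for \<open>w\<close>; this gap is
  what makes word independence part of an adjointness theorem. Operators act on functions on the
  whole space, but only values at weights count, so equality of operators is asserted only there.

  The operators on the group are not ad hoc: \<open>LS\<close> is left multiplication by the inverse
  of \<open>T_s\<close>, written dually to the basis formed by the inverses of the elements
  \<open>T_v\<close> with \<open>v = inv w\<close>. Dividing by \<open>q w\<close> produces
  functions on which \<open>RS\<close> of a simple reflection acts as the scalar
  \<open>1 / q\<close>, as for a representation induced from the finite part.

  Affine roots are kept as real functions, and separation questions become signs at a single point
  \<open>bp\<close> of the alcove. The highest coroot is only given by a definite description, so it
  must be constructed from irreducibility before the walls of the alcove are known.\<close>

lemma coroot_uminus: "coroot (- a) = - coroot a"
  by (simp add: coroot_def)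

lemma inner_coroot_self: "a \<noteq> 0 \<Longrightarrow> a \<bullet> coroot a = 2"
  by (simp add: coroot_def)

lemma coroot_coroot: "coroot (coroot a) = a"
  by (cases "a = 0") (simp_all add: coroot_def)

lemma coroot_inject: "coroot a = coroot b \<longleftrightarrow> a = b"
  by (metis coroot_coroot)

lemma coroot_eq_0_iff: "coroot a = 0 \<longleftrightarrow> a = 0"
  by (metis coroot_coroot coroot_def scaleR_zero_right)

lemma inner_coroot_pos_iff: "0 < x \<bullet> coroot a \<longleftrightarrow> 0 < x \<bullet> a"
proof (cases "a = 0")
  case False
  then have "0 < 2 / (a \<bullet> a)" by simp
  then show ?thesis by (simp only: coroot_def inner_scaleR_right zero_less_mult_iff) (meson less_asym)
qed (simp add: coroot_def)

lemma inner_coroot_neg_iff: "x \<bullet> coroot a < 0 \<longleftrightarrow> x \<bullet> a < 0"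
  using inner_coroot_pos_iff[of "- x" a] by simp

lemma inner_coroot_eq_0_iff: "x \<bullet> coroot a = 0 \<longleftrightarrow> x \<bullet> a = 0"
  by (cases "a = 0") (auto simp: coroot_def)

lemma refl_coroot: "refl a x = x - (x \<bullet> a) *\<^sub>R coroot a"
  by (simp add: refl_def coroot_def algebra_simps)

lemma refl_self: "refl a a = - a"
  by (cases "a = 0") (simp_all add: refl_def inner_coroot_self scaleR_2)

lemma refl_inner_shift: "refl a x \<bullet> y = x \<bullet> refl a y"
  by (simp add: refl_def coroot_def inner_simps inner_commute)

lemma refl_refl: "refl a (refl a x) = x"
  by (cases "a = 0") (simp_all add: refl_def inner_simps inner_coroot_self coroot_eq_0_iff algebra_simps scaleR_2)

lemma refl_isometry: "refl a x \<bullet> refl a y = x \<bullet> y"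
  by (simp add: refl_inner_shift refl_refl)

lemma linear_refl: "linear (refl a)"
  by (intro linearI) (simp_all add: refl_def inner_simps algebra_simps)

lemma coroot_refl: "coroot (refl a b) = refl a (coroot b)"
  by (metis coroot_def linear_refl linear_scale refl_isometry)

lemma coroot_refl_diff: "coroot (refl a b) = coroot b - (coroot b \<bullet> a) *\<^sub>R coroot a"
  unfolding coroot_refl by (rule refl_coroot)

lemma refl_uminus: "refl (- a) = refl a"
  by (simp add: fun_eq_iff refl_def coroot_uminus)

lemma refl_conj: "refl (refl a b) x = refl a (refl b (refl a x))"
proof -
  have "refl a (refl b (refl a x)) = refl a (refl a x) - (refl a x \<bullet> coroot b) *\<^sub>R refl a b"
    by (simp add: refl_def[of b] linear_diff[OF linear_refl] linear_scale[OF linear_refl])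
  then show ?thesis
    by (simp add: refl_refl refl_inner_shift flip: coroot_refl) (simp add: refl_def[of "refl a b"])
qed

lemma foldr_comp_append:
  "foldr (\<circ>) (xs @ ys) id = foldr (\<circ>) xs id \<circ> foldr (\<circ>) ys id"
  by (induction xs) (simp_all add: o_assoc)

text \<open>The cone is indexed by coefficient functions because \<open>alpha0\<close> quantifies
  over such functions. The family \<open>f\<close> is the identity for roots and
  \<open>coroot\<close> for coroots.\<close>

definition nat_cone :: "'a set \<Rightarrow> ('a \<Rightarrow> 'v::real_vector) \<Rightarrow> 'v set" where
  "nat_cone S f = {\<Sum>s\<in>S. of_nat (m s) *\<^sub>R f s | m. True}"

lemma nat_cone_zero: "0 \<in> nat_cone S f"
  by (auto simp: nat_cone_def intro!: exI[of _ "\<lambda>_. 0"])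

lemma nat_cone_add:
  assumes "x \<in> nat_cone S f" "y \<in> nat_cone S f"
  shows "x + y \<in> nat_cone S f"
proof -
  obtain m n where "x = (\<Sum>s\<in>S. of_nat (m s) *\<^sub>R f s)" "y = (\<Sum>s\<in>S. of_nat (n s) *\<^sub>R f s)"
    using assms by (auto simp: nat_cone_def)
  then have "x + y = (\<Sum>s\<in>S. of_nat (m s + n s) *\<^sub>R f s)"
    by (simp add: sum.distrib algebra_simps)
  then show ?thesis
    unfolding nat_cone_def by (intro CollectI exI[of _ "\<lambda>s. m s + n s"]) simp
qed

lemma nat_cone_base:
  assumes "finite S" "s \<in> S"
  shows "of_nat k *\<^sub>R f s \<in> nat_cone S f"
proof -
  have "of_nat k *\<^sub>R f s = (\<Sum>t\<in>S. of_nat (if t = s then k else 0) *\<^sub>R f t)"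
    using assms by (simp add: if_distrib[of of_nat] if_distrib[of "\<lambda>c. c *\<^sub>R _"] cong: if_cong)
  then show ?thesis
    unfolding nat_cone_def by (intro CollectI exI[of _ "\<lambda>t. if t = s then k else 0"]) simp
qed

lemma nat_cone_inner_nonneg:
  fixes f :: "'a \<Rightarrow> 'v::real_inner"
  assumes "x \<in> nat_cone S f" "\<And>s. s \<in> S \<Longrightarrow> 0 \<le> y \<bullet> f s"
  shows "0 \<le> y \<bullet> x"
  using assms by (auto simp: nat_cone_def inner_sum_right intro!: sum_nonneg)

lemma nat_cone_inner_pos:
  fixes f :: "'a \<Rightarrow> 'v::real_inner"
  assumes "finite S" "x \<in> nat_cone S f" "\<And>s. s \<in> S \<Longrightarrow> 0 < y \<bullet> f s" "x \<noteq> 0"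
  shows "0 < y \<bullet> x"
proof -
  obtain m where m: "x = (\<Sum>s\<in>S. of_nat (m s) *\<^sub>R f s)"
    using assms by (auto simp: nat_cone_def)
  obtain s where s: "s \<in> S" "m s \<noteq> 0"
    using assms(4) m by (cases "\<forall>s\<in>S. m s = 0") auto
  have "0 < (\<Sum>s\<in>S. of_nat (m s) * (y \<bullet> f s))"
    using assms s by (intro sum_pos2[of _ s]) (auto simp: less_imp_le)
  then show ?thesis by (simp add: m inner_sum_right)
qed

locale root_data =
  fixes R :: "'v::euclidean_space set" and x0 :: 'v
  assumes root_sys: "root_system R" and reg: "regular R x0"
begin

abbreviation Pos where "Pos \<equiv> pos_roots R x0"
abbreviation Sim where "Sim \<equiv> simple_roots R x0"

lemma finite_R: "finite R" and zero_notin_R: "0 \<notin> R" and span_R: "span R = UNIV"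
  using root_sys by (auto simp: root_system_def)

lemma refl_in_R: "a \<in> R \<Longrightarrow> b \<in> R \<Longrightarrow> refl a b \<in> R"
  using root_sys by (auto simp: root_system_def)

lemma cartan_int: "a \<in> R \<Longrightarrow> b \<in> R \<Longrightarrow> b \<bullet> coroot a \<in> \<int>"
  using root_sys by (auto simp: root_system_def)

lemma R_reduced: "a \<in> R \<Longrightarrow> c *\<^sub>R a \<in> R \<Longrightarrow> c = 1 \<or> c = -1"
  using root_sys by (auto simp: root_system_def)

lemma R_nz: "a \<in> R \<Longrightarrow> a \<noteq> 0"
  using zero_notin_R by blast

lemma uminus_in_R: "a \<in> R \<Longrightarrow> - a \<in> R"
  using refl_in_R[of a a] by (simp add: refl_self)

lemma Pos_R: "a \<in> Pos \<Longrightarrow> a \<in> R"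
  by (simp add: pos_roots_def)

lemma Sim_Pos: "a \<in> Sim \<Longrightarrow> a \<in> Pos"
  by (simp add: simple_roots_def)

lemma Sim_R: "a \<in> Sim \<Longrightarrow> a \<in> R"
  by (simp add: Sim_Pos Pos_R)

lemma finite_Pos: "finite Pos"
  using finite_R by (rule finite_subset[rotated]) (auto simp: Pos_R)

lemma finite_Sim: "finite Sim"
  using finite_Pos by (rule finite_subset[rotated]) (auto simp: Sim_Pos)

lemma Pos_inner: "a \<in> Pos \<Longrightarrow> 0 < x0 \<bullet> a"
  by (simp add: pos_roots_def)

lemma Pos_inner_coroot: "a \<in> Pos \<Longrightarrow> 0 < x0 \<bullet> coroot a"
  by (simp add: inner_coroot_pos_iff Pos_inner)

lemma Pos_cases: "a \<in> R \<Longrightarrow> a \<in> Pos \<or> - a \<in> Pos"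
  using reg by (auto simp: pos_roots_def regular_def uminus_in_R neq_iff)

lemma Sim_indecomp: "s \<in> Sim \<Longrightarrow> b \<in> Pos \<Longrightarrow> c \<in> Pos \<Longrightarrow> s \<noteq> b + c"
  by (auto simp: simple_roots_def)

text \<open>Strict Cauchy-Schwarz: the component of \<open>b\<close> orthogonal to \<open>a\<close>
  cannot vanish, because in a reduced system the only multiples of \<open>a\<close> are
  \<open>a\<close> and \<open>- a\<close>.\<close>

lemma cartan_product:
  assumes "a \<in> R" "b \<in> R" "b \<noteq> a" "b \<noteq> - a"
  shows "(a \<bullet> coroot b) * (b \<bullet> coroot a) < 4"
proof -
  have aa: "0 < a \<bullet> a" "0 < b \<bullet> b" using assms R_nz by auto
  have ne: "b - ((a \<bullet> b) / (a \<bullet> a)) *\<^sub>R a \<noteq> 0"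
  proof
    assume "b - ((a \<bullet> b) / (a \<bullet> a)) *\<^sub>R a = 0"
    then have b: "b = ((a \<bullet> b) / (a \<bullet> a)) *\<^sub>R a" by (simp only: right_minus_eq)
    then have "(a \<bullet> b) / (a \<bullet> a) = 1 \<or> (a \<bullet> b) / (a \<bullet> a) = -1"
      using R_reduced[of a "(a \<bullet> b) / (a \<bullet> a)"] assms by metis
    then show False using b assms by (metis scaleR_minus1_left scaleR_one)
  qed
  have "0 < (b - ((a \<bullet> b) / (a \<bullet> a)) *\<^sub>R a) \<bullet> (b - ((a \<bullet> b) / (a \<bullet> a)) *\<^sub>R a)"
    using ne by simp
  also have "\<dots> = b \<bullet> b - (a \<bullet> b)\<^sup>2 / (a \<bullet> a)"
    using aa by (simp add: inner_simps inner_commute[of b a] power2_eq_square field_simps)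
  finally have "(a \<bullet> b)\<^sup>2 < (a \<bullet> a) * (b \<bullet> b)"
    using aa by (simp add: field_simps)
  then show ?thesis
    using aa by (simp add: coroot_def inner_commute[of b a] power2_eq_square field_simps)
qed

text \<open>Both Cartan integers are positive with product below 4, so one of them is 1 and the
  other at most 3. The last two cases keep the exact value of the second integer for use in
  \<open>refl_simple_Pos\<close>.\<close>

lemma cartan_pos_cases:
  assumes "a \<in> R" "b \<in> R" "b \<noteq> a" "0 < a \<bullet> b"
  obtains "a \<bullet> coroot b = 1" | "b \<bullet> coroot a = 1" "a \<bullet> coroot b = 2" | "b \<bullet> coroot a = 1" "a \<bullet> coroot b = 3"
proof -
  obtain m n :: int where m: "a \<bullet> coroot b = of_int m" and n: "b \<bullet> coroot a = of_int n"
    using cartan_int assms by (metis Ints_cases)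
  have "b \<noteq> - a" using assms(4) inner_ge_zero[of a] by (auto simp del: inner_ge_zero)
  then have "real_of_int (m * n) < 4"
    using cartan_product[OF assms(1-3)] m n by simp
  then have mn: "m * n < 4" by linarith
  have "0 < a \<bullet> coroot b" "0 < b \<bullet> coroot a"
    using assms(4) by (simp_all add: inner_coroot_pos_iff inner_commute)
  then have pos: "1 \<le> m" "1 \<le> n" using m n by simp_all
  have "m * 1 \<le> m * n" "1 * n \<le> m * n" using pos by (auto intro: mult_left_mono mult_right_mono)
  then have "m \<le> 3" "n \<le> 3" using mn by auto
  then consider "m = 1" | "n = 1" "m = 2" | "n = 1" "m = 3"
    using pos mn by (cases "m = 1"; cases "n = 1"; cases "m = 2"; cases "m = 3"; cases "n = 2"; cases "n = 3"; auto)
  then show thesis using that m n by cases simp_all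
qed

lemma root_diff:
  assumes "a \<in> R" "b \<in> R" "b \<noteq> a" "0 < a \<bullet> b"
  shows "a - b \<in> R"
proof -
  have "a - b \<in> R" if "a \<bullet> coroot b = 1"
    using refl_in_R[of b a] assms that by (simp add: refl_def)
  moreover have "a - b \<in> R" if "b \<bullet> coroot a = 1"
    using uminus_in_R[OF refl_in_R[of a b]] assms that by (simp add: refl_def)
  ultimately show ?thesis using cartan_pos_cases[OF assms] by metis
qed

text \<open>The dual of \<open>root_diff\<close>: a Cartan integer equal to 1 makes the difference a
  reflected coroot, with the roles of the two integers exchanged.\<close>

lemma coroot_diff:
  assumes "a \<in> R" "b \<in> R" "b \<noteq> a" "0 < a \<bullet> b"
  shows "\<exists>c\<in>R. coroot a - coroot b = coroot c"
proof -
  have "coroot a - coroot b = coroot (refl b a)" if "b \<bullet> coroot a = 1"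
    using that by (simp add: coroot_refl_diff inner_commute)
  moreover have "coroot a - coroot b = coroot (- refl a b)" if "a \<bullet> coroot b = 1"
    using that by (simp add: coroot_refl_diff coroot_uminus inner_commute)
  ultimately show ?thesis
    using cartan_pos_cases[OF assms] assms refl_in_R uminus_in_R by metis
qed

text \<open>At an acute angle \<open>s - t\<close> would be a root; whichever of
  \<open>s - t\<close> and \<open>t - s\<close> is positive then decomposes \<open>s\<close> or
  \<open>t\<close>.\<close>

lemma Sim_obtuse:
  assumes "s \<in> Sim" "t \<in> Sim" "s \<noteq> t"
  shows "s \<bullet> t \<le> 0"
proof (rule ccontr)
  assume "\<not> s \<bullet> t \<le> 0"
  then have "s - t \<in> R" using root_diff[of s t] assms Sim_R by auto
  then have "s - t \<in> Pos \<or> - (s - t) \<in> Pos" by (rule Pos_cases)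
  then show False
    using Sim_indecomp[OF assms(1), of "s - t" t] Sim_indecomp[OF assms(2), of "t - s" s] assms Sim_Pos by auto
qed

text \<open>If the reflection made a positive root negative, then \<open>m s = a + b\<close> with \<open>a, b\<close> positive and
  \<open>m \<le> 3\<close>; subtracting \<open>s\<close> from both summands contradicts indecomposability or positivity.\<close>

lemma refl_simple_Pos:
  assumes s: "s \<in> Sim" and a: "a \<in> Pos" and ne: "a \<noteq> s"
  shows "refl s a \<in> Pos"
proof (rule ccontr)
  assume neg: "refl s a \<notin> Pos"
  have R: "s \<in> R" "a \<in> R" "s \<in> Pos" using s a Sim_R Pos_R Sim_Pos by auto
  define b where "b = - refl s a"
  have b: "b \<in> Pos" using neg Pos_cases[OF refl_in_R[OF R(1,2)]] by (simp add: b_def)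
  define m where "m = a \<bullet> coroot s"
  have ms: "m *\<^sub>R s = a + b" by (simp add: b_def m_def refl_def)
  have "0 < x0 \<bullet> (m *\<^sub>R s)" unfolding ms using Pos_inner a b by (simp add: inner_simps add_pos_pos)
  then have "0 < m" using Pos_inner[OF R(3)] by (simp add: zero_less_mult_iff)
  then have as: "0 < a \<bullet> s" by (simp add: m_def inner_coroot_pos_iff)
  have m1: "m \<noteq> 1" using ms Sim_indecomp[OF s a b] by auto
  then have sa: "s \<bullet> coroot a = 1" and m23: "m = 2 \<or> m = 3"
    using cartan_pos_cases[OF R(2,1) ne[symmetric] as] by (auto simp: m_def)
  have "a - s \<in> R" using root_diff[OF R(2,1) ne[symmetric] as] .
  then have as': "a - s \<in> Pos"
    using Pos_cases[of "a - s"] Sim_indecomp[OF s a, of "s - a"] by auto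
  have "refl s (a - s) = - (b - s)"
    by (simp add: b_def linear_diff[OF linear_refl] refl_self)
  then have "b - s \<in> R"
    using refl_in_R[OF R(1) \<open>a - s \<in> R\<close>] uminus_in_R by fastforce
  then have bs': "b - s \<in> Pos"
    using Pos_cases[of "b - s"] Sim_indecomp[OF s b, of "s - b"] by auto
  have eq: "(m - 2) *\<^sub>R s = (a - s) + (b - s)"
    using ms by (simp add: algebra_simps scaleR_2)
  from m23 show False
  proof
    assume "m = 2"
    then have "(a - s) + (b - s) = 0" using eq by simp
    then have "x0 \<bullet> ((a - s) + (b - s)) = 0" by simp
    then show False using Pos_inner[OF as'] Pos_inner[OF bs'] by (simp add: inner_simps)
  next
    assume "m = 3"
    then show False using eq Sim_indecomp[OF s as' bs'] by simp
  qed
qed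

text \<open>Heights \<open>x0 \<bullet> a\<close> are real numbers, so well-foundedness comes from
  finiteness: the measure counts the positive roots of smaller height.\<close>

lemma Pos_induct [consumes 1, case_names less]:
  assumes "a \<in> Pos"
    and "\<And>a. a \<in> Pos \<Longrightarrow> (\<And>b. b \<in> Pos \<Longrightarrow> x0 \<bullet> b < x0 \<bullet> a \<Longrightarrow> P b) \<Longrightarrow> P a"
  shows "P a"
  using assms(1)
proof (induction "card {c \<in> Pos. x0 \<bullet> c < x0 \<bullet> a}" arbitrary: a rule: less_induct)
  case less
  show ?case
  proof (rule assms(2)[OF less.prems])
    fix b assume b: "b \<in> Pos" "x0 \<bullet> b < x0 \<bullet> a"
    have "{c \<in> Pos. x0 \<bullet> c < x0 \<bullet> b} \<subset> {c \<in> Pos. x0 \<bullet> c < x0 \<bullet> a}" using b by auto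
    then have "card {c \<in> Pos. x0 \<bullet> c < x0 \<bullet> b} < card {c \<in> Pos. x0 \<bullet> c < x0 \<bullet> a}"
      using finite_Pos by (intro psubset_card_mono) auto
    then show "P b" using less.hyps b by blast
  qed
qed

lemma Pos_nat_cone: "a \<in> Pos \<Longrightarrow> a \<in> nat_cone Sim (\<lambda>s. s)"
proof (induction rule: Pos_induct)
  case (less a)
  show ?case
  proof (cases "a \<in> Sim")
    case True
    then show ?thesis using nat_cone_base[OF finite_Sim, of a 1 "\<lambda>s. s"] by simp
  next
    case False
    then obtain b c where bc: "b \<in> Pos" "c \<in> Pos" "a = b + c"
      using less.hyps by (auto simp: simple_roots_def)
    then have "x0 \<bullet> b < x0 \<bullet> a" "x0 \<bullet> c < x0 \<bullet> a" using Pos_inner by (simp_all add: inner_simps)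
    then show ?thesis using less bc nat_cone_add by metis
  qed
qed

lemma ex_Sim_acute:
  assumes "a \<in> Pos"
  shows "\<exists>s\<in>Sim. 0 < a \<bullet> s"
proof (rule ccontr)
  assume "\<not> (\<exists>s\<in>Sim. 0 < a \<bullet> s)"
  then have "0 \<le> (- a) \<bullet> a"
    by (intro nat_cone_inner_nonneg[OF Pos_nat_cone[OF assms]]) (auto simp: not_less)
  then show False using R_nz[OF Pos_R[OF assms]] inner_gt_zero_iff[of a] by (simp del: inner_gt_zero_iff)
qed

text \<open>Reflecting in a simple root at an acute angle lowers the height and keeps positivity
  until a simple root is reached. Unlike decomposition into sums, this descent also serves coroots
  and reflections, which are not additive in the root.\<close>

lemma Pos_simple_induct [consumes 1, case_names simple refl]:
  assumes "a \<in> Pos"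
    and "\<And>s. s \<in> Sim \<Longrightarrow> P s"
    and "\<And>a s. a \<in> Pos \<Longrightarrow> s \<in> Sim \<Longrightarrow> 0 < a \<bullet> s \<Longrightarrow> refl s a \<in> Pos \<Longrightarrow> P (refl s a) \<Longrightarrow> P a"
  shows "P a"
  using assms(1)
proof (induction rule: Pos_induct)
  case (less a)
  obtain s where s: "s \<in> Sim" "0 < a \<bullet> s" using ex_Sim_acute[OF less.hyps] by blast
  show ?case
  proof (cases "a = s")
    case True then show ?thesis using assms(2) s by simp
  next
    case False
    have p: "refl s a \<in> Pos" using refl_simple_Pos[OF s(1) less.hyps False] .
    have "x0 \<bullet> refl s a < x0 \<bullet> a"
      using s Pos_inner[OF Sim_Pos[OF s(1)]] by (simp add: refl_def inner_simps inner_coroot_pos_iff)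
    then show ?thesis using assms(3)[OF less.hyps s p] less.IH[OF p] by blast
  qed
qed

lemma nat_cone_coroot_base:
  assumes "s \<in> Sim" "a \<in> R" "0 \<le> a \<bullet> s"
  shows "(coroot a \<bullet> s) *\<^sub>R coroot s \<in> nat_cone Sim coroot"
proof -
  obtain m :: int where m: "coroot a \<bullet> s = of_int m"
    using cartan_int[OF assms(2) Sim_R[OF assms(1)]] by (auto simp: inner_commute elim: Ints_cases)
  have "0 \<le> s \<bullet> coroot a" using assms(3) inner_coroot_neg_iff[of s a] by (simp add: inner_commute not_less[symmetric])
  then have "0 \<le> m" using m by (simp add: inner_commute)
  then have "coroot a \<bullet> s = of_nat (nat m)" by (simp add: m)
  then show ?thesis using nat_cone_base[OF finite_Sim assms(1), of "nat m" coroot] by simp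
qed

lemma Pos_coroot_nat_cone: "a \<in> Pos \<Longrightarrow> coroot a \<in> nat_cone Sim coroot"
proof (induction rule: Pos_simple_induct)
  case (simple s)
  then show ?case using nat_cone_base[OF finite_Sim, of s 1 coroot] by simp
next
  case (refl a s)
  have "coroot a = coroot (refl s a) + (coroot a \<bullet> s) *\<^sub>R coroot s"
    by (simp add: coroot_refl_diff)
  then show ?case
    using nat_cone_add[OF refl(5) nat_cone_coroot_base[of s a]] refl Pos_R by simp
qed

lemma Sim_nonempty: "Sim \<noteq> {}"
proof
  assume "Sim = {}"
  then have "Pos = {}" using ex_Sim_acute by auto
  then have "R = {}" using Pos_cases by auto
  then have "UNIV = {0::'v}" using span_R by simp
  then show False using nonempty_Basis nonzero_Basis by blast
qed

text \<open>Transfers irreducibility from roots to simple roots. By descent each positive root lies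
  in one of the two orthogonal spans: \<open>refl s a\<close> and \<open>s\<close> have non-zero
  inner product, so they belong to the same side, and so does \<open>a\<close>.\<close>

lemma simple_roots_connected:
  assumes "Sim = I1 \<union> I2" "I1 \<noteq> {}" "\<And>s t. s \<in> I1 \<Longrightarrow> t \<in> I2 \<Longrightarrow> s \<bullet> t = 0"
  shows "I2 = {}"
proof (rule ccontr)
  assume ne: "I2 \<noteq> {}"
  have orth: "x \<bullet> y = 0" if "x \<in> span I1" "y \<in> span I2" for x y
  proof -
    have "orthogonal x t" if "t \<in> I2" for t
      using orthogonal_to_span[of x I1 t] \<open>x \<in> span I1\<close> that assms(3)
      by (metis inner_commute orthogonal_commute orthogonal_def)
    then show ?thesis using orthogonal_to_span[of y I2 x] that by (auto simp: orthogonal_def)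
  qed
  have cl: "a \<in> span I1 \<or> a \<in> span I2" if "a \<in> Pos" for a
    using that
  proof (induction rule: Pos_simple_induct)
    case (simple s) then show ?case using assms(1) span_base by blast
  next
    case (refl a s)
    have eq: "a = refl s a + (a \<bullet> coroot s) *\<^sub>R s" by (simp add: refl_def)
    have "refl s a \<bullet> s < 0" using refl by (simp add: refl_inner_shift refl_self)
    then have "\<not> (refl s a \<in> span I1 \<and> s \<in> I2)" "\<not> (refl s a \<in> span I2 \<and> s \<in> I1)"
      using orth span_base by (metis inner_commute less_irrefl)+
    then have "(refl s a \<in> span I1 \<and> s \<in> I1) \<or> (refl s a \<in> span I2 \<and> s \<in> I2)"
      using refl(5) refl(2) assms(1) by blast
    then show ?case using eq by (metis span_add span_base span_scale)
  qed
  have "a \<in> span I1 \<or> a \<in> span I2" if "a \<in> R" for a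
    using Pos_cases[OF that] cl[of a] cl[of "- a"] span_neg[of "- a" I1] span_neg[of "- a" I2] by auto
  then have "R = (R \<inter> span I1) \<union> (R \<inter> span I2)" by blast
  moreover have "R \<inter> span I1 \<noteq> {}" "R \<inter> span I2 \<noteq> {}"
    using assms(1,2) ne Sim_R span_base[of _ I1] span_base[of _ I2] by (metis IntI Un_iff empty_iff ex_in_conv)+
  moreover have "\<forall>a\<in>R \<inter> span I1. \<forall>b\<in>R \<inter> span I2. a \<bullet> b = 0" using orth by blast
  ultimately have "\<exists>R1 R2. R1 \<noteq> {} \<and> R2 \<noteq> {} \<and> R = R1 \<union> R2 \<and> (\<forall>a\<in>R1. \<forall>b\<in>R2. a \<bullet> b = 0)"
    by (intro exI[of _ "R \<inter> span I1"] exI[of _ "R \<inter> span I2"] conjI)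
  then show False
    using root_sys by (simp add: root_system_def)
qed

section \<open>The dominance order on coroots and the highest coroot\<close>

definition coroot_le :: "'v \<Rightarrow> 'v \<Rightarrow> bool" where
  "coroot_le b a \<longleftrightarrow> coroot a - coroot b \<in> nat_cone Sim coroot"

lemma coroot_le_refl: "coroot_le a a"
  by (simp add: coroot_le_def nat_cone_zero)

lemma coroot_le_trans: "coroot_le a b \<Longrightarrow> coroot_le b c \<Longrightarrow> coroot_le a c"
  unfolding coroot_le_def using nat_cone_add[of "coroot b - coroot a" Sim coroot "coroot c - coroot b"] by simp

lemma coroot_le_less:
  assumes "coroot_le a b" "a \<noteq> b" "\<And>s. s \<in> Sim \<Longrightarrow> 0 < y \<bullet> coroot s"
  shows "y \<bullet> coroot a < y \<bullet> coroot b"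
  using nat_cone_inner_pos[OF finite_Sim, of "coroot b - coroot a" coroot y] assms
  by (auto simp: coroot_le_def coroot_inject inner_simps)

lemma coroot_le_less_x0: "coroot_le a b \<Longrightarrow> a \<noteq> b \<Longrightarrow> x0 \<bullet> coroot a < x0 \<bullet> coroot b"
  by (rule coroot_le_less) (simp_all add: Pos_inner_coroot Sim_Pos)

text \<open>\<open>alpha0\<close> asks for a greatest element, whereas finiteness only gives maximal
  ones. Irreducibility enters through uniqueness of the maximal element, which makes it the
  greatest.\<close>

definition coroot_max :: "'v \<Rightarrow> bool" where
  "coroot_max a \<longleftrightarrow> a \<in> Pos \<and> (\<forall>b\<in>Pos. coroot_le a b \<longrightarrow> b = a)"

lemma ex_coroot_max:
  assumes "b \<in> Pos"
  shows "\<exists>a. coroot_max a \<and> coroot_le b a"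
proof -
  have "finite {c \<in> Pos. coroot_le b c}" "{c \<in> Pos. coroot_le b c} \<noteq> {}"
    using finite_Pos assms coroot_le_refl by auto
  then obtain a where "is_arg_min (\<lambda>c. - (x0 \<bullet> coroot c)) (\<lambda>c. c \<in> {c \<in> Pos. coroot_le b c}) a"
    using ex_is_arg_min_if_finite[where f="\<lambda>c. - (x0 \<bullet> coroot c)"] by blast
  then have a: "a \<in> Pos" "coroot_le b a"
      "\<And>c. c \<in> Pos \<Longrightarrow> coroot_le b c \<Longrightarrow> x0 \<bullet> coroot c \<le> x0 \<bullet> coroot a"
    by (auto simp: is_arg_min_linorder)
  have "c = a" if "c \<in> Pos" "coroot_le a c" for c
    using a(3)[OF that(1) coroot_le_trans[OF a(2) that(2)]] coroot_le_less_x0[OF that(2)] by auto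
  then have "coroot_max a"
    unfolding coroot_max_def using a by blast
  then show ?thesis using a by blast
qed

text \<open>If \<open>a \<bullet> s\<close> were negative, reflecting in \<open>s\<close> would add
  a positive multiple of \<open>coroot s\<close>. The larger coroot still pairs positively with
  \<open>x0\<close>, so it would contradict maximality.\<close>

lemma coroot_max_dominant:
  assumes "coroot_max a" "s \<in> Sim"
  shows "0 \<le> a \<bullet> s"
proof (rule ccontr)
  assume neg: "\<not> 0 \<le> a \<bullet> s"
  have a: "a \<in> Pos" "a \<in> R" using assms Pos_R by (auto simp: coroot_max_def)
  have d: "coroot (refl s a) - coroot a = (coroot (- a) \<bullet> s) *\<^sub>R coroot s"
    by (simp add: coroot_refl_diff coroot_uminus)
  have "(coroot (- a) \<bullet> s) *\<^sub>R coroot s \<in> nat_cone Sim coroot"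
    using nat_cone_coroot_base[OF assms(2) uminus_in_R[OF a(2)]] neg by simp
  then have le: "coroot_le a (refl s a)" by (simp add: coroot_le_def d)
  have ne: "refl s a \<noteq> a"
    using neg R_nz[OF Sim_R[OF assms(2)]] by (auto simp: refl_coroot coroot_eq_0_iff)
  have "0 < x0 \<bullet> coroot (refl s a)"
    using coroot_le_less_x0[OF le] ne Pos_inner_coroot[OF a(1)] by auto
  then have "refl s a \<in> Pos"
    using refl_in_R[OF Sim_R[OF assms(2)] a(2)] by (simp add: pos_roots_def inner_coroot_pos_iff)
  then show False using assms(1) le ne by (auto simp: coroot_max_def)
qed

text \<open>Simple roots missing from the expansion of \<open>coroot a\<close> are orthogonal to
  those occurring, so by connectedness none is missing. As \<open>b\<close> is dominant, this forces
  \<open>0 < b \<bullet> a\<close>; the difference of the coroots is then a coroot, and its sign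
  makes \<open>a\<close> and \<open>b\<close> comparable.\<close>

lemma coroot_max_unique:
  assumes "coroot_max a" "coroot_max b"
  shows "a = b"
proof (rule ccontr)
  assume ne: "a \<noteq> b"
  have ab: "a \<in> Pos" "b \<in> Pos" "a \<in> R" "b \<in> R" using assms Pos_R by (auto simp: coroot_max_def)
  obtain m where m: "coroot a = (\<Sum>s\<in>Sim. of_nat (m s) *\<^sub>R coroot s)"
    using Pos_coroot_nat_cone[OF ab(1)] by (auto simp: nat_cone_def)
  define I1 I2 where "I1 = {s \<in> Sim. m s \<noteq> 0}" and "I2 = {s \<in> Sim. m s = 0}"
  have U: "Sim = I1 \<union> I2" by (auto simp: I1_def I2_def)
  have "I1 \<noteq> {}"
  proof
    assume "I1 = {}"
    then have "coroot a = 0" by (simp add: m I1_def)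
    then show False using R_nz ab by (simp add: coroot_eq_0_iff)
  qed
  moreover have "s \<bullet> t = 0" if "s \<in> I1" "t \<in> I2" for s t
  proof -
    have t: "t \<in> Sim" "m t = 0" using that by (auto simp: I2_def)
    have "0 \<le> t \<bullet> a" using coroot_max_dominant[OF assms(1) t(1)] by (simp add: inner_commute)
    then have "0 \<le> t \<bullet> coroot a" using inner_coroot_neg_iff[of t a] by linarith
    then have ge: "0 \<le> (\<Sum>s\<in>Sim. of_nat (m s) * (t \<bullet> coroot s))" by (simp add: m inner_sum_right)
    have le: "of_nat (m s) * (t \<bullet> coroot s) \<le> 0" if "s \<in> Sim" for s
    proof (cases "s = t")
      case False
      then have "t \<bullet> coroot s \<le> 0"
        using Sim_obtuse[OF t(1) that] inner_coroot_pos_iff[of t s] by auto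
      then show ?thesis by (simp add: mult_nonneg_nonpos)
    qed (simp add: t)
    \<comment> \<open>The total is non-negative by dominance while every summand is non-positive, so
      all summands vanish.\<close>
    have "(\<Sum>s\<in>Sim. - (of_nat (m s) * (t \<bullet> coroot s))) = 0"
      using ge sum_nonpos[of Sim "\<lambda>s. of_nat (m s) * (t \<bullet> coroot s)"] le by (simp add: sum_negf)
    then have "of_nat (m s) * (t \<bullet> coroot s) = 0" if "s \<in> Sim" for s
      using sum_nonneg_eq_0_iff[OF finite_Sim, of "\<lambda>s. - (of_nat (m s) * (t \<bullet> coroot s))"] le that by auto
    then have "t \<bullet> coroot s = 0" using \<open>s \<in> I1\<close> by (fastforce simp: I1_def)
    then show ?thesis by (simp add: inner_coroot_eq_0_iff inner_commute)
  qed
  ultimately have "I2 = {}" using simple_roots_connected[OF U] by blast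
  then have mpos: "0 < m s" if "s \<in> Sim" for s using that by (auto simp: I2_def)
  have bs: "0 \<le> b \<bullet> coroot s" if "s \<in> Sim" for s
    using coroot_max_dominant[OF assms(2) that] inner_coroot_neg_iff[of b s] by linarith
  obtain t where t: "t \<in> Sim" "0 < b \<bullet> t" using ex_Sim_acute[OF ab(2)] by blast
  have "0 < (\<Sum>s\<in>Sim. of_nat (m s) * (b \<bullet> coroot s))"
    using finite_Sim t mpos bs by (intro sum_pos2[of _ t]) (auto simp: inner_coroot_pos_iff)
  then have "0 < b \<bullet> a" by (simp add: m inner_sum_right flip: inner_coroot_pos_iff)
  then have "\<exists>c\<in>R. coroot a - coroot b = coroot c"
    using coroot_diff[OF ab(3,4)] ne by (metis inner_commute)
  then obtain c where c: "c \<in> R" "coroot a - coroot b = coroot c" by blast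
  then consider "c \<in> Pos" | "- c \<in> Pos" using Pos_cases by blast
  then show False
  proof cases
    case 1
    then have "coroot_le b a" using c Pos_coroot_nat_cone by (simp add: coroot_le_def)
    then show False using assms ab ne by (auto simp: coroot_max_def)
  next
    case 2
    have "coroot b - coroot a = coroot (- c)" using c by (simp add: coroot_uminus algebra_simps)
    then have "coroot_le a b" using 2 Pos_coroot_nat_cone by (simp add: coroot_le_def)
    then show False using assms ab ne by (auto simp: coroot_max_def)
  qed
qed

lemma alpha0_Pos: "alpha0 R x0 \<in> Pos"
  and alpha0_highest: "b \<in> Pos \<Longrightarrow> coroot_le b (alpha0 R x0)"
proof -
  have iff: "(\<exists>m::'v \<Rightarrow> nat. coroot a - coroot b = (\<Sum>s\<in>Sim. of_nat (m s) *\<^sub>R coroot s)) \<longleftrightarrow> coroot_le b a" for a b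
    by (simp add: coroot_le_def nat_cone_def)
  obtain s where "s \<in> Pos" using Sim_nonempty Sim_Pos by blast
  then obtain a where a: "coroot_max a" using ex_coroot_max by blast
  have high: "coroot_le b a" if "b \<in> Pos" for b
    using ex_coroot_max[OF that] coroot_max_unique[OF a] by blast
  have "alpha0 R x0 = a"
    unfolding alpha0_def iff
  proof (rule the_equality)
    show "a \<in> Pos \<and> (\<forall>b\<in>Pos. coroot_le b a)" using a high by (simp add: coroot_max_def)
  next
    fix c assume "c \<in> Pos \<and> (\<forall>b\<in>Pos. coroot_le b c)"
    then show "c = a" using a by (auto simp: coroot_max_def)
  qed
  then show "alpha0 R x0 \<in> Pos" "b \<in> Pos \<Longrightarrow> coroot_le b (alpha0 R x0)"
    using a high by (simp_all add: coroot_max_def)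
qed

section \<open>The extended affine Weyl group and its length function\<close>

lemma weights_add: "l \<in> weights R \<Longrightarrow> m \<in> weights R \<Longrightarrow> l + m \<in> weights R"
  by (auto simp: weights_def inner_simps)

lemma weights_uminus: "l \<in> weights R \<Longrightarrow> - l \<in> weights R"
  by (auto simp: weights_def)

lemma weights_zero: "0 \<in> weights R"
  by (auto simp: weights_def)

lemma R_weights: "a \<in> R \<Longrightarrow> a \<in> weights R"
  by (auto simp: weights_def cartan_int)

lemma W0_id: "id \<in> W0 R"
  unfolding W0_def by (intro CollectI exI[of _ "[]"]) simp

lemma W0_Cons: "a \<in> R \<Longrightarrow> w \<in> W0 R \<Longrightarrow> refl a \<circ> w \<in> W0 R"
proof -
  assume a: "a \<in> R" and "w \<in> W0 R"
  then obtain as where "set as \<subseteq> R" "w = foldr (\<circ>) (map refl as) id" by (auto simp: W0_def)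
  then show ?thesis unfolding W0_def using a by (intro CollectI exI[of _ "a # as"]) simp
qed

lemma W0_induct [consumes 1, case_names id refl]:
  assumes "w \<in> W0 R" "P id"
    and step: "\<And>a w. a \<in> R \<Longrightarrow> w \<in> W0 R \<Longrightarrow> P w \<Longrightarrow> P (refl a \<circ> w)"
  shows "P w"
proof -
  have "P (foldr (\<circ>) (map refl as) id) \<and> foldr (\<circ>) (map refl as) id \<in> W0 R" if "set as \<subseteq> R" for as
    using that by (induction as) (use assms(2) W0_id in \<open>simp_all add: step W0_Cons\<close>)
  then show ?thesis using assms(1) by (auto simp: W0_def)
qed

lemma W0_refl: "a \<in> R \<Longrightarrow> refl a \<in> W0 R"
  using W0_Cons[OF _ W0_id] by simp

lemma W0_comp: "v \<in> W0 R \<Longrightarrow> w \<in> W0 R \<Longrightarrow> v \<circ> w \<in> W0 R"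
  by (induction rule: W0_induct) (simp_all add: W0_Cons flip: o_assoc)

lemma W0_linear: "w \<in> W0 R \<Longrightarrow> linear w"
proof (induction rule: W0_induct)
  case id
  then show ?case by (simp add: id_def linear_ident)
next
  case (refl a w)
  then show ?case using linear_compose linear_refl by blast
qed

lemma W0_isometry: "w \<in> W0 R \<Longrightarrow> w x \<bullet> w y = x \<bullet> y"
  by (induction rule: W0_induct) (simp_all add: refl_isometry)

lemma W0_coroot: "w \<in> W0 R \<Longrightarrow> coroot (w a) = w (coroot a)"
  by (simp add: coroot_def W0_isometry linear_scale[OF W0_linear])

lemma W0_root: "w \<in> W0 R \<Longrightarrow> a \<in> R \<Longrightarrow> w a \<in> R"
  by (induction rule: W0_induct) (simp_all add: refl_in_R)

lemma W0_ex_inverse: "w \<in> W0 R \<Longrightarrow> \<exists>v\<in>W0 R. w \<circ> v = id \<and> v \<circ> w = id"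
proof (induction rule: W0_induct)
  case id
  then show ?case using W0_id by (intro bexI[of _ id]) auto
next
  case (refl a w)
  then obtain v where v: "v \<in> W0 R" "w \<circ> v = id" "v \<circ> w = id" by blast
  have "(refl a \<circ> w) \<circ> (v \<circ> refl a) = id" "(v \<circ> refl a) \<circ> (refl a \<circ> w) = id"
    using v(2,3) by (auto simp: fun_eq_iff refl_refl)
  then show ?case using W0_comp[OF v(1) W0_refl[OF refl(1)]] by blast
qed

lemma W0_inv: "w \<in> W0 R \<Longrightarrow> inv w \<in> W0 R"
  using W0_ex_inverse by (metis inv_unique_comp)

lemma W0_bij: "w \<in> W0 R \<Longrightarrow> bij w"
  using W0_ex_inverse by (metis o_bij)

lemma W0_inv_simps: "w \<in> W0 R \<Longrightarrow> inv w (w x) = x" "w \<in> W0 R \<Longrightarrow> w (inv w x) = x"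
  using W0_bij by (simp_all add: bij_is_inj bij_is_surj surj_f_inv_f)

lemma W0_shift: "w \<in> W0 R \<Longrightarrow> w x \<bullet> y = x \<bullet> inv w y"
  by (metis W0_isometry W0_inv_simps(2))

lemma W0_weights: "w \<in> W0 R \<Longrightarrow> l \<in> weights R \<Longrightarrow> w l \<in> weights R"
  using W0_root[OF W0_inv] by (auto simp: weights_def W0_shift simp flip: W0_coroot[OF W0_inv])

lemma Wext_affineI:
  assumes "g \<in> W0 R" "l \<in> weights R"
  shows "(\<lambda>x. g x + l) \<in> Wext R"
  unfolding Wext_def using assms
  by (intro CollectI exI[of _ "[transl l, g]"]) (auto simp: transl_def fun_eq_iff)

lemma Wext_affineE:
  assumes "w \<in> Wext R"
  obtains g l where "g \<in> W0 R" "l \<in> weights R" "w = (\<lambda>x. g x + l)"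
proof -
  have "\<exists>g\<in>W0 R. \<exists>l\<in>weights R. foldr (\<circ>) gs id = (\<lambda>x. g x + l)"
    if "set gs \<subseteq> W0 R \<union> transl ` weights R" for gs
    using that
  proof (induction gs)
    case Nil
    show ?case by (intro bexI[of _ id] bexI[of _ 0]) (auto simp: W0_id weights_zero)
  next
    case (Cons h gs)
    then obtain g l where gl: "g \<in> W0 R" "l \<in> weights R" "foldr (\<circ>) gs id = (\<lambda>x. g x + l)"
      by (metis insert_subset list.simps(15))
    consider "h \<in> W0 R" | m where "m \<in> weights R" "h = transl m" using Cons.prems by auto
    then show ?case
    proof cases
      case 1
      then have "foldr (\<circ>) (h # gs) id = (\<lambda>x. (h \<circ> g) x + h l)"
        unfolding foldr_Cons o_apply gl(3) using linear_add[OF W0_linear[OF 1]] by auto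
      then show ?thesis using W0_comp[OF 1 gl(1)] W0_weights[OF 1 gl(2)] by blast
    next
      case 2
      then have "foldr (\<circ>) (h # gs) id = (\<lambda>x. g x + (l + m))"
        unfolding foldr_Cons o_apply gl(3) by (auto simp: transl_def)
      then show ?thesis using gl(1) weights_add[OF gl(2) 2(1)] by blast
    qed
  qed
  then show thesis using assms that by (auto simp: Wext_def)
qed

lemma W0_Wext: "w \<in> W0 R \<Longrightarrow> w \<in> Wext R"
  using Wext_affineI[of w 0] by (simp add: weights_zero)

lemma Wext_id: "id \<in> Wext R"
  by (simp add: W0_Wext W0_id)

lemma transl_Wext: "l \<in> weights R \<Longrightarrow> transl l \<in> Wext R"
  using Wext_affineI[OF W0_id, of l] by (simp add: transl_def)

lemma Wext_comp: "v \<in> Wext R \<Longrightarrow> w \<in> Wext R \<Longrightarrow> v \<circ> w \<in> Wext R"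
proof (elim Wext_affineE)
  fix g l h m assume a: "g \<in> W0 R" "l \<in> weights R" "v = (\<lambda>x. g x + l)" "h \<in> W0 R" "m \<in> weights R" "w = (\<lambda>x. h x + m)"
  have "v \<circ> w = (\<lambda>x. (g \<circ> h) x + (g m + l))" using W0_linear[OF a(1)] a by (auto simp: linear_add)
  then show ?thesis using a by (metis Wext_affineI W0_comp W0_weights weights_add)
qed

lemma Wext_ex_inverse: "w \<in> Wext R \<Longrightarrow> \<exists>v\<in>Wext R. w \<circ> v = id \<and> v \<circ> w = id"
proof (elim Wext_affineE)
  fix g l assume a: "g \<in> W0 R" "l \<in> weights R" "w = (\<lambda>x. g x + l)"
  have lin: "linear (inv g)" using W0_linear[OF W0_inv[OF a(1)]] .
  have "w \<circ> (\<lambda>x. inv g x + inv g (- l)) = id" "(\<lambda>x. inv g x + inv g (- l)) \<circ> w = id"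
    using a linear_diff[OF W0_linear[OF a(1)]]
    by (auto simp: fun_eq_iff linear_add[OF lin] linear_neg[OF lin] W0_inv_simps)
  then show ?thesis using Wext_affineI[OF W0_inv[OF a(1)] W0_weights[OF W0_inv[OF a(1)] weights_uminus[OF a(2)]]] by blast
qed

lemma Wext_inv: "w \<in> Wext R \<Longrightarrow> inv w \<in> Wext R"
  using Wext_ex_inverse by (metis inv_unique_comp)

lemma Wext_bij: "w \<in> Wext R \<Longrightarrow> bij w"
  using Wext_ex_inverse by (metis o_bij)

lemma Wext_inv_simps: "w \<in> Wext R \<Longrightarrow> inv w (w x) = x" "w \<in> Wext R \<Longrightarrow> w (inv w x) = x"
  using Wext_bij by (simp_all add: bij_is_inj bij_is_surj surj_f_inv_f)

lemma Wext_inv_comp: "w \<in> Wext R \<Longrightarrow> inv w \<circ> w = id" "w \<in> Wext R \<Longrightarrow> w \<circ> inv w = id"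
  by (simp_all add: fun_eq_iff Wext_inv_simps)

lemma Wext_inv_inv: "w \<in> Wext R \<Longrightarrow> inv (inv w) = w"
  by (simp add: inv_inv_eq Wext_bij)

lemma Wext_inv_o: "v \<in> Wext R \<Longrightarrow> w \<in> Wext R \<Longrightarrow> inv (v \<circ> w) = inv w \<circ> inv v"
  by (simp add: o_inv_distrib Wext_bij)

lemma Wext_weights: "w \<in> Wext R \<Longrightarrow> l \<in> weights R \<Longrightarrow> w l \<in> weights R"
  by (elim Wext_affineE) (simp add: weights_add W0_weights)

lemma Wext_bij_weights: "w \<in> Wext R \<Longrightarrow> bij_betw w (weights R) (weights R)"
  by (rule bij_betwI[of _ _ _ "inv w"]) (auto simp: Wext_weights Wext_inv Wext_inv_simps)

section \<open>Affine roots and a base point of the alcove\<close>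

text \<open>Affine roots are functions rather than pairs of a root and an integer, so that the group
  acts by composition. Both orientations of every hyperplane occur; the condition
  \<open>0 < \<phi> bp\<close> selects one.\<close>

definition Aff :: "('v \<Rightarrow> real) set" where
  "Aff = {\<phi>. \<exists>a\<in>R. \<exists>k::int. \<phi> = (\<lambda>x. x \<bullet> coroot a - of_int k)}"

lemma AffI: "a \<in> R \<Longrightarrow> (\<lambda>x. x \<bullet> coroot a - of_int k) \<in> Aff"
  by (auto simp: Aff_def)

lemma Aff_cases:
  assumes "\<phi> \<in> Aff"
  obtains (pos) a k where "a \<in> Pos" "\<phi> = (\<lambda>x. x \<bullet> coroot a - of_int k)"
  | (neg) a k where "a \<in> Pos" "\<phi> = (\<lambda>x. of_int k - x \<bullet> coroot a)"
proof -
  obtain a k where a: "a \<in> R" "\<phi> = (\<lambda>x. x \<bullet> coroot a - of_int k)" using assms by (auto simp: Aff_def)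
  from Pos_cases[OF a(1)] show thesis
  proof
    assume "- a \<in> Pos"
    moreover have "\<phi> = (\<lambda>x. of_int (- k) - x \<bullet> coroot (- a))" by (simp add: a(2) coroot_uminus)
    ultimately show thesis by (rule neg)
  qed (rule pos, simp_all add: a)
qed

lemma Aff_posI: "a \<in> Pos \<Longrightarrow> (\<lambda>x. x \<bullet> coroot a - of_int k) \<in> Aff"
  by (simp add: AffI Pos_R)

lemma Aff_negI: "a \<in> Pos \<Longrightarrow> (\<lambda>x. of_int k - x \<bullet> coroot a) \<in> Aff"
  using AffI[OF uminus_in_R[OF Pos_R], of a "- k"] by (simp add: coroot_uminus algebra_simps)

lemma Aff_uminus: "\<phi> \<in> Aff \<Longrightarrow> (\<lambda>x. - \<phi> x) \<in> Aff"
  by (elim Aff_cases) (simp_all add: Aff_negI Aff_posI)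

text \<open>The translation part shifts the constant by \<open>l \<bullet> coroot a\<close>, an
  integer because \<open>l\<close> is a weight.\<close>

lemma Aff_comp: "\<phi> \<in> Aff \<Longrightarrow> w \<in> Wext R \<Longrightarrow> \<phi> \<circ> w \<in> Aff"
proof (elim Wext_affineE)
  fix g l assume \<phi>: "\<phi> \<in> Aff" and w: "g \<in> W0 R" "l \<in> weights R" "w = (\<lambda>x. g x + l)"
  obtain a k where a: "a \<in> R" "\<phi> = (\<lambda>x. x \<bullet> coroot a - of_int k)" using \<phi> by (auto simp: Aff_def)
  obtain m :: int where m: "l \<bullet> coroot a = of_int m" using w(2) a(1) by (auto simp: weights_def elim: Ints_cases)
  have "\<phi> \<circ> w = (\<lambda>x. x \<bullet> coroot (inv g a) - of_int (k - m))"
    using a w m by (auto simp: fun_eq_iff inner_simps W0_shift W0_coroot[OF W0_inv])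
  then show "\<phi> \<circ> w \<in> Aff" using AffI[OF W0_root[OF W0_inv[OF w(1)] a(1)]] by metis
qed

text \<open>A small multiple of \<open>x0\<close> lies in the alcove. The sum over all roots bounds
  every single pairing, and the added 1 makes the bound strict and the denominator positive.\<close>

definition bp :: 'v where
  "bp = (1 / (1 + (\<Sum>a\<in>R. \<bar>x0 \<bullet> coroot a\<bar>))) *\<^sub>R x0"

lemma bp_alcove: "bp \<in> alcoveA R x0"
  unfolding alcoveA_def
proof (intro CollectI ballI)
  fix a assume a: "a \<in> Pos"
  have "\<bar>x0 \<bullet> coroot a\<bar> \<le> (\<Sum>a\<in>R. \<bar>x0 \<bullet> coroot a\<bar>)"
    using finite_R a by (intro member_le_sum) (auto simp: Pos_R)
  moreover have "0 < x0 \<bullet> coroot a" using Pos_inner_coroot[OF a] .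
  ultimately show "0 < bp \<bullet> coroot a \<and> bp \<bullet> coroot a < 1"
    unfolding bp_def inner_scaleR_left by (simp add: field_simps)
qed

lemma alcoveD: "x \<in> alcoveA R x0 \<Longrightarrow> a \<in> Pos \<Longrightarrow> 0 < x \<bullet> coroot a \<and> x \<bullet> coroot a < 1"
  by (simp add: alcoveA_def)

lemma bp_coord: "a \<in> Pos \<Longrightarrow> 0 < bp \<bullet> coroot a" "a \<in> Pos \<Longrightarrow> bp \<bullet> coroot a < 1"
  using alcoveD[OF bp_alcove] by simp_all

text \<open>Coroot coordinates on the alcove lie strictly between 0 and 1, so an integer level is on
  the same side of all of them.\<close>

lemma Aff_alcove_sign:
  assumes "\<phi> \<in> Aff" "x \<in> alcoveA R x0"
  shows "\<phi> x \<noteq> 0" and "0 < \<phi> x \<longleftrightarrow> 0 < \<phi> bp"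
proof -
  have "\<phi> x \<noteq> 0 \<and> (0 < \<phi> x \<longleftrightarrow> 0 < \<phi> bp)"
    using assms(1)
  proof (cases rule: Aff_cases)
    case (pos a k)
    have "0 < x \<bullet> coroot a" "x \<bullet> coroot a < 1" using alcoveD[OF assms(2) pos(1)] by auto
    then show ?thesis using pos bp_coord[OF pos(1)] by (cases "k \<le> 0") auto
  next
    case (neg a k)
    have "0 < x \<bullet> coroot a" "x \<bullet> coroot a < 1" using alcoveD[OF assms(2) neg(1)] by auto
    then show ?thesis using neg bp_coord[OF neg(1)] by (cases "k \<le> 0") auto
  qed
  then show "\<phi> x \<noteq> 0" and "0 < \<phi> x \<longleftrightarrow> 0 < \<phi> bp" by simp_all
qed

lemma Aff_alcove_sign_neg: "\<phi> \<in> Aff \<Longrightarrow> x \<in> alcoveA R x0 \<Longrightarrow> \<phi> x < 0 \<longleftrightarrow> \<phi> bp < 0"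
  using Aff_alcove_sign[OF Aff_uminus, of \<phi> x] by simp

lemma Aff_bp_nz: "\<phi> \<in> Aff \<Longrightarrow> \<phi> bp \<noteq> 0"
  using Aff_alcove_sign(1)[OF _ bp_alcove] .

lemma alcove_iff: "x \<in> alcoveA R x0 \<longleftrightarrow> (\<forall>\<phi>\<in>Aff. 0 < \<phi> bp \<longrightarrow> 0 < \<phi> x)"
proof
  assume r: "\<forall>\<phi>\<in>Aff. 0 < \<phi> bp \<longrightarrow> 0 < \<phi> x"
  have "0 < x \<bullet> coroot a \<and> x \<bullet> coroot a < 1" if "a \<in> Pos" for a
    using r[rule_format, OF Aff_posI[OF that, of 0]] r[rule_format, OF Aff_negI[OF that, of 1]]
      bp_coord[OF that] by simp
  then show "x \<in> alcoveA R x0" by (simp add: alcoveA_def)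
qed (simp add: Aff_alcove_sign)

text \<open>The origin is a vertex of the alcove.\<close>

lemma Aff_zero_nonneg:
  assumes "\<phi> \<in> Aff" "0 < \<phi> bp"
  shows "0 \<le> \<phi> 0"
  using assms(1)
proof (cases rule: Aff_cases)
  case (pos a k)
  then have "real_of_int k < 1" using assms(2) bp_coord[OF pos(1)] by simp
  then show ?thesis using pos by simp
next
  case (neg a k)
  then have "real_of_int k > 0" using assms(2) bp_coord[OF neg(1)] by simp
  then show ?thesis using neg by simp
qed

text \<open>The affine root of the wall of generator \<open>j\<close>, oriented to be positive on
  the alcove. In \<open>gens\<close> the level is 0 for simple walls and 1 for the wall of
  \<open>alpha0\<close>, so testing \<open>snd j\<close> selects the orientation.\<close>

definition rt :: "'v \<times> int \<Rightarrow> 'v \<Rightarrow> real" where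
  "rt j = (if snd j = 0 then (\<lambda>x. x \<bullet> coroot (fst j) - of_int (snd j))
    else (\<lambda>x. of_int (snd j) - x \<bullet> coroot (fst j)))"

lemma gens_cases:
  assumes "j \<in> gens R x0"
  obtains (affine) "j = (alpha0 R x0, 1)" | (finite) s where "s \<in> Sim" "j = (s, 0)"
  using assms by (auto simp: gens_def)

lemma gens_fst_Pos: "j \<in> gens R x0 \<Longrightarrow> fst j \<in> Pos"
  by (elim gens_cases) (simp_all add: alpha0_Pos Sim_Pos)

lemma rt_Aff: "j \<in> gens R x0 \<Longrightarrow> rt j \<in> Aff"
  unfolding rt_def by (simp only: Aff_posI Aff_negI gens_fst_Pos if_True if_False split: if_split) simp

lemma rt_bp_pos: "j \<in> gens R x0 \<Longrightarrow> 0 < rt j bp"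
  by (elim gens_cases) (simp_all add: rt_def bp_coord alpha0_Pos Sim_Pos)

lemma sgen_affine: "sgen j = (\<lambda>x. refl (fst j) x + of_int (snd j) *\<^sub>R fst j)"
  by (auto simp: sgen_def refl_def fun_eq_iff algebra_simps)

lemma sgen_Wext: "j \<in> gens R x0 \<Longrightarrow> sgen j \<in> Wext R"
proof -
  assume j: "j \<in> gens R x0"
  have "of_int (snd j) *\<^sub>R fst j \<in> weights R"
    using j by (elim gens_cases) (simp_all add: weights_zero R_weights Pos_R alpha0_Pos)
  then show ?thesis unfolding sgen_affine by (intro Wext_affineI W0_refl Pos_R gens_fst_Pos j)
qed

lemma sgen_sgen: "j \<in> gens R x0 \<Longrightarrow> sgen j (sgen j x) = x"
  using R_nz[OF Pos_R[OF gens_fst_Pos]] by (simp add: sgen_def inner_simps inner_coroot_self algebra_simps scaleR_2)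

lemma sgen_comp: "j \<in> gens R x0 \<Longrightarrow> sgen j \<circ> sgen j = id"
  by (simp add: fun_eq_iff sgen_sgen)

lemma sgen_inv: "j \<in> gens R x0 \<Longrightarrow> inv (sgen j) = sgen j"
  by (rule inv_unique_comp) (simp_all add: sgen_comp)

lemma rt_sgen: "j \<in> gens R x0 \<Longrightarrow> rt j (sgen j x) = - rt j x"
  using R_nz[OF Pos_R[OF gens_fst_Pos]] by (simp add: rt_def sgen_def inner_simps inner_coroot_self)

lemma rt_eq_0_iff: "rt j x = 0 \<longleftrightarrow> x \<bullet> coroot (fst j) = of_int (snd j)"
  by (auto simp: rt_def)

lemma sgen_fixed: "rt j x = 0 \<Longrightarrow> sgen j x = x"
  by (simp add: sgen_def rt_eq_0_iff)

text \<open>The witness is the midpoint of \<open>bp\<close> and its mirror image for a simple reflection, and the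
  multiple of \<open>x0\<close> lying on the mirror for the affine reflection.\<close>

lemma wall_point:
  assumes "j \<in> gens R x0"
  obtains y where "rt j y = 0" "\<And>\<phi>. \<phi> \<in> Aff \<Longrightarrow> 0 < \<phi> bp \<Longrightarrow> \<phi> \<noteq> rt j \<Longrightarrow> 0 < \<phi> y"
  using assms
proof (cases rule: gens_cases)
  case affine
  define y where "y = (1 / (x0 \<bullet> coroot (alpha0 R x0))) *\<^sub>R x0"
  have p0: "0 < x0 \<bullet> coroot (alpha0 R x0)" using Pos_inner_coroot[OF alpha0_Pos] .
  have y0: "y \<bullet> coroot (alpha0 R x0) = 1" using p0 by (simp add: y_def)
  have ya: "0 < y \<bullet> coroot a" "a \<noteq> alpha0 R x0 \<Longrightarrow> y \<bullet> coroot a < 1" if "a \<in> Pos" for a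
    using that p0 Pos_inner_coroot[OF that] coroot_le_less_x0[OF alpha0_highest[OF that]]
    by (auto simp: y_def)
  have "rt j y = 0" using affine y0 by (simp add: rt_eq_0_iff)
  moreover have "0 < \<phi> y" if \<phi>: "\<phi> \<in> Aff" "0 < \<phi> bp" "\<phi> \<noteq> rt j" for \<phi>
    using \<phi>(1)
  proof (cases rule: Aff_cases)
    case (pos a k)
    then have "real_of_int k < 1" using \<phi>(2) bp_coord[OF pos(1)] by simp
    then have "real_of_int k \<le> 0" by simp
    then show ?thesis using pos ya[OF pos(1)] by simp
  next
    case (neg a k)
    then have k0: "k \<ge> 1" using \<phi>(2) bp_coord[OF neg(1)] by (cases "k \<ge> 1") auto
    show ?thesis
    proof (cases "a = alpha0 R x0")
      case True
      then have "k \<noteq> 1" using \<phi>(3) neg affine by (auto simp: rt_def)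
      then show ?thesis using k0 True neg y0 by simp
    next
      case False
      have "1 \<le> real_of_int k" using k0 by simp
      then show ?thesis using neg(2) ya(2)[OF neg(1) False] by simp
    qed
  qed
  ultimately show thesis by (rule that)
next
  case (finite s)
  define y where "y = (1/2) *\<^sub>R (bp + refl s bp)"
  have ye: "y \<bullet> coroot a = (bp \<bullet> coroot a + bp \<bullet> coroot (refl s a)) / 2" for a
    by (simp add: y_def inner_simps refl_inner_shift coroot_refl)
  have y0: "y \<bullet> coroot s = 0" by (simp add: ye refl_self coroot_uminus)
  have ya: "0 < y \<bullet> coroot a" "y \<bullet> coroot a < 1" if "a \<in> Pos" "a \<noteq> s" for a
    using bp_coord[OF that(1)] bp_coord[OF refl_simple_Pos[OF finite(1) that]] by (simp_all add: ye)
  have "rt j y = 0" using finite y0 by (simp add: rt_eq_0_iff)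
  moreover have "0 < \<phi> y" if \<phi>: "\<phi> \<in> Aff" "0 < \<phi> bp" "\<phi> \<noteq> rt j" for \<phi>
    using \<phi>(1)
  proof (cases rule: Aff_cases)
    case (pos a k)
    then have "real_of_int k < 1" using \<phi>(2) bp_coord[OF pos(1)] by simp
    then have k0: "k \<le> 0" by simp
    show ?thesis
    proof (cases "a = s")
      case True
      then have "k \<noteq> 0" using \<phi>(3) pos finite by (auto simp: rt_def)
      then show ?thesis using k0 True pos y0 by simp
    next
      case False
      have "real_of_int k \<le> 0" using k0 by simp
      then show ?thesis using pos(2) ya(1)[OF pos(1) False] by simp
    qed
  next
    case (neg a k)
    then have "k \<ge> 1" using \<phi>(2) bp_coord[OF neg(1)] by (cases "k \<ge> 1") auto
    then have "real_of_int k \<ge> 1" by simp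
    then show ?thesis using neg ya[OF neg(1)] y0 by (cases "a = s") auto
  qed
  ultimately show thesis by (rule that)
qed

text \<open>If \<open>\<phi>\<close> changed sign, minus its reflection would be positive on the
  alcove, hence non-negative at a suitable point of the wall. The reflection fixes that point, and
  \<open>\<phi>\<close> is strictly positive there.\<close>

lemma sgen_flips_only_rt:
  assumes j: "j \<in> gens R x0" and \<phi>: "\<phi> \<in> Aff" "0 < \<phi> bp" "\<phi> \<noteq> rt j"
  shows "0 < \<phi> (sgen j bp)"
proof (rule ccontr)
  assume neg: "\<not> 0 < \<phi> (sgen j bp)"
  obtain y where y: "rt j y = 0" "\<And>\<phi>. \<phi> \<in> Aff \<Longrightarrow> 0 < \<phi> bp \<Longrightarrow> \<phi> \<noteq> rt j \<Longrightarrow> 0 < \<phi> y"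
    using wall_point[OF j] by blast
  let ?\<psi> = "\<lambda>x. - (\<phi> \<circ> sgen j) x"
  have A: "?\<psi> \<in> Aff" using Aff_uminus[OF Aff_comp[OF \<phi>(1) sgen_Wext[OF j]]] .
  have "0 < ?\<psi> bp" using Aff_bp_nz[OF A] neg by simp
  \<comment> \<open>The inequality is weak to cover the case \<open>?\<psi> = rt j\<close>, where
    the value at \<open>y\<close> is 0.\<close>
  then have "0 \<le> ?\<psi> y" using y(1) y(2)[OF A] by (metis less_eq_real_def)
  then show False using y(2)[OF \<phi>] sgen_fixed[OF y(1)] by simp
qed

section \<open>Inversion sets and the length function\<close>

definition Inv :: "('v \<Rightarrow> 'v) \<Rightarrow> ('v \<Rightarrow> real) set" where
  "Inv w = {\<phi> \<in> Aff. 0 < \<phi> bp \<and> \<phi> (w bp) < 0}"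

lemma finite_Inv: "finite (Inv w)"
proof -
  let ?I = "\<lambda>a. {\<lfloor>min (bp \<bullet> coroot a) (w bp \<bullet> coroot a)\<rfloor>..\<lceil>max (bp \<bullet> coroot a) (w bp \<bullet> coroot a)\<rceil>}"
  have "Inv w \<subseteq> (\<Union>a\<in>R. (\<lambda>k x. x \<bullet> coroot a - of_int k) ` ?I a)"
  proof
    fix \<phi> assume "\<phi> \<in> Inv w"
    then obtain a k where a: "a \<in> R" "\<phi> = (\<lambda>x. x \<bullet> coroot a - of_int k)"
      "0 < bp \<bullet> coroot a - of_int k" "w bp \<bullet> coroot a - of_int k < 0"
      by (auto simp: Inv_def Aff_def)
    have "min (bp \<bullet> coroot a) (w bp \<bullet> coroot a) \<le> of_int k" "of_int k \<le> max (bp \<bullet> coroot a) (w bp \<bullet> coroot a)"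
      using a(3,4) by linarith+
    then have "k \<in> ?I a" by (metis atLeastAtMost_iff floor_mono ceiling_mono floor_of_int ceiling_of_int)
    then show "\<phi> \<in> (\<Union>a\<in>R. (\<lambda>k x. x \<bullet> coroot a - of_int k) ` ?I a)" using a(1,2) by blast
  qed
  then show ?thesis using finite_R by (meson finite_UN_I finite_atLeastAtMost_int finite_imageI finite_subset)
qed

text \<open>Equal zero sets make the coroots proportional; the factor is positive since both
  functions are positive at \<open>bp\<close>, and reducedness then makes it 1.\<close>

lemma hyperplane_inject:
  assumes "\<phi> \<in> Aff" "\<psi> \<in> Aff" "0 < \<phi> bp" "0 < \<psi> bp" "{x. \<phi> x = 0} = {x. \<psi> x = 0}"
  shows "\<phi> = \<psi>"
proof -
  obtain a k b m where a: "a \<in> R" "\<phi> = (\<lambda>x. x \<bullet> coroot a - of_int k)"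
    and b: "b \<in> R" "\<psi> = (\<lambda>x. x \<bullet> coroot b - of_int m)"
    using assms(1,2) by (auto simp: Aff_def)
  define A B where "A = coroot a" and "B = coroot b"
  have nz: "A \<noteq> 0" "B \<noteq> 0" using a b R_nz by (auto simp: A_def B_def coroot_eq_0_iff)
  have z: "x \<bullet> A = of_int k \<longleftrightarrow> x \<bullet> B = of_int m" for x
    using assms(5) by (auto simp: a b A_def B_def set_eq_iff)
  define p where "p = (of_int k / (A \<bullet> A)) *\<^sub>R A"
  have pA: "p \<bullet> A = of_int k" using nz by (simp add: p_def)
  then have pB: "p \<bullet> B = of_int m" using z by simp
  \<comment> \<open>\<open>y\<close> is the component of \<open>B\<close> orthogonal to
    \<open>A\<close>. Moving from \<open>p\<close> along \<open>y\<close> stays on the common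
    hyperplane, so \<open>y\<close> is orthogonal to \<open>B\<close> as well and therefore
    zero.\<close>
  define c where "c = (B \<bullet> A) / (A \<bullet> A)"
  define y where "y = B - c *\<^sub>R A"
  have yA: "y \<bullet> A = 0" using nz by (simp add: y_def c_def inner_simps)
  then have "(p + y) \<bullet> A = of_int k" using pA by (simp only: inner_add_left add_0_right)
  then have "(p + y) \<bullet> B = of_int m" using z by blast
  then have "y \<bullet> B = 0" using pB by (simp add: inner_simps)
  then have "y \<bullet> (B - c *\<^sub>R A) = 0" using yA by (simp only: inner_diff_right inner_scaleR_right)
  then have "y \<bullet> y = 0" by (simp only: y_def)
  then have BA: "B = c *\<^sub>R A" by (simp add: y_def)
  have "of_int m = c * of_int k" using pA pB BA by simp
  then have "\<psi> bp = c * \<phi> bp" by (simp add: a b BA flip: A_def B_def) (simp add: algebra_simps)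
  then have cpos: "0 < c" using assms(3,4) by (simp add: zero_less_mult_iff)
  have "b = coroot (c *\<^sub>R A)" using BA by (metis B_def coroot_coroot)
  also have "\<dots> = (1 / c) *\<^sub>R a" using cpos by (simp add: A_def coroot_def)
  finally have "(1 / c) *\<^sub>R a \<in> R" using b(1) by simp
  then have "c = 1" using R_reduced[OF a(1), of "1 / c"] cpos by (auto simp: divide_eq_eq)
  then show ?thesis using BA \<open>of_int m = c * of_int k\<close> by (simp add: a b flip: A_def B_def)
qed

text \<open>The definition separates whole alcoves and counts hyperplanes as sets. An affine root
  positive at \<open>bp\<close> is such a hyperplane with a chosen side, and its signs at
  \<open>bp\<close> and \<open>w bp\<close> determine those on the two alcoves.\<close>

lemma len_eq: 
  assumes w: "w \<in> Wext R"
  shows "len R x0 w = card (Inv w)"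
proof -
  let ?P = "\<lambda>a (k::int). ((\<forall>x\<in>alcoveA R x0. x \<bullet> coroot a < of_int k) \<and>
        (\<forall>y\<in>w ` alcoveA R x0. y \<bullet> coroot a > of_int k)) \<or>
       ((\<forall>x\<in>alcoveA R x0. x \<bullet> coroot a > of_int k) \<and>
        (\<forall>y\<in>w ` alcoveA R x0. y \<bullet> coroot a < of_int k))"
  let ?S = "{H. \<exists>a\<in>Pos. \<exists>k::int. H = {x. x \<bullet> coroot a = of_int k} \<and> ?P a k}"
  have sep: "(\<forall>x\<in>alcoveA R x0. 0 < \<phi> x) \<and> (\<forall>x\<in>alcoveA R x0. \<phi> (w x) < 0)" if "\<phi> \<in> Inv w" for \<phi>
    using that Aff_alcove_sign(2)[of \<phi>] Aff_alcove_sign_neg[OF Aff_comp[OF _ w], of \<phi>] by (auto simp: Inv_def)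
  have "?S = (\<lambda>\<phi>. {x. \<phi> x = 0}) ` Inv w"
  proof (intro equalityI subsetI)
    fix H assume "H \<in> ?S"
    then obtain a k where a: "a \<in> Pos" "H = {x. x \<bullet> coroot a = of_int k}" and P: "?P a k" by blast
    from P show "H \<in> (\<lambda>\<phi>. {x. \<phi> x = 0}) ` Inv w"
    proof
      assume "(\<forall>x\<in>alcoveA R x0. x \<bullet> coroot a < of_int k) \<and> (\<forall>y\<in>w ` alcoveA R x0. y \<bullet> coroot a > of_int k)"
      then have "(\<lambda>x. of_int k - x \<bullet> coroot a) \<in> Inv w"
        using bp_alcove Aff_negI[OF a(1)] by (auto simp: Inv_def)
      moreover have "H = {x. of_int k - x \<bullet> coroot a = 0}" using a(2) by auto
      ultimately show ?thesis by (intro image_eqI[where x="\<lambda>x. of_int k - x \<bullet> coroot a"])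
    next
      assume "(\<forall>x\<in>alcoveA R x0. x \<bullet> coroot a > of_int k) \<and> (\<forall>y\<in>w ` alcoveA R x0. y \<bullet> coroot a < of_int k)"
      then have "(\<lambda>x. x \<bullet> coroot a - of_int k) \<in> Inv w"
        using bp_alcove Aff_posI[OF a(1)] by (auto simp: Inv_def)
      moreover have "H = {x. x \<bullet> coroot a - of_int k = 0}" using a(2) by auto
      ultimately show ?thesis by (intro image_eqI[where x="\<lambda>x. x \<bullet> coroot a - of_int k"])
    qed
  next
    fix H assume "H \<in> (\<lambda>\<phi>. {x. \<phi> x = 0}) ` Inv w"
    then obtain \<phi> where \<phi>: "\<phi> \<in> Inv w" "H = {x. \<phi> x = 0}" by blast
    then have "\<phi> \<in> Aff" by (simp add: Inv_def)
    then show "H \<in> ?S"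
    proof (cases rule: Aff_cases)
      case (pos a k)
      have "?P a k" using sep[OF \<phi>(1)] by (simp add: pos(2))
      moreover have "H = {x. x \<bullet> coroot a = of_int k}" using \<phi>(2) by (simp add: pos(2))
      ultimately show ?thesis using pos(1) by (intro CollectI bexI[of _ a] exI[of _ k]) simp_all
    next
      case (neg a k)
      have "?P a k" using sep[OF \<phi>(1)] by (simp add: neg(2))
      moreover have "H = {x. x \<bullet> coroot a = of_int k}" using \<phi>(2) by (auto simp: neg(2))
      ultimately show ?thesis using neg(1) by (intro CollectI bexI[of _ a] exI[of _ k]) simp_all
    qed
  qed
  moreover have "inj_on (\<lambda>\<phi>. {x. \<phi> x = 0}) (Inv w)"
    by (intro inj_onI hyperplane_inject) (auto simp: Inv_def)
  ultimately show ?thesis unfolding len_def by (simp add: card_image)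
qed

lemma rt_W_nz: "j \<in> gens R x0 \<Longrightarrow> w \<in> Wext R \<Longrightarrow> rt j (w bp) \<noteq> 0"
  using Aff_bp_nz[OF Aff_comp[OF rt_Aff]] by simp

lemma o_sgen_sgen: "j \<in> gens R x0 \<Longrightarrow> \<phi> \<circ> sgen j \<circ> sgen j = \<phi>"
  by (simp add: fun_eq_iff sgen_sgen)

lemma sgen_o_sgen: "j \<in> gens R x0 \<Longrightarrow> sgen j \<circ> (sgen j \<circ> w) = w"
  by (simp add: fun_eq_iff sgen_sgen)

text \<open>The reflection moves the alcove across the wall of \<open>rt j\<close> and across no
  other hyperplane. Hence it carries the inversions of \<open>w\<close> to inversions of
  \<open>sgen j \<circ> w\<close>, with \<open>rt j\<close> as the one new element.\<close>

lemma len_sgen_up: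
  assumes j: "j \<in> gens R x0" and w: "w \<in> Wext R" and pos: "0 < rt j (w bp)"
  shows "len R x0 (sgen j \<circ> w) = Suc (len R x0 w)"
proof -
  have "Inv (sgen j \<circ> w) = insert (rt j) ((\<lambda>\<phi>. \<phi> \<circ> sgen j) ` Inv w)"
  proof (intro equalityI subsetI)
    fix \<phi> assume \<phi>: "\<phi> \<in> Inv (sgen j \<circ> w)"
    show "\<phi> \<in> insert (rt j) ((\<lambda>\<phi>. \<phi> \<circ> sgen j) ` Inv w)"
    proof (cases "\<phi> = rt j")
      case False
      then have "\<phi> \<circ> sgen j \<in> Inv w"
        using \<phi> sgen_flips_only_rt[OF j, of \<phi>] Aff_comp[OF _ sgen_Wext[OF j], of \<phi>] by (simp add: Inv_def)
      then show ?thesis using o_sgen_sgen[OF j, of \<phi>] by (metis image_eqI insertI2)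
    qed simp
  next
    fix \<phi> assume "\<phi> \<in> insert (rt j) ((\<lambda>\<phi>. \<phi> \<circ> sgen j) ` Inv w)"
    then consider "\<phi> = rt j" | \<psi> where "\<psi> \<in> Inv w" "\<phi> = \<psi> \<circ> sgen j" by blast
    then show "\<phi> \<in> Inv (sgen j \<circ> w)"
    proof cases
      case 1
      then show ?thesis using pos rt_bp_pos[OF j] rt_Aff[OF j] by (simp add: Inv_def rt_sgen[OF j])
    next
      case 2
      then have "\<psi> \<noteq> rt j" using pos by (auto simp: Inv_def)
      then show ?thesis
        using 2 sgen_flips_only_rt[OF j, of \<psi>] Aff_comp[OF _ sgen_Wext[OF j], of \<psi>] sgen_sgen[OF j]
        by (simp add: Inv_def)
    qed
  qed
  moreover have "rt j \<notin> (\<lambda>\<phi>. \<phi> \<circ> sgen j) ` Inv w"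
  proof
    assume "rt j \<in> (\<lambda>\<phi>. \<phi> \<circ> sgen j) ` Inv w"
    then obtain \<psi> where "\<psi> \<in> Inv w" "rt j = \<psi> \<circ> sgen j" by blast
    then have "\<psi> bp = rt j (sgen j bp)" "0 < \<psi> bp" by (simp_all add: sgen_sgen[OF j] Inv_def)
    then show False using rt_sgen[OF j] rt_bp_pos[OF j] by simp
  qed
  moreover have "inj_on (\<lambda>\<phi>. \<phi> \<circ> sgen j) (Inv w)"
    by (intro inj_onI) (metis o_sgen_sgen[OF j])
  ultimately show ?thesis
    using w j by (simp add: len_eq Wext_comp sgen_Wext finite_Inv card_image)
qed

lemma len_sgen_down:
  assumes j: "j \<in> gens R x0" and w: "w \<in> Wext R" and neg: "rt j (w bp) < 0"
  shows "len R x0 w = Suc (len R x0 (sgen j \<circ> w))"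
proof -
  have "0 < rt j ((sgen j \<circ> w) bp)" using neg by (simp add: rt_sgen[OF j])
  from len_sgen_up[OF j Wext_comp[OF sgen_Wext[OF j] w] this] show ?thesis
    unfolding sgen_o_sgen[OF j] .
qed

lemma len_sgen_cases:
  assumes "j \<in> gens R x0" "w \<in> Wext R"
  shows "len R x0 (sgen j \<circ> w) = Suc (len R x0 w) \<or> len R x0 w = Suc (len R x0 (sgen j \<circ> w))"
  using len_sgen_up[OF assms] len_sgen_down[OF assms] rt_W_nz[OF assms] by linarith

lemma len_sgen_less_iff:
  assumes "j \<in> gens R x0" "w \<in> Wext R"
  shows "len R x0 (sgen j \<circ> w) < len R x0 w \<longleftrightarrow> rt j (w bp) < 0"
  using len_sgen_up[OF assms] len_sgen_down[OF assms] rt_W_nz[OF assms] by linarith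

text \<open>Composing with \<open>w\<close> and changing the sign turns inversions of
  \<open>w\<close> into inversions of \<open>inv w\<close>. Injectivity gives an inequality, which
  is used for both elements.\<close>

lemma len_inv:
  assumes w: "w \<in> Wext R"
  shows "len R x0 (inv w) = len R x0 w"
proof -
  have le: "len R x0 v \<le> len R x0 (inv v)" if v: "v \<in> Wext R" for v
  proof -
    have "inj_on (\<lambda>\<psi> x. - \<psi> (v x)) (Inv v)"
    proof (intro inj_onI ext)
      fix \<phi> \<psi> :: "'v \<Rightarrow> real" and x assume "(\<lambda>x. - \<phi> (v x)) = (\<lambda>x. - \<psi> (v x))"
      then have "- \<phi> (v (inv v x)) = - \<psi> (v (inv v x))" by meson
      then show "\<phi> x = \<psi> x" by (simp add: Wext_inv_simps[OF v])
    qed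
    moreover have "(\<lambda>\<psi> x. - \<psi> (v x)) ` Inv v \<subseteq> Inv (inv v)"
      using Aff_uminus[OF Aff_comp[OF _ v]] by (auto simp: Inv_def Wext_inv_simps[OF v])
    ultimately have "card (Inv v) \<le> card (Inv (inv v))" using finite_Inv by (metis card_inj_on_le)
    then show ?thesis by (simp add: len_eq v Wext_inv)
  qed
  show ?thesis using le[OF w] le[OF Wext_inv[OF w]] by (simp add: Wext_inv_inv[OF w])
qed

section \<open>Elements of length zero and descents\<close>

lemma Omega_Wext: "u \<in> Omega R x0 \<Longrightarrow> u \<in> Wext R"
  by (simp add: Omega_def)

lemma Omega_alcove: "u \<in> Omega R x0 \<Longrightarrow> x \<in> alcoveA R x0 \<Longrightarrow> u x \<in> alcoveA R x0"
  by (auto simp: Omega_def)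

lemma Omega_inv:
  assumes "u \<in> Omega R x0"
  shows "inv u \<in> Omega R x0"
proof -
  have "inv u ` u ` alcoveA R x0 = alcoveA R x0"
    by (simp add: image_inv_f_f bij_is_inj Wext_bij Omega_Wext[OF assms])
  then show ?thesis using assms Wext_inv by (auto simp: Omega_def)
qed

lemma Inv_empty_alcove:
  assumes "w \<in> Wext R" "Inv w = {}"
  shows "w bp \<in> alcoveA R x0"
  unfolding alcove_iff
proof (intro ballI impI)
  fix \<phi> assume "\<phi> \<in> Aff" "0 < \<phi> bp"
  moreover have "\<phi> (w bp) \<noteq> 0" using Aff_bp_nz[OF Aff_comp[OF \<open>\<phi> \<in> Aff\<close> assms(1)]] by simp
  ultimately show "0 < \<phi> (w bp)" using assms(2) by (auto simp: Inv_def not_less)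
qed

lemma len_0_iff:
  assumes w: "w \<in> Wext R"
  shows "len R x0 w = 0 \<longleftrightarrow> w \<in> Omega R x0"
proof
  have sub: "v ` alcoveA R x0 \<subseteq> alcoveA R x0" if v: "v \<in> Wext R" "len R x0 v = 0" for v
  proof -
    have "v bp \<in> alcoveA R x0"
      using that Inv_empty_alcove[OF v(1)] finite_Inv by (simp add: len_eq)
    then have "0 < (\<phi> \<circ> v) bp" if "\<phi> \<in> Aff" "0 < \<phi> bp" for \<phi> using that by (simp add: alcove_iff)
    then have "0 < (\<phi> \<circ> v) x" if "\<phi> \<in> Aff" "0 < \<phi> bp" "x \<in> alcoveA R x0" for \<phi> x
      using that Aff_alcove_sign(2)[OF Aff_comp[OF _ v(1)]] by blast
    then show ?thesis by (auto simp: alcove_iff[of "v _"])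
  qed
  assume z: "len R x0 w = 0"
  have "alcoveA R x0 \<subseteq> w ` alcoveA R x0"
  proof
    fix x assume "x \<in> alcoveA R x0"
    then have "inv w x \<in> alcoveA R x0" using sub[OF Wext_inv[OF w]] z len_inv[OF w] by auto
    then show "x \<in> w ` alcoveA R x0" by (intro image_eqI[of _ _ "inv w x"]) (simp_all add: Wext_inv_simps[OF w])
  qed
  then show "w \<in> Omega R x0" using sub[OF w z] w by (simp add: Omega_def)
next
  assume "w \<in> Omega R x0"
  then have "w bp \<in> alcoveA R x0" using Omega_alcove bp_alcove by blast
  then have "Inv w = {}" by (fastforce simp: Inv_def alcove_iff)
  then show "len R x0 w = 0" by (simp add: len_eq w)
qed

lemma len_id: "len R x0 id = 0"
  by (simp add: len_0_iff Wext_id) (simp add: Omega_def Wext_id)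

lemma len_sgen: "j \<in> gens R x0 \<Longrightarrow> len R x0 (sgen j) = 1"
  using len_sgen_up[OF _ Wext_id, of j] rt_bp_pos[of j] len_id by simp

lemma len_Omega_left:
  assumes u: "u \<in> Omega R x0" and w: "w \<in> Wext R"
  shows "len R x0 (u \<circ> w) = len R x0 w"
proof -
  have le: "len R x0 v \<le> len R x0 (h \<circ> v)" if h: "h \<in> Omega R x0" and v: "v \<in> Wext R" for h v
  proof -
    have hW: "h \<in> Wext R" using h Omega_Wext by blast
    have "inj_on (\<lambda>\<psi>. \<psi> \<circ> inv h) (Inv v)"
    proof (intro inj_onI)
      fix \<phi> \<psi> :: "'v \<Rightarrow> real" assume "\<phi> \<circ> inv h = \<psi> \<circ> inv h"
      then have "\<phi> \<circ> (inv h \<circ> h) = \<psi> \<circ> (inv h \<circ> h)" by (simp only: o_assoc)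
      then show "\<phi> = \<psi>" by (simp add: Wext_inv_comp[OF hW])
    qed
    moreover have "(\<lambda>\<psi>. \<psi> \<circ> inv h) ` Inv v \<subseteq> Inv (h \<circ> v)"
      using Aff_comp[OF _ Wext_inv[OF hW]] Aff_alcove_sign(2)[OF _ Omega_alcove[OF Omega_inv[OF h] bp_alcove]]
      by (auto simp: Inv_def Wext_inv_simps[OF hW])
    ultimately have "card (Inv v) \<le> card (Inv (h \<circ> v))" using finite_Inv by (metis card_inj_on_le)
    then show ?thesis by (simp add: len_eq v Wext_comp hW)
  qed
  have "inv u \<circ> (u \<circ> w) = w" by (simp add: o_assoc Wext_inv_comp Omega_Wext[OF u])
  then show ?thesis using le[OF u w] le[OF Omega_inv[OF u] Wext_comp[OF Omega_Wext[OF u] w]] by simp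
qed

lemma len_Omega_right:
  assumes u: "u \<in> Omega R x0" and w: "w \<in> Wext R"
  shows "len R x0 (w \<circ> u) = len R x0 w"
proof -
  have "len R x0 (w \<circ> u) = len R x0 (inv (w \<circ> u))" by (simp add: len_inv Wext_comp w Omega_Wext[OF u])
  also have "\<dots> = len R x0 (inv u \<circ> inv w)" by (simp add: Wext_inv_o w Omega_Wext[OF u])
  also have "\<dots> = len R x0 w" by (simp add: len_Omega_left Omega_inv u Wext_inv w len_inv)
  finally show ?thesis .
qed

lemma len_right_sgen: "j \<in> gens R x0 \<Longrightarrow> w \<in> Wext R \<Longrightarrow> len R x0 (w \<circ> sgen j) = len R x0 (sgen j \<circ> inv w)"
  by (metis Wext_comp Wext_inv_o len_inv sgen_Wext sgen_inv)

lemma len_right_sgen_cases: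
  assumes "j \<in> gens R x0" "w \<in> Wext R"
  shows "len R x0 (w \<circ> sgen j) = Suc (len R x0 w) \<or> len R x0 w = Suc (len R x0 (w \<circ> sgen j))"
  using len_sgen_cases[OF assms(1) Wext_inv[OF assms(2)]] len_right_sgen[OF assms] len_inv[OF assms(2)] by simp

text \<open>If no generator lowers the length, \<open>w bp\<close> is on the inner side of every
  wall. Positive coroots are non-negative combinations of simple ones and lie below the coroot of
  \<open>alpha0\<close>, so the wall inequalities already put \<open>w bp\<close> in the
  alcove.\<close>

lemma ex_left_descent:
  assumes w: "w \<in> Wext R" and nz: "len R x0 w \<noteq> 0"
  shows "\<exists>j\<in>gens R x0. len R x0 (sgen j \<circ> w) < len R x0 w"
proof (rule ccontr)
  assume "\<not> ?thesis"
  then have p: "0 < rt j (w bp)" if "j \<in> gens R x0" for j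
    using that len_sgen_less_iff[OF that w] rt_W_nz[OF that w] by fastforce
  have s: "0 < w bp \<bullet> coroot s" if "s \<in> Sim" for s
    using p[of "(s, 0)"] that by (simp add: gens_def rt_def)
  have a0: "w bp \<bullet> coroot (alpha0 R x0) < 1"
    using p[of "(alpha0 R x0, 1)"] by (simp add: gens_def rt_def)
  have "0 < w bp \<bullet> coroot a \<and> w bp \<bullet> coroot a < 1" if a: "a \<in> Pos" for a
  proof
    show "0 < w bp \<bullet> coroot a"
      using nat_cone_inner_pos[OF finite_Sim Pos_coroot_nat_cone[OF a] s] R_nz[OF Pos_R[OF a]]
      by (simp add: coroot_eq_0_iff)
    have "0 \<le> w bp \<bullet> (coroot (alpha0 R x0) - coroot a)"
      using nat_cone_inner_nonneg[OF alpha0_highest[OF a, unfolded coroot_le_def], of "w bp"] s less_imp_le by blast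
    then show "w bp \<bullet> coroot a < 1" using a0 by (simp add: inner_simps)
  qed
  then have "w bp \<in> alcoveA R x0" by (simp add: alcoveA_def)
  then have "Inv w = {}" by (fastforce simp: Inv_def alcove_iff)
  then show False using nz by (simp add: len_eq w)
qed

lemma ex_right_descent:
  assumes w: "w \<in> Wext R" and nz: "len R x0 w \<noteq> 0"
  shows "\<exists>j\<in>gens R x0. len R x0 (w \<circ> sgen j) < len R x0 w"
  using ex_left_descent[OF Wext_inv[OF w]] nz len_right_sgen[OF _ w] len_inv[OF w] by auto

section \<open>The elements attached to weights\<close>

text \<open>Along the descent to a simple root, the reflection in a positive root is conjugated into
  a simple reflection; \<open>refl_uminus\<close> covers negative roots.\<close>

lemma W0_simple_word:
  assumes "w \<in> W0 R"
  shows "\<exists>ss. set ss \<subseteq> Sim \<and> w = foldr (\<circ>) (map refl ss) id"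
proof -
  let ?Q = "\<lambda>w. \<exists>ss. set ss \<subseteq> Sim \<and> w = foldr (\<circ>) (map refl ss) id"
  have comp: "?Q (v \<circ> w)" if qv: "?Q v" and qw: "?Q w" for v w
  proof -
    obtain ss ts where st: "set ss \<subseteq> Sim" "set ts \<subseteq> Sim"
      "v = foldr (\<circ>) (map refl ss) id" "w = foldr (\<circ>) (map refl ts) id"
      using qv qw by blast
    have "v \<circ> w = foldr (\<circ>) (map refl (ss @ ts)) id"
      unfolding st map_append foldr_comp_append ..
    moreover have "set (ss @ ts) \<subseteq> Sim" using st by simp
    ultimately show ?thesis by blast
  qed
  have single: "?Q (refl s)" if "s \<in> Sim" for s
    using that by (intro exI[of _ "[s]"]) simp
  have pos: "?Q (refl a)" if "a \<in> Pos" for a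
    using that
  proof (induction rule: Pos_simple_induct)
    case (refl a s)
    have "refl a = refl s \<circ> (refl (refl s a) \<circ> refl s)"
      using refl_conj[of s "refl s a"] by (simp add: fun_eq_iff refl_refl)
    then show ?case using comp[OF single[OF refl(2)] comp[OF refl(5) single[OF refl(2)]]] by (simp only:)
  qed (rule single)
  have root: "?Q (refl a)" if "a \<in> R" for a
    using Pos_cases[OF that] pos[of a] pos[of "- a"] by (simp only: refl_uminus) blast
  show ?thesis using assms
  proof (induction rule: W0_induct)
    case id
    show ?case by (intro exI[of _ "[]"]) simp
  next
    case (refl a w)
    then show ?case using comp[OF root] by blast
  qed
qed

text \<open>If the reflecting root is the first letter, that letter is dropped. Otherwise the
  reflection is carried past the first letter, which leaves the conjugated root positive, and the
  induction hypothesis shortens the rest.\<close>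

lemma exchange:
  assumes "set ss \<subseteq> Sim" "a \<in> Pos" "foldr (\<circ>) (map refl ss) id bp \<bullet> a < 0"
  shows "\<exists>ts. set ts \<subseteq> Sim \<and> length ts < length ss \<and>
    refl a \<circ> foldr (\<circ>) (map refl ss) id = foldr (\<circ>) (map refl ts) id"
  using assms
proof (induction ss arbitrary: a)
  case Nil
  then show ?case using bp_coord(1)[of a] by (simp add: inner_coroot_pos_iff)
next
  case (Cons t ss)
  let ?w = "foldr (\<circ>) (map refl ss) id"
  have t: "t \<in> Sim" "set ss \<subseteq> Sim" using Cons.prems by auto
  show ?case
  proof (cases "a = t")
    case True
    then have e: "refl a \<circ> foldr (\<circ>) (map refl (t # ss)) id = ?w" by (simp add: fun_eq_iff refl_refl)
    show ?thesis by (rule exI[of _ ss]) (simp only: e t length_Cons lessI simp_thms)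
  next
    case False
    have e0: "foldr (\<circ>) (map refl (t # ss)) id = refl t \<circ> ?w" by simp
    have "?w bp \<bullet> refl t a < 0"
      using Cons.prems(3) unfolding e0 comp_apply[of "refl t" ?w bp] refl_inner_shift .
    then obtain ts where ts: "set ts \<subseteq> Sim" "length ts < length ss"
      "refl (refl t a) \<circ> ?w = foldr (\<circ>) (map refl ts) id"
      using Cons.IH[OF t(2) refl_simple_Pos[OF t(1) Cons.prems(2) False]] by blast
    have "refl a \<circ> foldr (\<circ>) (map refl (t # ss)) id = refl t \<circ> (refl (refl t a) \<circ> ?w)"
    proof -
      have "refl a \<circ> refl t = refl t \<circ> refl (refl t a)" by (auto simp: fun_eq_iff refl_conj refl_refl)
      then show ?thesis by (simp only: e0 o_assoc)
    qed
    also have "\<dots> = foldr (\<circ>) (map refl (t # ts)) id" unfolding ts(3) by simp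
    finally have e: "refl a \<circ> foldr (\<circ>) (map refl (t # ss)) id = foldr (\<circ>) (map refl (t # ts)) id" .
    show ?thesis using t(1) ts(1,2) by (intro exI[of _ "t # ts"] conjI e) simp_all
  qed
qed

text \<open>A shortest word for \<open>w\<close> must be empty: otherwise the word without its first
  letter \<open>t\<close> sends \<open>bp\<close> to the negative side of \<open>t\<close>, and
  \<open>exchange\<close> yields a still shorter word for \<open>w\<close>.\<close>

lemma W0_free:
  assumes w: "w \<in> W0 R" and pos: "\<And>a. a \<in> Pos \<Longrightarrow> 0 < w bp \<bullet> a"
  shows "w = id"
proof -
  let ?P = "\<lambda>ss. set ss \<subseteq> Sim \<and> w = foldr (\<circ>) (map refl ss) id"
  obtain ss where ss: "?P ss" "\<And>ts. ?P ts \<Longrightarrow> length ss \<le> length ts"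
    using ex_has_least_nat[of ?P _ length] W0_simple_word[OF w] by blast
  show ?thesis
  proof (cases ss)
    case Nil
    then show ?thesis using ss(1) by simp
  next
    case (Cons t ts)
    have t: "t \<in> Sim" "set ts \<subseteq> Sim" using ss(1) Cons by auto
    have eq: "w = refl t \<circ> foldr (\<circ>) (map refl ts) id" using ss(1) Cons by simp
    then have "foldr (\<circ>) (map refl ts) id bp = refl t (w bp)" by (simp add: refl_refl)
    then have "foldr (\<circ>) (map refl ts) id bp \<bullet> t < 0"
      using pos[OF Sim_Pos[OF t(1)]] by (simp add: refl_inner_shift refl_self)
    then obtain us where "set us \<subseteq> Sim" "length us < length ts" "w = foldr (\<circ>) (map refl us) id"
      using exchange[OF t(2) Sim_Pos[OF t(1)]] eq by blast
    then show ?thesis using ss(2)[of us] Cons by simp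
  qed
qed

text \<open>The induction counts the positive roots that are negative on \<open>z\<close>.
  Reflecting in a simple one among them permutes the other positive roots, so the count
  drops.\<close>

lemma W0_transitive:
  assumes "\<And>a. a \<in> R \<Longrightarrow> z \<bullet> a \<noteq> 0"
  shows "\<exists>v\<in>W0 R. \<forall>a\<in>Pos. 0 < v z \<bullet> a"
  using assms
proof (induction "card {a \<in> Pos. z \<bullet> a < 0}" arbitrary: z rule: less_induct)
  case less
  show ?case
  proof (cases "\<exists>s\<in>Sim. z \<bullet> s < 0")
    case True
    then obtain s where s: "s \<in> Sim" "z \<bullet> s < 0" by blast
    have "refl s ` {a \<in> Pos. refl s z \<bullet> a < 0} \<subseteq> {a \<in> Pos. z \<bullet> a < 0} - {s}"
    proof
      fix b assume "b \<in> refl s ` {a \<in> Pos. refl s z \<bullet> a < 0}"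
      then obtain a where a: "a \<in> Pos" "z \<bullet> refl s a < 0" "b = refl s a" by (auto simp: refl_inner_shift)
      have "a \<noteq> s" using a(2) s(2) by (auto simp: refl_self)
      then have "b \<in> Pos" using refl_simple_Pos[OF s(1) a(1)] a(3) by simp
      moreover have "b \<noteq> s"
      proof
        assume "b = s"
        then have "a = - s" using a(3) refl_refl[of s a] by (simp add: refl_self)
        then show False using Pos_inner[OF a(1)] Pos_inner[OF Sim_Pos[OF s(1)]] by simp
      qed
      ultimately show "b \<in> {a \<in> Pos. z \<bullet> a < 0} - {s}" using a by simp
    qed
    moreover have "inj_on (refl s) {a \<in> Pos. refl s z \<bullet> a < 0}" by (rule inj_on_inverseI[of _ "refl s"]) (rule refl_refl)
    moreover have fin: "finite {a \<in> Pos. z \<bullet> a < 0}" using finite_Pos by simp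
    ultimately have "card {a \<in> Pos. refl s z \<bullet> a < 0} \<le> card ({a \<in> Pos. z \<bullet> a < 0} - {s})"
      by (meson card_inj_on_le finite_Diff)
    also have "\<dots> < card {a \<in> Pos. z \<bullet> a < 0}"
      using fin s Sim_Pos by (intro psubset_card_mono) auto
    finally have "\<exists>v\<in>W0 R. \<forall>a\<in>Pos. 0 < v (refl s z) \<bullet> a"
      using less.prems refl_in_R[OF Sim_R[OF s(1)]] by (intro less.hyps) (auto simp: refl_inner_shift)
    then obtain v where v: "v \<in> W0 R" "\<forall>a\<in>Pos. 0 < v (refl s z) \<bullet> a" by blast
    then show ?thesis
      using W0_comp[OF v(1) W0_refl[OF Sim_R[OF s(1)]]] by (intro bexI[of _ "v \<circ> refl s"]) auto
  next
    case False
    have "0 < z \<bullet> a" if a: "a \<in> Pos" for a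
      using nat_cone_inner_nonneg[OF Pos_nat_cone[OF a], of z] False less.prems[OF Pos_R[OF a]]
      by (force simp: not_less)
    then show ?thesis using W0_id by (intro bexI[of _ id]) auto
  qed
qed

section \<open>Shortest elements into the antidominant chamber\<close>

lemma closure_chamberC: "closure (chamberC R x0) = {x. \<forall>a\<in>Pos. 0 \<le> x \<bullet> coroot a}"
proof
  have eq: "{x. \<forall>a\<in>Pos. 0 \<le> x \<bullet> coroot a} = (\<Inter>a\<in>Pos. {x. 0 \<le> x \<bullet> coroot a})" by auto
  have "closed {x. \<forall>a\<in>Pos. 0 \<le> x \<bullet> coroot a}"
    unfolding eq by (intro closed_INT ballI closed_Collect_le continuous_intros)
  then show "closure (chamberC R x0) \<subseteq> {x. \<forall>a\<in>Pos. 0 \<le> x \<bullet> coroot a}"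
    by (intro closure_minimal) (auto simp: chamberC_def less_imp_le)
  show "{x. \<forall>a\<in>Pos. 0 \<le> x \<bullet> coroot a} \<subseteq> closure (chamberC R x0)"
  proof
    fix x assume x: "x \<in> {x. \<forall>a\<in>Pos. 0 \<le> x \<bullet> coroot a}"
    show "x \<in> closure (chamberC R x0)"
      unfolding closure_approachable
    proof (intro allI impI)
      fix e :: real assume e: "0 < e"
      define d where "d = e / (norm x0 + 1)"
      have n: "0 < norm x0 + 1" using norm_ge_zero[of x0] by linarith
      have d: "0 < d" using e n by (simp add: d_def)
      have "x + d *\<^sub>R x0 \<in> chamberC R x0"
        using x d Pos_inner_coroot by (auto simp: chamberC_def inner_simps intro!: add_nonneg_pos)
      moreover have "dist (x + d *\<^sub>R x0) x < e"
      proof -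
        have "d * norm x0 < d * (norm x0 + 1)" using d by simp
        also have "\<dots> = e" using n by (simp add: d_def)
        finally show ?thesis using d by (simp add: dist_norm)
      qed
      ultimately show "\<exists>y\<in>chamberC R x0. dist y x < e" by blast
    qed
  qed
qed

lemma neg_closure_chamberC: "x \<in> uminus ` closure (chamberC R x0) \<longleftrightarrow> (\<forall>a\<in>Pos. x \<bullet> coroot a \<le> 0)"
  unfolding closure_chamberC
  by (auto intro!: image_eqI[of _ _ "- x"])

lemma bp_inner_Pos: "a \<in> R \<Longrightarrow> 0 < bp \<bullet> a \<longleftrightarrow> a \<in> Pos"
  using Pos_cases[of a] bp_coord(1)[of a] bp_coord(1)[of "- a"]
  by (auto simp: inner_coroot_pos_iff coroot_uminus inner_coroot_neg_iff)

lemma W0_bp_coord: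
  assumes "v \<in> W0 R" "a \<in> R"
  shows "v bp \<bullet> coroot a < 1" "- 1 < v bp \<bullet> coroot a"
proof -
  have e: "v bp \<bullet> coroot a = bp \<bullet> coroot (inv v a)"
    using assms by (simp add: W0_shift W0_coroot[OF W0_inv])
  have "inv v a \<in> R" using W0_root[OF W0_inv[OF assms(1)] assms(2)] .
  then consider "inv v a \<in> Pos" | "- inv v a \<in> Pos" using Pos_cases by blast
  then have "bp \<bullet> coroot (inv v a) < 1 \<and> - 1 < bp \<bullet> coroot (inv v a)"
  proof cases
    case 1
    then show ?thesis using bp_coord[of "inv v a"] by linarith
  next
    case 2
    then show ?thesis using bp_coord[of "- inv v a"] by (simp add: coroot_uminus)
  qed
  then show "v bp \<bullet> coroot a < 1" "- 1 < v bp \<bullet> coroot a" using e by simp_all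
qed

text \<open>By \<open>W0_bp_coord\<close> an inversion of a finite element has level 0. The inverse
  appears because \<open>inv v bp \<bullet> coroot a\<close> equals
  \<open>bp \<bullet> coroot (v a)\<close>: the inversions are then the positive roots that
  \<open>v\<close> itself makes negative.\<close>

lemma W0_Inv_inv_iff:
  assumes v: "v \<in> W0 R"
  shows "\<phi> \<in> Inv (inv v) \<longleftrightarrow> (\<exists>a\<in>Pos. \<phi> = (\<lambda>x. x \<bullet> coroot a) \<and> v a \<notin> Pos)"
proof
  assume \<phi>: "\<phi> \<in> Inv (inv v)"
  have shift: "inv v bp \<bullet> coroot a = bp \<bullet> coroot (v a)" for a
    using W0_shift[OF W0_inv[OF v], of bp "coroot a"] by (simp add: W0_coroot[OF v] inv_inv_eq W0_bij[OF v])
  have p: "\<phi> \<in> Aff" "0 < \<phi> bp" "\<phi> (inv v bp) < 0" using \<phi> by (auto simp: Inv_def)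
  from p(1) show "\<exists>a\<in>Pos. \<phi> = (\<lambda>x. x \<bullet> coroot a) \<and> v a \<notin> Pos"
  proof (cases rule: Aff_cases)
    case (pos a k)
    have "real_of_int k < 1" "- 1 < real_of_int k"
      using p pos bp_coord[OF pos(1)] W0_bp_coord[OF W0_inv[OF v] Pos_R[OF pos(1)]] by auto
    then have "k = 0" by simp
    then have "bp \<bullet> coroot (v a) < 0" using p(3) pos shift by simp
    then have "v a \<notin> Pos" using bp_coord(1)[of "v a"] by auto
    then show ?thesis using pos \<open>k = 0\<close> by auto
  next
    case (neg a k)
    have "0 < real_of_int k" using p(2) neg bp_coord[OF neg(1)] by simp
    then have "1 \<le> real_of_int k" by simp
    then show ?thesis using p(3) neg W0_bp_coord(1)[OF W0_inv[OF v] Pos_R[OF neg(1)]] by simp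
  qed
next
  assume "\<exists>a\<in>Pos. \<phi> = (\<lambda>x. x \<bullet> coroot a) \<and> v a \<notin> Pos"
  then obtain a where a: "a \<in> Pos" "\<phi> = (\<lambda>x. x \<bullet> coroot a)" "v a \<notin> Pos" by blast
  have "- v a \<in> Pos" using a Pos_cases[OF W0_root[OF v Pos_R[OF a(1)]]] by blast
  then have "bp \<bullet> coroot (v a) < 0" using bp_coord(1)[of "- v a"] by (simp add: coroot_uminus)
  moreover have "inv v bp \<bullet> coroot a = bp \<bullet> coroot (v a)"
    using W0_shift[OF W0_inv[OF v], of bp "coroot a"] by (simp add: W0_coroot[OF v] inv_inv_eq W0_bij[OF v])
  ultimately show "\<phi> \<in> Inv (inv v)"
    using a bp_coord(1)[OF a(1)] Aff_posI[OF a(1), of 0] by (simp add: Inv_def)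
qed

text \<open>Agreement of signs extends to negative roots, so \<open>v \<circ> inv w\<close> keeps
  \<open>bp\<close> in the dominant chamber and \<open>W0_free\<close> applies.\<close>

lemma W0_eqI:
  assumes v: "v \<in> W0 R" and w: "w \<in> W0 R" and eq: "\<And>a. a \<in> Pos \<Longrightarrow> v a \<in> Pos \<longleftrightarrow> w a \<in> Pos"
  shows "v = w"
proof -
  have neg: "w a \<in> Pos" if "- a \<in> Pos" "v a \<in> Pos" for a
  proof -
    have "v (- a) \<notin> Pos" using that(2) Pos_inner[of "v a"] Pos_inner[of "- v a"]
      by (auto simp: linear_neg[OF W0_linear[OF v]])
    then have "w (- a) \<notin> Pos" using eq[OF that(1)] by simp
    then show ?thesis
      using Pos_cases[OF W0_root[OF w Pos_R[OF that(1)]]] by (simp add: linear_neg[OF W0_linear[OF w]])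
  qed
  have "v \<circ> inv w = id"
  proof (rule W0_free)
    show "v \<circ> inv w \<in> W0 R" using v w W0_comp W0_inv by blast
    fix b assume b: "b \<in> Pos"
    let ?a = "inv v b"
    have aR: "?a \<in> R" using W0_root[OF W0_inv[OF v] Pos_R[OF b]] .
    have va: "v ?a \<in> Pos" using b by (simp add: W0_inv_simps[OF v])
    have "w ?a \<in> Pos" using Pos_cases[OF aR] eq[of ?a] neg[of ?a] va by blast
    then have "0 < bp \<bullet> w ?a" using bp_inner_Pos[OF W0_root[OF w aR]] by simp
    moreover have "v (inv w bp) \<bullet> b = bp \<bullet> w ?a"
      using W0_shift[OF v, of "inv w bp" b] W0_shift[OF W0_inv[OF w], of bp ?a] by (simp add: inv_inv_eq W0_bij[OF w])
    ultimately show "0 < (v \<circ> inv w) bp \<bullet> b" by simp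
  qed
  then have "v x = w x" for x using W0_inv_simps(1)[OF w, of x] by (metis comp_apply id_apply)
  then show ?thesis by blast
qed

text \<open>Adding \<open>bp\<close> to \<open>- l\<close> breaks the ties on reflecting
  hyperplanes. Any \<open>g\<close> sending \<open>l\<close> to the antidominant closure makes
  negative every positive root that \<open>v\<close> makes negative, so \<open>v\<close> has the
  fewest inversions, and equal length forces equal inversion sets.\<close>

lemma vlam_eq:
  assumes l: "l \<in> weights R" and v: "v \<in> W0 R" and pos: "\<And>a. a \<in> Pos \<Longrightarrow> 0 < v (bp - l) \<bullet> a"
  shows "vlam R x0 l = v"
proof -
  have len: "len R x0 g = card (Inv (inv g))" if "g \<in> W0 R" for g
    using that len_inv[OF W0_Wext] len_eq[OF Wext_inv[OF W0_Wext]] by metis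
  have sub: "Inv (inv v) \<subseteq> Inv (inv g)" if g: "g \<in> W0 R" "g l \<in> uminus ` closure (chamberC R x0)" for g
  proof
    fix \<phi> assume "\<phi> \<in> Inv (inv v)"
    then obtain a where a: "a \<in> Pos" "\<phi> = (\<lambda>x. x \<bullet> coroot a)" "v a \<notin> Pos" using W0_Inv_inv_iff[OF v] by blast
    have "- v a \<in> Pos" using a Pos_cases[OF W0_root[OF v Pos_R[OF a(1)]]] by blast
    then have "v (bp - l) \<bullet> v a < 0" using pos[of "- v a"] by simp
    then have "(bp - l) \<bullet> a < 0" by (simp only: W0_isometry[OF v])
    then have "(bp - l) \<bullet> coroot a < 0" by (simp only: inner_coroot_neg_iff)
    then have "0 < l \<bullet> coroot a" using bp_coord[OF a(1)] by (simp add: inner_simps)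
    then have "0 < g l \<bullet> coroot (g a)" by (simp add: W0_coroot[OF g(1)] W0_isometry[OF g(1)])
    then have "g a \<notin> Pos" using g(2) unfolding neg_closure_chamberC by (meson not_le)
    then show "\<phi> \<in> Inv (inv g)" using W0_Inv_inv_iff[OF g(1)] a by blast
  qed
  have vl: "v l \<in> uminus ` closure (chamberC R x0)"
    unfolding neg_closure_chamberC
  proof
    fix b assume b: "b \<in> Pos"
    have "0 < v (bp - l) \<bullet> coroot b" using pos[OF b] by (simp add: inner_coroot_pos_iff)
    then have "v l \<bullet> coroot b < v bp \<bullet> coroot b" by (simp add: linear_diff[OF W0_linear[OF v]] inner_simps)
    also have "\<dots> < 1" using W0_bp_coord[OF v Pos_R[OF b]] by simp
    finally have "v l \<bullet> coroot b < 1" .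
    moreover have "v l \<bullet> coroot b \<in> \<int>" using W0_weights[OF v l] Pos_R[OF b] by (simp add: weights_def)
    \<comment> \<open>An integer below 1 is at most 0: integrality of the weight removes the
      perturbation by \<open>bp\<close>.\<close>
    ultimately show "v l \<bullet> coroot b \<le> 0" by (auto elim!: Ints_cases)
  qed
  show ?thesis
    unfolding vlam_def
  proof (rule the_equality)
    have "len R x0 v \<le> len R x0 g" if "g \<in> W0 R" "g l \<in> uminus ` closure (chamberC R x0)" for g
      using card_mono[OF finite_Inv sub[OF that]] len v that by simp
    then show "v \<in> W0 R \<and> v l \<in> uminus ` closure (chamberC R x0) \<and>
      (\<forall>v'\<in>W0 R. v' l \<in> uminus ` closure (chamberC R x0) \<longrightarrow> len R x0 v \<le> len R x0 v')"
      using v vl by blast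
  next
    fix g assume g: "g \<in> W0 R \<and> g l \<in> uminus ` closure (chamberC R x0) \<and>
      (\<forall>v'\<in>W0 R. v' l \<in> uminus ` closure (chamberC R x0) \<longrightarrow> len R x0 g \<le> len R x0 v')"
    then have gW: "g \<in> W0 R" and gl: "g l \<in> uminus ` closure (chamberC R x0)" and "len R x0 g \<le> len R x0 v"
      using v vl by blast+
    then have "Inv (inv v) = Inv (inv g)"
      using card_subset_eq[OF finite_Inv sub[OF gW gl]] card_mono[OF finite_Inv sub[OF gW gl]] len v by simp
    then have iff: "(\<exists>a\<in>Pos. \<phi> = (\<lambda>x. x \<bullet> coroot a) \<and> v a \<notin> Pos) \<longleftrightarrow> (\<exists>a\<in>Pos. \<phi> = (\<lambda>x. x \<bullet> coroot a) \<and> g a \<notin> Pos)" for \<phi>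
      using W0_Inv_inv_iff[OF v] W0_Inv_inv_iff[OF gW] by simp
    have inj: "a = b" if "(\<lambda>x. x \<bullet> coroot a) = (\<lambda>x. x \<bullet> coroot b)" for a b :: 'v
      using that by (metis coroot_inject inner_commute vector_eq_ldot)
    show "g = v"
    proof (rule W0_eqI[OF gW v])
      fix a assume "a \<in> Pos"
      then show "g a \<in> Pos \<longleftrightarrow> v a \<in> Pos" using iff[of "\<lambda>x. x \<bullet> coroot a"] inj by metis
    qed
  qed
qed

text \<open>If \<open>w\<close> has linear part \<open>g\<close>, then \<open>inv w bp\<close> is
  \<open>inv g (bp - l)\<close>, so the hypothesis is the criterion of \<open>vlam_eq\<close> for
  \<open>inv g\<close>. It replaces minimality of length in the sequel.\<close>

lemma ulam_eqI:
  assumes w: "w \<in> Wext R" "w 0 = l" and pos: "\<And>a. a \<in> Pos \<Longrightarrow> 0 < inv w bp \<bullet> a"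
  shows "ulam R x0 l = w"
proof -
  obtain g m where g: "g \<in> W0 R" "m \<in> weights R" "w = (\<lambda>x. g x + m)" using w(1) by (rule Wext_affineE)
  have m: "m = l" using w(2) g(3) linear_0[OF W0_linear[OF g(1)]] by simp
  have "w (inv g (bp - l)) = bp" by (simp add: g(3) m W0_inv_simps[OF g(1)])
  then have "inv w bp = inv g (bp - l)" using Wext_inv_simps(1)[OF w(1)] by metis
  then have "vlam R x0 l = inv g" using vlam_eq[OF _ W0_inv[OF g(1)]] pos g(2) m by simp
  then have "ulam R x0 l = transl l \<circ> g" by (simp add: ulam_def inv_inv_eq W0_bij[OF g(1)])
  then show ?thesis by (auto simp: g(3) m transl_def)
qed

text \<open>\<open>bp - l\<close> is regular because no affine root vanishes at \<open>bp\<close>,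
  so some finite element moves it into the dominant chamber and \<open>ulam_eqI\<close>
  applies.\<close>

lemma ulam_props:
  assumes l: "l \<in> weights R"
  shows "ulam R x0 l \<in> Wext R" "ulam R x0 l 0 = l" "\<And>a. a \<in> Pos \<Longrightarrow> 0 < inv (ulam R x0 l) bp \<bullet> a"
proof -
  have "(bp - l) \<bullet> a \<noteq> 0" if "a \<in> R" for a
  proof -
    obtain k :: int where k: "l \<bullet> coroot a = of_int k" using l \<open>a \<in> R\<close> by (auto simp: weights_def elim: Ints_cases)
    have "(bp - l) \<bullet> coroot a \<noteq> 0" using Aff_bp_nz[OF AffI[OF that, of k]] k by (simp add: inner_simps)
    then show ?thesis by (simp add: inner_coroot_eq_0_iff)
  qed
  then obtain v where v: "v \<in> W0 R" "\<forall>a\<in>Pos. 0 < v (bp - l) \<bullet> a" using W0_transitive by blast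
  let ?w = "\<lambda>x. inv v x + l"
  have w: "?w \<in> Wext R" using Wext_affineI[OF W0_inv[OF v(1)] l] .
  have w0: "?w 0 = l" using linear_0[OF W0_linear[OF W0_inv[OF v(1)]]] by simp
  have "?w (v (bp - l)) = bp" by (simp add: W0_inv_simps[OF v(1)])
  then have i: "inv ?w bp = v (bp - l)" using Wext_inv_simps(1)[OF w] by metis
  have "ulam R x0 l = ?w" using ulam_eqI[OF w w0] v(2) i by simp
  then show "ulam R x0 l \<in> Wext R" "ulam R x0 l 0 = l" "\<And>a. a \<in> Pos \<Longrightarrow> 0 < inv (ulam R x0 l) bp \<bullet> a"
    using w w0 i v(2) by simp_all
qed

text \<open>Pulling positive roots back along \<open>inv (ulam R x0 l)\<close> yields affine roots
  through \<open>l\<close> that are positive on the alcove. They turn the criterion of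
  \<open>ulam_eqI\<close> into sign conditions.\<close>

lemma ulam_Aff_pos:
  assumes "l \<in> weights R" "a \<in> Pos"
  defines "\<psi> \<equiv> (\<lambda>x. x \<bullet> coroot a) \<circ> inv (ulam R x0 l)"
  shows "\<psi> \<in> Aff" "0 < \<psi> bp" "\<psi> l = 0"
proof -
  note u = ulam_props[OF assms(1)]
  show "\<psi> \<in> Aff"
    unfolding \<psi>_def using Aff_comp[OF Aff_posI[OF assms(2), of 0] Wext_inv[OF u(1)]] by simp
  show "0 < \<psi> bp" using u(3)[OF assms(2)] by (simp add: \<psi>_def inner_coroot_pos_iff)
  have "inv (ulam R x0 l) l = 0" using Wext_inv_simps(1)[OF u(1), of 0] u(2) by simp
  then show "\<psi> l = 0" by (simp add: \<psi>_def)
qed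

text \<open>The affine roots of \<open>ulam_Aff_pos\<close> vanish at \<open>l\<close> and
  \<open>rt j\<close> does not, so the reflection changes none of their signs on the alcove.\<close>

lemma ulam_sgen:
  assumes j: "j \<in> gens R x0" and l: "l \<in> weights R" and nz: "rt j l \<noteq> 0"
  shows "ulam R x0 (sgen j l) = sgen j \<circ> ulam R x0 l"
proof (rule ulam_eqI)
  note u = ulam_props[OF l]
  show "sgen j \<circ> ulam R x0 l \<in> Wext R" using Wext_comp[OF sgen_Wext[OF j] u(1)] .
  show "(sgen j \<circ> ulam R x0 l) 0 = sgen j l" by (simp add: u(2))
  fix a assume a: "a \<in> Pos"
  let ?\<psi> = "(\<lambda>x. x \<bullet> coroot a) \<circ> inv (ulam R x0 l)"
  note p = ulam_Aff_pos[OF l a]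
  have "?\<psi> \<noteq> rt j" using nz p(3) by metis
  then have "0 < ?\<psi> (sgen j bp)" using sgen_flips_only_rt[OF j p(1,2)] by blast
  moreover have "inv (sgen j \<circ> ulam R x0 l) = inv (ulam R x0 l) \<circ> sgen j"
    by (simp add: Wext_inv_o sgen_Wext j u(1) sgen_inv)
  ultimately show "0 < inv (sgen j \<circ> ulam R x0 l) bp \<bullet> a" by (simp add: inner_coroot_pos_iff)
qed

lemma ulam_Omega:
  assumes h: "h \<in> Omega R x0" and l: "l \<in> weights R"
  shows "ulam R x0 (h l) = h \<circ> ulam R x0 l"
proof (rule ulam_eqI)
  note u = ulam_props[OF l]
  show "h \<circ> ulam R x0 l \<in> Wext R" using Wext_comp[OF Omega_Wext[OF h] u(1)] .
  show "(h \<circ> ulam R x0 l) 0 = h l" by (simp add: u(2))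
  fix a assume a: "a \<in> Pos"
  note p = ulam_Aff_pos[OF l a]
  have "0 < ((\<lambda>x. x \<bullet> coroot a) \<circ> inv (ulam R x0 l)) (inv h bp)"
    using Aff_alcove_sign(2)[OF p(1) Omega_alcove[OF Omega_inv[OF h] bp_alcove]] p(2) by blast
  then show "0 < inv (h \<circ> ulam R x0 l) bp \<bullet> a"
    by (simp add: inner_coroot_pos_iff Wext_inv_o Omega_Wext h u(1))
qed

section \<open>Independence of reduced words\<close>

text \<open>Comparing linear parts identifies \<open>a\<close> with \<open>\<eta>\<close> times the
  image of \<open>b\<close>; the sign occurs twice in the reflection and cancels.\<close>

lemma sgen_conjugate:
  assumes w: "w \<in> Wext R" and eta: "\<eta> = 1 \<or> \<eta> = -1"
    and eq: "\<And>x. w x \<bullet> coroot a - of_int m = \<eta> * (x \<bullet> coroot b - of_int n)"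
  shows "sgen (a, m) \<circ> w = w \<circ> sgen (b, n)"
proof -
  obtain g l where g: "g \<in> W0 R" "l \<in> weights R" "w = (\<lambda>x. g x + l)" using w by (rule Wext_affineE)
  have lin: "linear g" using W0_linear[OF g(1)] .
  have "coroot (inv g a) = coroot (\<eta> *\<^sub>R b)"
  proof (rule vector_eq_rdot[THEN iffD1], rule allI)
    fix x
    have "x \<bullet> coroot (inv g a) = w x \<bullet> coroot a - w 0 \<bullet> coroot a"
      using linear_0[OF lin] by (simp add: g(3) inner_simps W0_shift[OF g(1)] W0_coroot[OF W0_inv[OF g(1)]])
    also have "\<dots> = \<eta> * (x \<bullet> coroot b)" using eq[of x] eq[of 0] by (simp add: algebra_simps)
    also have "\<dots> = x \<bullet> coroot (\<eta> *\<^sub>R b)" using eta by (auto simp: coroot_uminus)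
    finally show "coroot (inv g a) \<bullet> x = coroot (\<eta> *\<^sub>R b) \<bullet> x" by (simp add: inner_commute)
  qed
  then have "inv g a = \<eta> *\<^sub>R b" by (simp add: coroot_inject)
  then have a: "a = \<eta> *\<^sub>R g b" using W0_inv_simps(2)[OF g(1), of a] linear_scale[OF lin] by simp
  have "sgen (a, m) (w x) = w (sgen (b, n) x)" for x
  proof -
    have "sgen (a, m) (w x) = w x - (\<eta> * (x \<bullet> coroot b - of_int n)) *\<^sub>R a" by (simp add: sgen_def eq)
    also have "\<dots> = w x - (x \<bullet> coroot b - of_int n) *\<^sub>R g b" using eta by (auto simp: a)
    also have "\<dots> = w (sgen (b, n) x)"
      by (simp add: sgen_def g(3) linear_diff[OF lin] linear_scale[OF lin])
    finally show ?thesis .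
  qed
  then show ?thesis by auto
qed

text \<open>\<open>rt\<close> is oriented by the alcove while \<open>sgen_conjugate\<close> uses
  unoriented levels; the signs for \<open>j\<close>, for \<open>k\<close> and for the hypothesis
  combine into one.\<close>

lemma rt_conjugate:
  assumes j: "j \<in> gens R x0" and k: "k \<in> gens R x0" and w: "w \<in> Wext R"
    and eq: "rt j \<circ> w = rt k \<or> (\<lambda>x. - (rt j \<circ> w) x) = rt k"
  shows "sgen j \<circ> w = w \<circ> sgen k"
proof -
  obtain a m b n where jk: "j = (a, m)" "k = (b, n)" by (metis surj_pair)
  have ex: "\<exists>\<epsilon>\<in>{1, -1}. \<forall>x. rt i x = \<epsilon> * (x \<bullet> coroot (fst i) - of_int (snd i))" for i
  proof (cases "snd i = 0")
    case False
    then show ?thesis by (intro bexI[of _ "-1"]) (auto simp: rt_def)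
  qed (simp add: rt_def)
  obtain \<epsilon> where e: "\<epsilon> \<in> {1, -1}" "\<And>x. rt j x = \<epsilon> * (x \<bullet> coroot a - of_int m)" using ex[of j] unfolding jk fst_conv snd_conv by blast
  obtain \<zeta> where z: "\<zeta> \<in> {1, -1}" "\<And>x. rt k x = \<zeta> * (x \<bullet> coroot b - of_int n)" using ex[of k] unfolding jk fst_conv snd_conv by blast
  obtain \<sigma> :: real where s: "\<sigma> \<in> {1, -1}" "\<And>x. rt j (w x) = \<sigma> * rt k x"
  proof -
    from eq show thesis
    proof
      assume "rt j \<circ> w = rt k"
      then show thesis using that[of 1] by (auto simp: fun_eq_iff)
    next
      assume a: "(\<lambda>x. - (rt j \<circ> w) x) = rt k"
      have "rt j (w x) = - 1 * rt k x" for x using fun_cong[OF a, of x] by simp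
      then show thesis using that[of "-1"] by blast
    qed
  qed
  have "w x \<bullet> coroot a - of_int m = (\<epsilon> * \<sigma> * \<zeta>) * (x \<bullet> coroot b - of_int n)" for x
    using e(1) z(1) s(1) s(2)[of x] unfolding e(2) z(2) by auto
  moreover have "\<epsilon> * \<sigma> * \<zeta> = 1 \<or> \<epsilon> * \<sigma> * \<zeta> = -1" using e(1) z(1) s(1) by auto
  ultimately show ?thesis using sgen_conjugate[OF w] jk by blast
qed

text \<open>Being a left descent is a sign of \<open>rt j \<circ> w\<close> at \<open>bp\<close>.
  Right multiplication by \<open>sgen k\<close> can change it only if this function is
  \<open>rt k\<close> or its negative, and then \<open>rt_conjugate\<close> gives the excluded
  equality.\<close>

lemma left_descent_right_mult:
  assumes j: "j \<in> gens R x0" and k: "k \<in> gens R x0" and w: "w \<in> Wext R"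
    and ne: "sgen j \<circ> w \<noteq> w \<circ> sgen k"
  shows "len R x0 (sgen j \<circ> (w \<circ> sgen k)) < len R x0 (w \<circ> sgen k) \<longleftrightarrow> len R x0 (sgen j \<circ> w) < len R x0 w"
proof -
  let ?\<psi> = "rt j \<circ> w"
  have A: "?\<psi> \<in> Aff" using Aff_comp[OF rt_Aff[OF j] w] .
  have "?\<psi> \<noteq> rt k" "(\<lambda>x. - ?\<psi> x) \<noteq> rt k" using rt_conjugate[OF j k w] ne by blast+
  then have "0 < ?\<psi> bp \<Longrightarrow> 0 < ?\<psi> (sgen k bp)" "?\<psi> bp < 0 \<Longrightarrow> ?\<psi> (sgen k bp) < 0"
    using sgen_flips_only_rt[OF k A] sgen_flips_only_rt[OF k Aff_uminus[OF A]] by auto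
  then have "?\<psi> (sgen k bp) < 0 \<longleftrightarrow> ?\<psi> bp < 0" using Aff_bp_nz[OF A] by linarith
  then show ?thesis
    using len_sgen_less_iff[OF j w] len_sgen_less_iff[OF j Wext_comp[OF w sgen_Wext[OF k]]] by simp
qed

lemma right_descent_left_mult:
  assumes j: "j \<in> gens R x0" and k: "k \<in> gens R x0" and w: "w \<in> Wext R"
    and ne: "sgen j \<circ> w \<noteq> w \<circ> sgen k"
  shows "len R x0 (sgen j \<circ> (w \<circ> sgen k)) < len R x0 (sgen j \<circ> w) \<longleftrightarrow> len R x0 (w \<circ> sgen k) < len R x0 w"
proof -
  note W = Wext_comp Wext_inv sgen_Wext w j k
  have i1: "inv (sgen j \<circ> w) = inv w \<circ> sgen j" "inv (w \<circ> sgen k) = sgen k \<circ> inv w"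
    by (simp_all add: Wext_inv_o W sgen_inv)
  have "inv (sgen j \<circ> (w \<circ> sgen k)) = inv (w \<circ> sgen k) \<circ> inv (sgen j)" by (rule Wext_inv_o) (simp_all add: W)
  then have i2: "inv (sgen j \<circ> (w \<circ> sgen k)) = sgen k \<circ> (inv w \<circ> sgen j)"
    by (simp add: i1 sgen_inv j comp_assoc)
  have "sgen k \<circ> inv w \<noteq> inv w \<circ> sgen j"
    using ne Wext_inv_inv[OF Wext_comp[OF sgen_Wext[OF j] w]] Wext_inv_inv[OF Wext_comp[OF w sgen_Wext[OF k]]]
    unfolding i1 by metis
  from left_descent_right_mult[OF k j Wext_inv[OF w] this] show ?thesis
    unfolding i2[symmetric] unfolding i1[symmetric]
    using len_inv[OF w] len_inv[OF Wext_comp[OF sgen_Wext[OF j] w]] len_inv[OF Wext_comp[OF w sgen_Wext[OF k]]]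
      len_inv[OF Wext_comp[OF sgen_Wext[OF j] Wext_comp[OF w sgen_Wext[OF k]]]]
    by (simp only:)
qed

end

section \<open>Hecke operators on functions on the group\<close>

locale hecke_data = root_data R x0 for R :: "'v::euclidean_space set" and x0 +
  fixes q :: "('v \<Rightarrow> 'v) \<Rightarrow> real"
  assumes q_nz: "w \<in> Wext R \<Longrightarrow> q w \<noteq> 0"
    and q_mult: "w \<in> Wext R \<Longrightarrow> w' \<in> Wext R \<Longrightarrow> len R x0 (w \<circ> w') = len R x0 w + len R x0 w' \<Longrightarrow> q (w \<circ> w') = q w * q w'"
    and q_len0: "w \<in> Wext R \<Longrightarrow> len R x0 w = 0 \<Longrightarrow> q w = 1"
    and q_gen_pos: "j \<in> gens R x0 \<Longrightarrow> 0 < q (sgen j)"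
begin

lemma q_Omega_left: "u \<in> Omega R x0 \<Longrightarrow> w \<in> Wext R \<Longrightarrow> q (u \<circ> w) = q w"
  using q_mult[of u w] q_len0[of u] len_0_iff[of u] len_Omega_left[of u w] Omega_Wext[of u] by simp

lemma q_sgen_up:
  assumes "j \<in> gens R x0" "w \<in> Wext R" "len R x0 (sgen j \<circ> w) = Suc (len R x0 w)"
  shows "q (sgen j \<circ> w) = q (sgen j) * q w"
  using assms by (intro q_mult) (simp_all add: sgen_Wext len_sgen)

lemma q_sgen_right_up:
  assumes "j \<in> gens R x0" "w \<in> Wext R" "len R x0 (w \<circ> sgen j) = Suc (len R x0 w)"
  shows "q (w \<circ> sgen j) = q w * q (sgen j)"
  using assms by (intro q_mult) (simp_all add: sgen_Wext len_sgen)

text \<open>If the length goes up, \<open>q\<close> of the common product factors in two ways and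
  \<open>q w\<close> cancels. If it goes down, \<open>sgen j \<circ> w\<close> satisfies the same
  relation and goes up.\<close>

lemma q_conjugate_gens:
  assumes j: "j \<in> gens R x0" and k: "k \<in> gens R x0" and w: "w \<in> Wext R"
    and eq: "sgen j \<circ> w = w \<circ> sgen k"
  shows "q (sgen j) = q (sgen k)"
proof -
  have up: "q (sgen j) = q (sgen k)"
    if v: "v \<in> Wext R" "sgen j \<circ> v = v \<circ> sgen k" "len R x0 (sgen j \<circ> v) = Suc (len R x0 v)" for v
    using q_sgen_up[OF j v(1,3)] q_sgen_right_up[OF k v(1)] v(2,3) q_nz[OF v(1)] by simp
  from len_sgen_cases[OF j w] show ?thesis
  proof
    assume "len R x0 (sgen j \<circ> w) = Suc (len R x0 w)"
    then show ?thesis by (rule up[OF w eq])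
  next
    assume l: "len R x0 w = Suc (len R x0 (sgen j \<circ> w))"
    have "(sgen j \<circ> w) \<circ> sgen k = w" unfolding eq comp_assoc sgen_comp[OF k] by simp
    then show ?thesis using up[of "sgen j \<circ> w"] l Wext_comp[OF sgen_Wext[OF j] w] sgen_o_sgen[OF j, of w] by simp
  qed
qed

text \<open>The quadratic relation reads \<open>T_j^2 = 1 + kq j T_j\<close>, so the inverse of
  \<open>T_j\<close> is \<open>T_j - kq j\<close>.\<close>

definition kq :: "'v \<times> int \<Rightarrow> complex" where
  "kq j = complex_of_real (q (sgen j) - inverse (q (sgen j)))"

text \<open>Left and right operators on functions on the group, extended by zero outside the group so
  that operator identities can be stated as equalities of functions. \<open>LS j\<close> inverts the action of
  \<open>T\<^sub>j\<close> after embedding functions on the weight lattice by \<open>Emb\<close>; the right operators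
  commute with it and move any value of a function to the identity element.\<close>

definition LS :: "'v \<times> int \<Rightarrow> (('v \<Rightarrow> 'v) \<Rightarrow> complex) \<Rightarrow> ('v \<Rightarrow> 'v) \<Rightarrow> complex" where
  "LS j G w = (if w \<in> Wext R
     then G (sgen j \<circ> w) - (if len R x0 (sgen j \<circ> w) < len R x0 w then kq j * G w else 0) else 0)"

definition RS :: "'v \<times> int \<Rightarrow> (('v \<Rightarrow> 'v) \<Rightarrow> complex) \<Rightarrow> ('v \<Rightarrow> 'v) \<Rightarrow> complex" where
  "RS k G w = (if w \<in> Wext R
     then G (w \<circ> sgen k) - (if len R x0 (w \<circ> sgen k) < len R x0 w then kq k * G w else 0) else 0)"

definition LU :: "('v \<Rightarrow> 'v) \<Rightarrow> (('v \<Rightarrow> 'v) \<Rightarrow> complex) \<Rightarrow> ('v \<Rightarrow> 'v) \<Rightarrow> complex" where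
  "LU u G w = (if w \<in> Wext R then G (u \<circ> w) else 0)"

definition RU :: "('v \<Rightarrow> 'v) \<Rightarrow> (('v \<Rightarrow> 'v) \<Rightarrow> complex) \<Rightarrow> ('v \<Rightarrow> 'v) \<Rightarrow> complex" where
  "RU u G w = (if w \<in> Wext R then G (w \<circ> u) else 0)"

definition Emb :: "('v \<Rightarrow> complex) \<Rightarrow> ('v \<Rightarrow> 'v) \<Rightarrow> complex" where
  "Emb f w = (if w \<in> Wext R then f (w 0) / complex_of_real (q w) else 0)"

text \<open>If \<open>sgen j \<circ> w\<close> and \<open>w \<circ> sgen k\<close> differ,
  multiplication on one side does not affect descents on the other, and both composites expand to
  the same terms. If they coincide, so do the length tests, and \<open>q_conjugate_gens\<close>
  makes the coefficients equal.\<close>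

lemma LS_RS:
  assumes j: "j \<in> gens R x0" and k: "k \<in> gens R x0"
  shows "LS j (RS k G) = RS k (LS j G)"
proof
  fix w
  show "LS j (RS k G) w = RS k (LS j G) w"
  proof (cases "w \<in> Wext R")
    case w: True
    have W: "sgen j \<circ> w \<in> Wext R" "w \<circ> sgen k \<in> Wext R" using w j k by (simp_all add: Wext_comp sgen_Wext)
    have e: "LS j (RS k G) w = G (sgen j \<circ> (w \<circ> sgen k))
        - (if len R x0 (sgen j \<circ> (w \<circ> sgen k)) < len R x0 (sgen j \<circ> w) then kq k * G (sgen j \<circ> w) else 0)
        - (if len R x0 (sgen j \<circ> w) < len R x0 w then kq j * (G (w \<circ> sgen k)
          - (if len R x0 (w \<circ> sgen k) < len R x0 w then kq k * G w else 0)) else 0)"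
      using w W by (simp only: LS_def RS_def if_True comp_assoc)
    have e': "RS k (LS j G) w = G (sgen j \<circ> (w \<circ> sgen k))
        - (if len R x0 (sgen j \<circ> (w \<circ> sgen k)) < len R x0 (w \<circ> sgen k) then kq j * G (w \<circ> sgen k) else 0)
        - (if len R x0 (w \<circ> sgen k) < len R x0 w then kq k * (G (sgen j \<circ> w)
          - (if len R x0 (sgen j \<circ> w) < len R x0 w then kq j * G w else 0)) else 0)"
      using w W by (simp only: LS_def RS_def if_True comp_assoc)
    show ?thesis
    proof (cases "sgen j \<circ> w = w \<circ> sgen k")
      case True
      have kk: "kq j = kq k" by (simp add: kq_def q_conjugate_gens[OF j k w True])
      have "sgen j \<circ> (w \<circ> sgen k) = w" unfolding True[symmetric] by (rule sgen_o_sgen[OF j])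
      then show ?thesis unfolding e e' kk True by (auto simp: algebra_simps)
    next
      case False
      show ?thesis
        unfolding e e' left_descent_right_mult[OF j k w False] right_descent_left_mult[OF j k w False]
        by (simp only: right_diff_distrib mult_zero_right split: if_split) (simp add: algebra_simps)
    qed
  qed (simp add: LS_def RS_def)
qed

lemma LS_RU:
  assumes j: "j \<in> gens R x0" and u: "u \<in> Omega R x0"
  shows "LS j (RU u G) = RU u (LS j G)"
proof
  fix w
  show "LS j (RU u G) w = RU u (LS j G) w"
  proof (cases "w \<in> Wext R")
    case w: True
    have W: "sgen j \<circ> w \<in> Wext R" "w \<circ> u \<in> Wext R" using w j u by (simp_all add: Wext_comp sgen_Wext Omega_Wext)
    have "len R x0 (sgen j \<circ> (w \<circ> u)) = len R x0 (sgen j \<circ> w)" "len R x0 (w \<circ> u) = len R x0 w"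
      using len_Omega_right[OF u W(1)] len_Omega_right[OF u w] by (simp_all only: comp_assoc)
    then show ?thesis using w W by (simp only: LS_def RU_def if_True comp_assoc)
  qed (simp add: LS_def RU_def)
qed

lemma LU_RS:
  assumes u: "u \<in> Omega R x0" and k: "k \<in> gens R x0"
  shows "LU u (RS k G) = RS k (LU u G)"
proof
  fix w
  show "LU u (RS k G) w = RS k (LU u G) w"
  proof (cases "w \<in> Wext R")
    case w: True
    have W: "u \<circ> w \<in> Wext R" "w \<circ> sgen k \<in> Wext R" using w k u by (simp_all add: Wext_comp sgen_Wext Omega_Wext)
    have "len R x0 (u \<circ> (w \<circ> sgen k)) = len R x0 (w \<circ> sgen k)" "len R x0 (u \<circ> w) = len R x0 w"
      using len_Omega_left[OF u W(2)] len_Omega_left[OF u w] by (simp_all only: comp_assoc)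
    then show ?thesis using w W by (simp only: RS_def LU_def if_True comp_assoc)
  qed (simp add: RS_def LU_def)
qed

lemma LU_RU:
  assumes u: "u \<in> Omega R x0" and v: "v \<in> Omega R x0"
  shows "LU u (RU v G) = RU v (LU u G)"
proof
  fix w
  show "LU u (RU v G) w = RU v (LU u G) w"
    using Wext_comp[OF Omega_Wext[OF u], of w] Wext_comp[OF _ Omega_Wext[OF v], of w]
    by (simp only: LU_def RU_def comp_assoc split: if_split) blast
qed

text \<open>\<open>chi\<close> compares \<open>l\<close> with the whole alcove. The wall coordinate
  has constant sign there, so the sign of \<open>rt j l\<close> decides, and the point
  \<open>bp\<close> rules out the opposite alternative.\<close>

lemma chi_eq:
  assumes j: "j \<in> gens R x0"
  shows "chi R x0 q j l = (if rt j l = 0 then 1 else if rt j l < 0 then complex_of_real (q (sgen j))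
    else complex_of_real (inverse (q (sgen j))))"
  using j
proof (cases rule: gens_cases)
  case affine
  have A: "x \<bullet> coroot (alpha0 R x0) < 1" if "x \<in> alcoveA R x0" for x
    using alcoveD[OF that alpha0_Pos] by simp
  then have "\<not> (\<forall>x\<in>alcoveA R x0. 1 < x \<bullet> coroot (alpha0 R x0))" using bp_alcove by (meson less_asym)
  then show ?thesis using A affine by (auto simp: chi_def rt_def Let_def)
next
  case (finite s)
  have A: "0 < x \<bullet> coroot s" if "x \<in> alcoveA R x0" for x
    using alcoveD[OF that Sim_Pos[OF finite(1)]] by simp
  then have "\<not> (\<forall>x\<in>alcoveA R x0. x \<bullet> coroot s < 0)" using bp_alcove by (meson less_asym)
  then show ?thesis using A finite by (auto simp: chi_def rt_def Let_def)
qed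

lemma Tgen_values:
  assumes j: "j \<in> gens R x0"
  shows "rt j l = 0 \<Longrightarrow> Tgen R x0 q j f l = complex_of_real (q (sgen j)) * f l"
    and "rt j l < 0 \<Longrightarrow> Tgen R x0 q j f l = complex_of_real (q (sgen j)) * f (sgen j l)"
    and "0 < rt j l \<Longrightarrow> Tgen R x0 q j f l = kq j * f l + f (sgen j l) / complex_of_real (q (sgen j))"
  using q_gen_pos[OF j]
  by (simp_all add: Tgen_def act_def sgen_inv[OF j] chi_eq[OF j] sgen_fixed kq_def divide_inverse algebra_simps)

text \<open>The length test depends on the sign of \<open>rt j\<close> at \<open>w bp\<close>,
  whereas \<open>Tgen\<close> depends on the sign at \<open>w 0\<close>. As 0 is a vertex of the
  alcove, the signs agree unless \<open>w 0\<close> is on the wall, where \<open>Tgen\<close> is the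
  scalar \<open>q (sgen j)\<close>. The division by \<open>q w\<close> absorbs the remaining
  factors.\<close>

lemma LS_Emb:
  assumes j: "j \<in> gens R x0"
  shows "LS j (Emb (Tgen R x0 q j f)) = Emb f"
proof
  fix w
  show "LS j (Emb (Tgen R x0 q j f)) w = Emb f w"
  proof (cases "w \<in> Wext R")
    case w: True
    let ?T = "Tgen R x0 q j f" and ?c = "complex_of_real (q (sgen j))" and ?l = "w 0"
    have sw: "sgen j \<circ> w \<in> Wext R" using Wext_comp[OF sgen_Wext[OF j] w] .
    have c0: "?c \<noteq> 0" using q_gen_pos[OF j] by simp
    have qw: "complex_of_real (q w) \<noteq> 0" "complex_of_real (q (sgen j \<circ> w)) \<noteq> 0" using q_nz[OF w] q_nz[OF sw] by simp_all
    have kq: "kq j = ?c - 1 / ?c" by (simp add: kq_def divide_inverse)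
    have l: "?l \<in> weights R" using Wext_weights[OF w weights_zero] .
    have A: "rt j \<circ> w \<in> Aff" using Aff_comp[OF rt_Aff[OF j] w] .
    consider "0 < rt j (w bp)" | "rt j (w bp) < 0" using rt_W_nz[OF j w] by linarith
    then show ?thesis
    proof cases
      case 1
      have len: "len R x0 (sgen j \<circ> w) = Suc (len R x0 w)" using len_sgen_up[OF j w 1] .
      have q: "complex_of_real (q (sgen j \<circ> w)) = ?c * complex_of_real (q w)" by (simp add: q_sgen_up[OF j w len])
      have "0 \<le> rt j ?l" using Aff_zero_nonneg[OF A] 1 by simp
      then have "?T (sgen j ?l) = ?c * f ?l"
        using Tgen_values(1,2)[OF j, of "sgen j ?l" f] rt_sgen[OF j, of ?l] sgen_sgen[OF j] sgen_fixed[of j ?l]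
        by (cases "rt j ?l = 0") auto
      then show ?thesis using w sw len c0 qw by (simp add: LS_def Emb_def q)
    next
      case 2
      have len: "len R x0 w = Suc (len R x0 (sgen j \<circ> w))" using len_sgen_down[OF j w 2] .
      have q: "complex_of_real (q w) = ?c * complex_of_real (q (sgen j \<circ> w))"
        using q_sgen_up[OF j sw] len sgen_o_sgen[OF j, of w] by simp
      have "0 \<le> (\<lambda>x. - (rt j \<circ> w) x) 0" using Aff_zero_nonneg[OF Aff_uminus[OF A]] 2 by simp
      \<comment> \<open>Off the wall the two \<open>kq j\<close> terms cancel; on the wall the
        identity is \<open>c - (c - 1/c) = 1/c\<close>.\<close>
      then have "?T (sgen j ?l) - kq j * (?T ?l / ?c) = f ?l / ?c"
        using Tgen_values[OF j, of "sgen j ?l" f] Tgen_values[OF j, of ?l f] rt_sgen[OF j, of ?l] sgen_sgen[OF j] sgen_fixed[of j ?l] c0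
        by (cases "rt j ?l = 0") (auto simp: kq field_simps)
      then have "(?T (sgen j ?l) - kq j * (?T ?l / ?c)) / complex_of_real (q (sgen j \<circ> w))
          = f ?l / ?c / complex_of_real (q (sgen j \<circ> w))" by (simp only:)
      then show ?thesis using w sw len by (simp add: LS_def Emb_def q diff_divide_distrib)
    qed
  qed (simp add: LS_def Emb_def)
qed

lemma LU_Emb:
  assumes u: "u \<in> Omega R x0"
  shows "LU u (Emb (act u f)) = Emb f"
proof
  fix w show "LU u (Emb (act u f)) w = Emb f w"
    using Wext_comp[OF Omega_Wext[OF u], of w] q_Omega_left[OF u, of w] Wext_inv_simps(1)[OF Omega_Wext[OF u]]
    by (simp add: LU_def Emb_def act_def)
qed

text \<open>The system for the pair \<open>w\<close>, \<open>sgen j \<circ> w\<close> is triangular: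
  evaluation at the shorter element gives \<open>G\<close> at the longer one, and evaluation at the
  longer one then gives the other value.\<close>

lemma LS_inj:
  assumes j: "j \<in> gens R x0" and eq: "\<And>w. w \<in> Wext R \<Longrightarrow> LS j G w = LS j G' w" and w: "w \<in> Wext R"
  shows "G w = G' w"
proof -
  have sw: "sgen j \<circ> w \<in> Wext R" using Wext_comp[OF sgen_Wext[OF j] w] .
  note e1 = eq[OF w] and e2 = eq[OF sw]
  show ?thesis
    using len_sgen_cases[OF j w] e1 e2 w sw sgen_o_sgen[OF j, of w]
    by (simp only: LS_def if_True) (auto split: if_splits)
qed

lemma LU_inj:
  assumes u: "u \<in> Omega R x0" and eq: "\<And>w. w \<in> Wext R \<Longrightarrow> LU u G w = LU u G' w" and w: "w \<in> Wext R"
  shows "G w = G' w"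
proof -
  have "u \<circ> (inv u \<circ> w) = w" by (simp add: o_assoc Wext_inv_comp Omega_Wext[OF u])
  moreover have "inv u \<circ> w \<in> Wext R" by (simp add: Wext_comp Wext_inv Omega_Wext u w)
  ultimately show ?thesis using eq[of "inv u \<circ> w"] by (simp only: LU_def if_True)
qed

section \<open>Operators commuting with the right action\<close>

definition right_equivariant :: "((('v \<Rightarrow> 'v) \<Rightarrow> complex) \<Rightarrow> ('v \<Rightarrow> 'v) \<Rightarrow> complex) \<Rightarrow> bool" where
  "right_equivariant Z \<longleftrightarrow>
     (\<forall>k\<in>gens R x0. \<forall>G. Z (RS k G) = RS k (Z G)) \<and> (\<forall>u\<in>Omega R x0. \<forall>G. Z (RU u G) = RU u (Z G))"

text \<open>\<open>Z\<close> plays the inverse of \<open>T\<close> seen through \<open>Emb\<close>.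
  Its injectivity is recorded because two operators are compared by cancelling \<open>Z\<close>, and
  it is restricted to group elements because functions may be arbitrary elsewhere.\<close>

definition represents :: "('v \<Rightarrow> 'v) \<Rightarrow> (('v \<Rightarrow> complex) \<Rightarrow> 'v \<Rightarrow> complex) \<Rightarrow> bool" where
  "represents w T \<longleftrightarrow> w \<in> Wext R \<and> (\<exists>Z. right_equivariant Z \<and> (\<forall>G. Z G id = G w) \<and>
     (\<forall>f. Z (Emb (T f)) = Emb f) \<and>
     (\<forall>G G'. (\<forall>v\<in>Wext R. Z G v = Z G' v) \<longrightarrow> (\<forall>v\<in>Wext R. G v = G' v)))"

text \<open>A right descent \<open>k\<close> of \<open>v\<close> writes a value at \<open>v\<close>
  as a value of \<open>RS k\<close> at a shorter element, and equivariance moves \<open>RS k\<close>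
  inside \<open>Z\<close>. At length zero \<open>RU v\<close> moves the value to \<open>id\<close>,
  where it is prescribed.\<close>

lemma right_equivariant_unique:
  assumes Z: "right_equivariant Z" "\<And>G. Z G id = G w" and Z': "right_equivariant Z'" "\<And>G. Z' G id = G w"
    and v: "v \<in> Wext R"
  shows "Z G v = Z' G v"
  using v
proof (induction "len R x0 v" arbitrary: v G rule: less_induct)
  case less
  show ?case
  proof (cases "len R x0 v = 0")
    case True
    then have v: "v \<in> Omega R x0" using len_0_iff[OF less.prems] by simp
    have "H v = RU v H id" for H by (simp add: RU_def Wext_id)
    moreover have "RU v (Z G) = Z (RU v G)" "RU v (Z' G) = Z' (RU v G)" using Z Z' v by (simp_all add: right_equivariant_def)
    ultimately show ?thesis using Z(2) Z'(2) by metis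
  next
    case False
    then obtain k where k: "k \<in> gens R x0" "len R x0 (v \<circ> sgen k) < len R x0 v"
      using ex_right_descent[OF less.prems] by blast
    let ?v = "v \<circ> sgen k"
    have W: "?v \<in> Wext R" using Wext_comp[OF less.prems sgen_Wext[OF k(1)]] .
    have vv: "?v \<circ> sgen k = v" unfolding comp_assoc sgen_comp[OF k(1)] by simp
    have "H v = RS k H ?v" for H using k(2) W vv by (simp only: RS_def if_True) simp
    moreover have "RS k (Z G) = Z (RS k G)" "RS k (Z' G) = Z' (RS k G)"
      using Z Z' k(1) by (simp_all add: right_equivariant_def)
    ultimately show ?thesis using less.hyps[OF k(2) W] by metis
  qed
qed

lemma representsI:
  assumes "w \<in> Wext R" "right_equivariant Z" "\<And>G. Z G id = G w" "\<And>f. Z (Emb (T f)) = Emb f"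
    "\<And>G G'. \<forall>v\<in>Wext R. Z G v = Z G' v \<Longrightarrow> \<forall>v\<in>Wext R. G v = G' v"
  shows "represents w T"
  unfolding represents_def by (intro conjI exI[of _ Z] allI impI) (fact assms)+

text \<open>The two inverses coincide on the group, so \<open>Z\<close> sends both
  \<open>Emb (T f)\<close> and \<open>Emb (T' f)\<close> to \<open>Emb f\<close> there, and
  injectivity cancels \<open>Z\<close>.\<close>

lemma represents_unique:
  assumes "represents w T" "represents w T'" "l \<in> weights R"
  shows "T f l = T' f l"
proof -
  obtain Z where Zo: "right_equivariant Z" "\<forall>G. Z G id = G w" "\<forall>f. Z (Emb (T f)) = Emb f"
    and injo: "\<forall>G G'. (\<forall>v\<in>Wext R. Z G v = Z G' v) \<longrightarrow> (\<forall>v\<in>Wext R. G v = G' v)"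
    using assms(1) unfolding represents_def by blast
  note Z = Zo(1) Zo(2)[rule_format] Zo(3)[rule_format] and inj = injo[THEN spec, THEN spec, THEN mp]
  obtain Z' where Zo': "right_equivariant Z'" "\<forall>G. Z' G id = G w" "\<forall>f. Z' (Emb (T' f)) = Emb f"
    using assms(2) unfolding represents_def by blast
  note Z' = Zo'(1) Zo'(2)[rule_format] Zo'(3)[rule_format]
  have "Z (Emb (T f)) v = Z (Emb (T' f)) v" if "v \<in> Wext R" for v
    using right_equivariant_unique[OF Z(1,2) Z'(1,2) that, of "Emb (T' f)"] Z(3)[of f] Z'(3)[of f] by simp
  \<comment> \<open>The translation by \<open>l\<close> sends 0 to \<open>l\<close>, so evaluating
    \<open>Emb\<close> at it recovers the value at \<open>l\<close>.\<close>
  then have "Emb (T f) (transl l) = Emb (T' f) (transl l)"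
    using inj transl_Wext[OF assms(3)] by blast
  then show ?thesis using q_nz[OF transl_Wext[OF assms(3)]] transl_Wext[OF assms(3)] by (simp add: Emb_def transl_def)
qed

lemma represents_id: "represents id id"
  unfolding represents_def right_equivariant_def by (intro conjI Wext_id exI[of _ "\<lambda>G. G"]) simp_all

text \<open>Inverting \<open>T \<circ> Tgen R x0 q j\<close> reverses the order, so
  \<open>LS j\<close> is applied after \<open>Z\<close>. At \<open>id\<close> it agrees with
  \<open>RS j\<close>, which passes through \<open>Z\<close> and, as the length goes up, shifts
  \<open>w\<close> to \<open>w \<circ> sgen j\<close> without a correction term.\<close>

lemma represents_sgen:
  assumes "represents w T" and j: "j \<in> gens R x0" and up: "len R x0 (w \<circ> sgen j) = Suc (len R x0 w)"
  shows "represents (w \<circ> sgen j) (T \<circ> Tgen R x0 q j)"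
proof -
  obtain Z where w: "w \<in> Wext R" and Zo: "right_equivariant Z" "\<forall>G. Z G id = G w" "\<forall>f. Z (Emb (T f)) = Emb f"
    and injo: "\<forall>G G'. (\<forall>v\<in>Wext R. Z G v = Z G' v) \<longrightarrow> (\<forall>v\<in>Wext R. G v = G' v)"
    using assms(1) unfolding represents_def by blast
  note Z = Zo(1) Zo(2)[rule_format] Zo(3)[rule_format] and inj = injo[THEN spec, THEN spec, THEN mp]
  have "right_equivariant (\<lambda>G. LS j (Z G))"
    using Z(1) LS_RS[OF j] LS_RU[OF j] by (simp add: right_equivariant_def)
  moreover have "LS j (Z G) id = G (w \<circ> sgen j)" for G
  proof -
    have "LS j (Z G) id = Z G (sgen j)" by (simp add: LS_def Wext_id len_id)
    also have "\<dots> = RS j (Z G) id" by (simp add: RS_def Wext_id len_id)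
    also have "\<dots> = Z (RS j G) id" using Z(1) j by (simp add: right_equivariant_def)
    also have "\<dots> = RS j G w" by (rule Z(2))
    also have "\<dots> = G (w \<circ> sgen j)" using w up by (simp add: RS_def)
    finally show ?thesis .
  qed
  moreover have "LS j (Z (Emb ((T \<circ> Tgen R x0 q j) f))) = Emb f" for f
    by (simp add: Z(3) LS_Emb[OF j])
  moreover have "\<forall>v\<in>Wext R. G v = G' v" if "\<forall>v\<in>Wext R. LS j (Z G) v = LS j (Z G') v" for G G'
    using LS_inj[OF j, of "Z G" "Z G'"] that inj by blast
  ultimately show ?thesis
    by (intro representsI[OF Wext_comp[OF w sgen_Wext[OF j]], of "\<lambda>G. LS j (Z G)"])
qed

lemma represents_Omega:
  assumes "represents w T" and u: "u \<in> Omega R x0"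
  shows "represents (w \<circ> u) (T \<circ> act u)"
proof -
  obtain Z where w: "w \<in> Wext R" and Zo: "right_equivariant Z" "\<forall>G. Z G id = G w" "\<forall>f. Z (Emb (T f)) = Emb f"
    and injo: "\<forall>G G'. (\<forall>v\<in>Wext R. Z G v = Z G' v) \<longrightarrow> (\<forall>v\<in>Wext R. G v = G' v)"
    using assms(1) unfolding represents_def by blast
  note Z = Zo(1) Zo(2)[rule_format] Zo(3)[rule_format] and inj = injo[THEN spec, THEN spec, THEN mp]
  have "right_equivariant (\<lambda>G. LU u (Z G))"
    using Z(1) LU_RS[OF u] LU_RU[OF u] by (simp add: right_equivariant_def)
  moreover have "LU u (Z G) id = G (w \<circ> u)" for G
  proof -
    have "LU u (Z G) id = RU u (Z G) id" by (simp add: LU_def RU_def Wext_id)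
    also have "\<dots> = Z (RU u G) id" using Z(1) u by (simp add: right_equivariant_def)
    also have "\<dots> = G (w \<circ> u)" using w by (simp add: Z(2) RU_def)
    finally show ?thesis .
  qed
  moreover have "LU u (Z (Emb ((T \<circ> act u) f))) = Emb f" for f
    by (simp add: Z(3) LU_Emb[OF u])
  moreover have "\<forall>v\<in>Wext R. G v = G' v" if "\<forall>v\<in>Wext R. LU u (Z G) v = LU u (Z G') v" for G G'
    using LU_inj[OF u, of "Z G" "Z G'"] that inj by blast
  ultimately show ?thesis
    by (intro representsI[OF Wext_comp[OF w Omega_Wext[OF u]], of "\<lambda>G. LU u (Z G)"])
qed

section \<open>Reduced words and the operators they define\<close>

definition sgen_word :: "('v \<times> int) list \<Rightarrow> 'v \<Rightarrow> 'v" where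
  "sgen_word js = foldr (\<circ>) (map sgen js) id"

definition Tgen_word :: "('v \<times> int) list \<Rightarrow> ('v \<Rightarrow> complex) \<Rightarrow> 'v \<Rightarrow> complex" where
  "Tgen_word js = foldr (\<circ>) (map (Tgen R x0 q) js) id"

lemma sgen_word_simps: "sgen_word [] = id" "sgen_word (j # js) = sgen j \<circ> sgen_word js" "sgen_word (js @ [j]) = sgen_word js \<circ> sgen j"
  unfolding sgen_word_def map_append foldr_comp_append by simp_all

lemma Tgen_word_simps: "Tgen_word [] = id" "Tgen_word (j # js) = Tgen R x0 q j \<circ> Tgen_word js" "Tgen_word (js @ [j]) = Tgen_word js \<circ> Tgen R x0 q j"
  unfolding Tgen_word_def map_append foldr_comp_append by simp_all

lemma sgen_word_Wext: "set js \<subseteq> gens R x0 \<Longrightarrow> sgen_word js \<in> Wext R"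
  by (induction js) (simp_all add: sgen_word_simps Wext_id Wext_comp sgen_Wext)

lemma sgen_word_rev: "set js \<subseteq> gens R x0 \<Longrightarrow> sgen_word (rev js) = inv (sgen_word js)"
  by (induction js) (simp_all add: sgen_word_simps Wext_inv_o sgen_inv sgen_Wext sgen_word_Wext)

lemma len_sgen_word_le:
  assumes "u \<in> Omega R x0" "set js \<subseteq> gens R x0"
  shows "len R x0 (u \<circ> sgen_word js) \<le> length js"
  using assms(2)
proof (induction js rule: rev_induct)
  case Nil
  then show ?case using assms(1) by (simp add: sgen_word_simps len_0_iff Omega_Wext)
next
  case (snoc j js)
  have "u \<circ> sgen_word js \<in> Wext R" using assms(1) snoc.prems by (simp add: Wext_comp Omega_Wext sgen_word_Wext)
  moreover have "len R x0 (u \<circ> sgen_word js) \<le> length js" by (rule snoc.IH) (use snoc.prems in simp)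
  moreover have "j \<in> gens R x0" using snoc.prems by simp
  ultimately have "len R x0 ((u \<circ> sgen_word js) \<circ> sgen j) \<le> Suc (length js)"
    using len_right_sgen_cases[of j "u \<circ> sgen_word js"] by linarith
  then show ?case by (simp only: sgen_word_simps comp_assoc length_append_singleton)
qed

text \<open>Words grow on the right. By \<open>len_sgen_word_le\<close> a prefix of a reduced word
  is reduced, so every letter raises the length as \<open>represents_sgen\<close> demands.\<close>

lemma represents_word:
  assumes u: "u \<in> Omega R x0" and "set js \<subseteq> gens R x0" "len R x0 (u \<circ> sgen_word js) = length js"
  shows "represents (u \<circ> sgen_word js) (act u \<circ> Tgen_word js)"
  using assms(2,3)
proof (induction js rule: rev_induct)
  case Nil
  then show ?case using represents_Omega[OF represents_id u] by (simp add: sgen_word_simps Tgen_word_simps)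
next
  case (snoc j js)
  have j: "j \<in> gens R x0" and js: "set js \<subseteq> gens R x0" using snoc.prems by auto
  have W: "u \<circ> sgen_word js \<in> Wext R" using u js by (simp add: Wext_comp Omega_Wext sgen_word_Wext)
  have eq: "u \<circ> sgen_word (js @ [j]) = (u \<circ> sgen_word js) \<circ> sgen j" by (simp only: sgen_word_simps comp_assoc)
  have up: "len R x0 ((u \<circ> sgen_word js) \<circ> sgen j) = Suc (length js)" using snoc.prems(2) unfolding eq length_append_singleton .
  have l: "len R x0 (u \<circ> sgen_word js) = length js"
    using up len_right_sgen_cases[OF j W] len_sgen_word_le[OF u js] by linarith
  have "represents ((u \<circ> sgen_word js) \<circ> sgen j) ((act u \<circ> Tgen_word js) \<circ> Tgen R x0 q j)"
    by (rule represents_sgen[OF snoc.IH[OF js l] j]) (simp only: up l)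
  then show ?case by (simp only: eq Tgen_word_simps comp_assoc)
qed

lemma ex_reduced_word:
  assumes "w \<in> Wext R"
  shows "\<exists>u js. u \<in> Omega R x0 \<and> set js \<subseteq> gens R x0 \<and> length js = len R x0 w \<and> w = u \<circ> sgen_word js"
  using assms
proof (induction "len R x0 w" arbitrary: w rule: less_induct)
  case less
  show ?case
  proof (cases "len R x0 w = 0")
    case True
    then show ?thesis using len_0_iff[OF less.prems] by (intro exI[of _ w] exI[of _ "[]"]) (simp add: sgen_word_simps)
  next
    case False
    then obtain k where k: "k \<in> gens R x0" "len R x0 (w \<circ> sgen k) < len R x0 w"
      using ex_right_descent[OF less.prems] by blast
    obtain u js where u: "u \<in> Omega R x0" "set js \<subseteq> gens R x0" "length js = len R x0 (w \<circ> sgen k)" "w \<circ> sgen k = u \<circ> sgen_word js"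
      using less.hyps[OF k(2) Wext_comp[OF less.prems sgen_Wext[OF k(1)]]] by blast
    have "w = (w \<circ> sgen k) \<circ> sgen k" unfolding comp_assoc sgen_comp[OF k(1)] by simp
    then have "w = u \<circ> sgen_word (js @ [k])" unfolding u(4) by (simp only: sgen_word_simps comp_assoc)
    moreover have "length (js @ [k]) = len R x0 w" using u(3) len_right_sgen_cases[OF k(1) less.prems] k(2) by simp
    moreover have "set (js @ [k]) \<subseteq> gens R x0" using u(2) k(1) by simp
    ultimately show ?thesis using u(1) by blast
  qed
qed

lemma hatT_basis_word:
  assumes "w \<in> Wext R"
  obtains u js where "u \<in> Omega R x0" "set js \<subseteq> gens R x0" "length js = len R x0 w" "w = u \<circ> sgen_word js"
    "hatT_basis R x0 q w = act u \<circ> Tgen_word js"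
proof -
  have "\<exists>T u js. u \<in> Omega R x0 \<and> set js \<subseteq> gens R x0 \<and>
      length js = len R x0 w \<and> w = u \<circ> foldr (\<circ>) (map sgen js) id \<and>
      T = act u \<circ> foldr (\<circ>) (map (Tgen R x0 q) js) id"
    using ex_reduced_word[OF assms] unfolding sgen_word_def by blast
  then have "\<exists>u js. u \<in> Omega R x0 \<and> set js \<subseteq> gens R x0 \<and>
      length js = len R x0 w \<and> w = u \<circ> foldr (\<circ>) (map sgen js) id \<and>
      hatT_basis R x0 q w = act u \<circ> foldr (\<circ>) (map (Tgen R x0 q) js) id"
    unfolding hatT_basis_def by (rule someI_ex)
  then show thesis using that unfolding sgen_word_def Tgen_word_def by blast
qed

text \<open>The reversed product has its length-zero factor on the right, the product chosen for the
  inverse has it on the left. Both represent the same group element and hence agree at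
  weights.\<close>

lemma hatT_basis_inv:
  assumes u: "u \<in> Omega R x0" and js: "set js \<subseteq> gens R x0" and len: "length js = len R x0 (u \<circ> sgen_word js)"
    and l: "l \<in> weights R"
  shows "hatT_basis R x0 q (inv (u \<circ> sgen_word js)) f l = (Tgen_word (rev js) \<circ> act (inv u)) f l"
proof -
  let ?w = "u \<circ> sgen_word js"
  have w: "?w \<in> Wext R" using u js by (simp add: Wext_comp Omega_Wext sgen_word_Wext)
  have idO: "id \<in> Omega R x0" using len_0_iff[OF Wext_id] len_id by simp
  have rjs: "set (rev js) \<subseteq> gens R x0" using js by simp
  have inv: "inv ?w = sgen_word (rev js) \<circ> inv u"
    using u js by (simp add: Wext_inv_o Omega_Wext sgen_word_Wext sgen_word_rev)
  have "len R x0 (sgen_word (rev js)) = len R x0 (sgen_word (rev js) \<circ> inv u)"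
    using len_Omega_right[OF Omega_inv[OF u] sgen_word_Wext[OF rjs]] by simp
  also have "\<dots> = length (rev js)" using len inv len_inv[OF w] by simp
  finally have "len R x0 (id \<circ> sgen_word (rev js)) = length (rev js)" by simp
  then have "represents (id \<circ> sgen_word (rev js)) (act id \<circ> Tgen_word (rev js))" by (rule represents_word[OF idO rjs])
  moreover have "act id \<circ> Tgen_word (rev js) = Tgen_word (rev js)" by (simp add: fun_eq_iff act_def)
  ultimately have "represents (sgen_word (rev js)) (Tgen_word (rev js))" by simp
  then have r1: "represents (inv ?w) (Tgen_word (rev js) \<circ> act (inv u))" unfolding inv by (rule represents_Omega[OF _ Omega_inv[OF u]])
  obtain v ks where v: "v \<in> Omega R x0" "set ks \<subseteq> gens R x0" "length ks = len R x0 (inv ?w)" "inv ?w = v \<circ> sgen_word ks"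
    "hatT_basis R x0 q (inv ?w) = act v \<circ> Tgen_word ks"
    using hatT_basis_word[OF Wext_inv[OF w]] by blast
  have "represents (inv ?w) (hatT_basis R x0 q (inv ?w))"
    using represents_word[OF v(1,2) v(3)[unfolded v(4), symmetric]] unfolding v(5) unfolding v(4) .
  then show ?thesis using represents_unique[OF _ r1 l] by blast
qed

section \<open>Bounded operators and adjoints\<close>

abbreviation P where "P \<equiv> weights R"
abbreviation D where "D \<equiv> delta R x0 q"
abbreviation L2 where "L2 \<equiv> l2 R x0 q"
abbreviation nsq where "nsq \<equiv> normsq R x0 q"
abbreviation ip where "ip \<equiv> inner_delta R x0 q"

section \<open>The weight function and square-summable functions\<close>

lemma D_nonneg: "0 \<le> D l"
  unfolding delta_def N0_def by (intro divide_nonneg_nonneg mult_nonneg_nonneg sum_nonneg) auto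

lemma D_Omega: "u \<in> Omega R x0 \<Longrightarrow> l \<in> P \<Longrightarrow> D (u l) = D l"
  by (simp add: delta_def ulam_Omega q_Omega_left ulam_props(1))

definition rchi :: "'v \<times> int \<Rightarrow> 'v \<Rightarrow> real" where
  "rchi j l = (if rt j l = 0 then 1 else if rt j l < 0 then q (sgen j) else inverse (q (sgen j)))"

lemma chi_rchi: "j \<in> gens R x0 \<Longrightarrow> chi R x0 q j l = complex_of_real (rchi j l)"
  by (simp add: chi_eq rchi_def)

text \<open>Crossing the wall away from the alcove prolongs \<open>ulam\<close> by one letter and
  divides \<open>D\<close> by the square of \<open>q (sgen j)\<close>; the two values of
  \<open>rchi\<close> differ by exactly that square.\<close>

lemma rchi_D:
  assumes j: "j \<in> gens R x0" and l: "l \<in> P"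
  shows "rchi j (sgen j l) * D (sgen j l) = rchi j l * D l"
proof -
  have pos: "rchi j (sgen j m) * D (sgen j m) = rchi j m * D m" if m: "m \<in> P" "0 < rt j m" for m
  proof -
    note u = ulam_props[OF m(1)]
    have A: "rt j \<circ> ulam R x0 m \<in> Aff" using Aff_comp[OF rt_Aff[OF j] u(1)] .
    \<comment> \<open>\<open>m\<close> is a vertex of the image of the alcove under
      \<open>ulam R x0 m\<close>, so a strict sign at \<open>m\<close> holds on that whole
      image.\<close>
    have "\<not> rt j (ulam R x0 m bp) < 0"
    proof
      assume "rt j (ulam R x0 m bp) < 0"
      then have "0 \<le> (\<lambda>x. - (rt j \<circ> ulam R x0 m) x) 0" using Aff_zero_nonneg[OF Aff_uminus[OF A]] by simp
      then show False using m(2) u(2) by simp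
    qed
    then have "len R x0 (sgen j \<circ> ulam R x0 m) = Suc (len R x0 (ulam R x0 m))"
      using len_sgen_up[OF j u(1)] rt_W_nz[OF j u(1)] by linarith
    then have "q (sgen j \<circ> ulam R x0 m) = q (sgen j) * q (ulam R x0 m)" by (rule q_sgen_up[OF j u(1)])
    moreover have "ulam R x0 (sgen j m) = sgen j \<circ> ulam R x0 m" using ulam_sgen[OF j m(1)] m(2) by simp
    ultimately have "D (sgen j m) = 1 / (N0 R q * (q (sgen j) * q (ulam R x0 m))\<^sup>2)" by (simp only: delta_def)
    also have "\<dots> = inverse (q (sgen j)) * (inverse (q (sgen j)) * D m)"
      by (simp add: delta_def power2_eq_square divide_inverse)
    finally show ?thesis
      using m(2) q_gen_pos[OF j] by (simp add: rchi_def rt_sgen[OF j])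
  qed
  consider "rt j l = 0" | "0 < rt j l" | "0 < rt j (sgen j l)" using rt_sgen[OF j, of l] by linarith
  then show ?thesis
  proof cases
    case 1
    then show ?thesis by (simp add: sgen_fixed)
  next
    case 2
    then show ?thesis by (rule pos[OF l])
  next
    case 3
    then show ?thesis using pos[OF Wext_weights[OF sgen_Wext[OF j] l]] sgen_sgen[OF j] by simp
  qed
qed

lemma L2I: "(\<lambda>l. (cmod (f l))\<^sup>2 * D l) summable_on P \<Longrightarrow> f \<in> L2"
  by (simp add: l2_def)

lemma L2D: "f \<in> L2 \<Longrightarrow> (\<lambda>l. (cmod (f l))\<^sup>2 * D l) summable_on P"
  by (simp add: l2_def)

lemma L2_dominated:
  assumes h: "h summable_on P" and le: "\<And>l. l \<in> P \<Longrightarrow> (cmod (f l))\<^sup>2 * D l \<le> h l"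
  shows "f \<in> L2" "nsq f \<le> (\<Sum>\<^sub>\<infinity>l\<in>P. h l)"
proof -
  show f: "f \<in> L2"
    by (intro L2I summable_on_comparison_test[OF h]) (auto simp: le D_nonneg)
  show "nsq f \<le> (\<Sum>\<^sub>\<infinity>l\<in>P. h l)"
    unfolding normsq_def by (intro infsum_mono L2D f h le)
qed

lemma L2_cong: "(\<And>l. l \<in> P \<Longrightarrow> f l = g l) \<Longrightarrow> f \<in> L2 \<longleftrightarrow> g \<in> L2"
  unfolding l2_def by (simp cong: summable_on_cong)

lemma nsq_cong: "(\<And>l. l \<in> P \<Longrightarrow> f l = g l) \<Longrightarrow> nsq f = nsq g"
  unfolding normsq_def by (intro infsum_cong) simp

lemma ip_cong: "(\<And>l. l \<in> P \<Longrightarrow> g l = g' l) \<Longrightarrow> ip f g = ip f g'"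
  unfolding inner_delta_def by (intro infsum_cong) simp

text \<open>Boundedness needs only some constant, so this crude bound stands in for a triangle
  inequality in the weighted space.\<close>

lemma cmod_add_sq: "(cmod (a + b))\<^sup>2 \<le> 2 * (cmod a)\<^sup>2 + 2 * (cmod b)\<^sup>2"
proof -
  have "(cmod (a + b))\<^sup>2 \<le> (cmod a + cmod b)\<^sup>2" by (intro power_mono norm_triangle_ineq) simp
  also have "\<dots> \<le> 2 * (cmod a)\<^sup>2 + 2 * (cmod b)\<^sup>2"
    using zero_le_power2[of "cmod a - cmod b"] by (simp add: power2_eq_square algebra_simps)
  finally show ?thesis .
qed

lemma L2_add:
  assumes f: "f \<in> L2" and g: "g \<in> L2"
  shows "(\<lambda>l. f l + g l) \<in> L2" "nsq (\<lambda>l. f l + g l) \<le> 2 * nsq f + 2 * nsq g"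
proof -
  let ?h = "\<lambda>l. 2 * ((cmod (f l))\<^sup>2 * D l) + 2 * ((cmod (g l))\<^sup>2 * D l)"
  have h: "?h summable_on P" by (intro summable_on_add summable_on_cmult_right L2D f g)
  have le: "(cmod (f l + g l))\<^sup>2 * D l \<le> ?h l" for l
    using mult_right_mono[OF cmod_add_sq[of "f l" "g l"] D_nonneg[of l]] by (simp add: algebra_simps)
  show "(\<lambda>l. f l + g l) \<in> L2" by (rule L2_dominated(1)[OF h]) (rule le)
  have "nsq (\<lambda>l. f l + g l) \<le> (\<Sum>\<^sub>\<infinity>l\<in>P. ?h l)" by (rule L2_dominated(2)[OF h]) (rule le)
  also have "\<dots> = (\<Sum>\<^sub>\<infinity>l\<in>P. 2 * ((cmod (f l))\<^sup>2 * D l)) + (\<Sum>\<^sub>\<infinity>l\<in>P. 2 * ((cmod (g l))\<^sup>2 * D l))"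
    by (intro infsum_add summable_on_cmult_right L2D f g)
  also have "\<dots> = 2 * nsq f + 2 * nsq g"
    unfolding normsq_def by (simp add: infsum_cmult_right')
  finally show "nsq (\<lambda>l. f l + g l) \<le> 2 * nsq f + 2 * nsq g" .
qed

lemma L2_scale:
  assumes f: "f \<in> L2"
  shows "(\<lambda>l. c * f l) \<in> L2" "nsq (\<lambda>l. c * f l) = (cmod c)\<^sup>2 * nsq f"
proof -
  have e: "(cmod (c * f l))\<^sup>2 * D l = (cmod c)\<^sup>2 * ((cmod (f l))\<^sup>2 * D l)" for l
    by (simp add: norm_mult power_mult_distrib)
  show "(\<lambda>l. c * f l) \<in> L2" unfolding l2_def by (simp only: e mem_Collect_eq) (intro summable_on_cmult_right L2D f)
  show "nsq (\<lambda>l. c * f l) = (cmod c)\<^sup>2 * nsq f" unfolding normsq_def by (simp only: e infsum_cmult_right')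
qed

lemma ip_summable:
  assumes f: "f \<in> L2" and g: "g \<in> L2"
  shows "(\<lambda>l. f l * cnj (g l) * complex_of_real (D l)) summable_on P"
proof (rule abs_summable_summable)
  have h: "(\<lambda>l. (cmod (f l))\<^sup>2 * D l + (cmod (g l))\<^sup>2 * D l) summable_on P" by (intro summable_on_add L2D f g)
  show "(\<lambda>l. norm (f l * cnj (g l) * complex_of_real (D l))) summable_on P"
  proof (rule summable_on_comparison_test[OF h])
    fix l
    have "cmod (f l) * cmod (g l) \<le> (cmod (f l))\<^sup>2 + (cmod (g l))\<^sup>2"
      using sum_squares_bound[of "cmod (f l)" "cmod (g l)"] mult_nonneg_nonneg[OF norm_ge_zero norm_ge_zero, of "f l" "g l"]
      unfolding mult.assoc by linarith
    then have "cmod (f l) * cmod (g l) * D l \<le> ((cmod (f l))\<^sup>2 + (cmod (g l))\<^sup>2) * D l" by (intro mult_right_mono D_nonneg)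
    then show "norm (f l * cnj (g l) * complex_of_real (D l)) \<le> (cmod (f l))\<^sup>2 * D l + (cmod (g l))\<^sup>2 * D l"
      using D_nonneg[of l] by (simp add: norm_mult algebra_simps)
  qed simp
qed

lemma ip_add_left:
  assumes "f \<in> L2" "f' \<in> L2" "g \<in> L2"
  shows "ip (\<lambda>l. f l + f' l) g = ip f g + ip f' g"
  unfolding inner_delta_def distrib_right
  by (rule infsum_add[OF ip_summable ip_summable]) (fact assms)+

lemma ip_add_right:
  assumes "f \<in> L2" "g \<in> L2" "g' \<in> L2"
  shows "ip f (\<lambda>l. g l + g' l) = ip f g + ip f g'"
  unfolding inner_delta_def complex_cnj_add distrib_right distrib_left
  by (rule infsum_add[OF ip_summable ip_summable]) (fact assms)+

lemma ip_scale_left: "ip (\<lambda>l. c * f l) g = c * ip f g"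
  unfolding inner_delta_def by (simp add: infsum_cmult_right'[symmetric] mult.assoc)

lemma ip_scale_right: "ip f (\<lambda>l. cnj c * g l) = c * ip f g"
  unfolding inner_delta_def by (simp add: infsum_cmult_right'[symmetric] mult_ac)

section \<open>Bounded operators with adjoints\<close>

text \<open>The bound is on squared norms, and \<open>C\<close> is non-negative so that bounds
  multiply under composition.\<close>

definition bdd_op :: "(('v \<Rightarrow> complex) \<Rightarrow> 'v \<Rightarrow> complex) \<Rightarrow> bool" where
  "bdd_op T \<longleftrightarrow> (\<forall>f\<in>L2. T f \<in> L2) \<and> (\<exists>C\<ge>0. \<forall>f\<in>L2. nsq (T f) \<le> C * nsq f)"

definition adjoint_ops :: "(('v \<Rightarrow> complex) \<Rightarrow> 'v \<Rightarrow> complex) \<Rightarrow> (('v \<Rightarrow> complex) \<Rightarrow> 'v \<Rightarrow> complex) \<Rightarrow> bool" where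
  "adjoint_ops T T' \<longleftrightarrow> bdd_op T \<and> bdd_op T' \<and> (\<forall>f\<in>L2. \<forall>g\<in>L2. ip (T f) g = ip f (T' g))"

lemma bdd_op_comp:
  assumes "bdd_op S" "bdd_op T"
  shows "bdd_op (S \<circ> T)"
proof -
  obtain C where C: "C \<ge> 0" "\<And>f. f \<in> L2 \<Longrightarrow> nsq (S f) \<le> C * nsq f" using assms(1) by (auto simp: bdd_op_def)
  obtain C' where C': "C' \<ge> 0" "\<And>f. f \<in> L2 \<Longrightarrow> nsq (T f) \<le> C' * nsq f" using assms(2) by (auto simp: bdd_op_def)
  have L: "\<And>f. f \<in> L2 \<Longrightarrow> S f \<in> L2" "\<And>f. f \<in> L2 \<Longrightarrow> T f \<in> L2" using assms by (auto simp: bdd_op_def)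
  have "nsq (S (T f)) \<le> C * C' * nsq f" if "f \<in> L2" for f
    using C(2)[OF L(2)[OF that]] mult_left_mono[OF C'(2)[OF that] C(1)] by simp
  then show ?thesis unfolding bdd_op_def using L C(1) C'(1) by (auto intro!: exI[of _ "C * C'"])
qed

lemma adjoint_ops_comp: "adjoint_ops S S' \<Longrightarrow> adjoint_ops T T' \<Longrightarrow> adjoint_ops (S \<circ> T) (T' \<circ> S')"
  unfolding adjoint_ops_def by (simp add: bdd_op_comp) (simp add: bdd_op_def)

lemma adjoint_ops_id: "adjoint_ops id id"
  unfolding adjoint_ops_def bdd_op_def by (auto intro!: exI[of _ 1])

lemma bdd_op_add:
  assumes "bdd_op S" "bdd_op T"
  shows "bdd_op (\<lambda>f l. S f l + T f l)"
proof -
  obtain C where C: "C \<ge> 0" "\<And>f. f \<in> L2 \<Longrightarrow> nsq (S f) \<le> C * nsq f" using assms(1) by (auto simp: bdd_op_def)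
  obtain C' where C': "C' \<ge> 0" "\<And>f. f \<in> L2 \<Longrightarrow> nsq (T f) \<le> C' * nsq f" using assms(2) by (auto simp: bdd_op_def)
  have L: "\<And>f. f \<in> L2 \<Longrightarrow> S f \<in> L2" "\<And>f. f \<in> L2 \<Longrightarrow> T f \<in> L2" using assms by (auto simp: bdd_op_def)
  have "nsq (\<lambda>l. S f l + T f l) \<le> (2 * C + 2 * C') * nsq f" if "f \<in> L2" for f
    using L2_add(2)[OF L(1)[OF that] L(2)[OF that]] C(2)[OF that] C'(2)[OF that] by (simp add: algebra_simps)
  then show ?thesis unfolding bdd_op_def using L L2_add(1) C(1) C'(1) by (auto intro!: exI[of _ "2 * C + 2 * C'"])
qed

lemma adjoint_ops_add:
  assumes "adjoint_ops S S'" "adjoint_ops T T'"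
  shows "adjoint_ops (\<lambda>f l. S f l + T f l) (\<lambda>f l. S' f l + T' f l)"
proof -
  have b: "bdd_op S" "bdd_op S'" "bdd_op T" "bdd_op T'" using assms by (auto simp: adjoint_ops_def)
  have "ip (\<lambda>l. S f l + T f l) g = ip f (\<lambda>l. S' g l + T' g l)" if "f \<in> L2" "g \<in> L2" for f g
    using that assms b by (simp add: ip_add_left ip_add_right adjoint_ops_def bdd_op_def)
  then show ?thesis using b by (simp add: adjoint_ops_def bdd_op_add)
qed

lemma bdd_op_scale: "bdd_op T \<Longrightarrow> bdd_op (\<lambda>f l. c * T f l)"
proof -
  assume T: "bdd_op T"
  obtain C where C: "C \<ge> 0" "\<And>f. f \<in> L2 \<Longrightarrow> nsq (T f) \<le> C * nsq f" using T by (auto simp: bdd_op_def)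
  have L: "\<And>f. f \<in> L2 \<Longrightarrow> T f \<in> L2" using T by (auto simp: bdd_op_def)
  have "nsq (\<lambda>l. c * T f l) \<le> ((cmod c)\<^sup>2 * C) * nsq f" if "f \<in> L2" for f
    using mult_left_mono[OF C(2)[OF that], of "(cmod c)\<^sup>2"] by (simp add: L2_scale(2)[OF L[OF that]] mult.assoc)
  then show ?thesis unfolding bdd_op_def using L L2_scale(1) C(1) by (auto intro!: exI[of _ "(cmod c)\<^sup>2 * C"])
qed

lemma adjoint_ops_scale: "adjoint_ops T T' \<Longrightarrow> adjoint_ops (\<lambda>f l. c * T f l) (\<lambda>f l. cnj c * T' f l)"
  by (simp add: adjoint_ops_def bdd_op_scale ip_scale_left ip_scale_right)

lemma adjoint_ops_sum:
  assumes "finite F" "\<And>w. w \<in> F \<Longrightarrow> adjoint_ops (T w) (T' w)"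
  shows "adjoint_ops (\<lambda>f l. \<Sum>w\<in>F. c w * T w f l) (\<lambda>f l. \<Sum>w\<in>F. cnj (c w) * T' w f l)"
  using assms
proof (induction F rule: finite_induct)
  case empty
  have "adjoint_ops (\<lambda>f l. 0 * id f l) (\<lambda>f l. cnj 0 * id f l)" by (rule adjoint_ops_scale[OF adjoint_ops_id])
  then show ?case by simp
next
  case (insert w F)
  have "adjoint_ops (\<lambda>f l. c w * T w f l + (\<Sum>w\<in>F. c w * T w f l)) (\<lambda>f l. cnj (c w) * T' w f l + (\<Sum>w\<in>F. cnj (c w) * T' w f l))"
    by (intro adjoint_ops_add adjoint_ops_scale insert) (simp_all add: insert)
  then show ?case using insert by simp
qed

text \<open>Neither \<open>L2\<close> nor the inner product sees values off the weight lattice,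
  which suits \<open>hatT_basis_inv\<close>, an identity at weights only.\<close>

lemma adjoint_ops_cong:
  assumes "adjoint_ops T T'" "\<And>f l. l \<in> P \<Longrightarrow> T' f l = S' f l"
  shows "adjoint_ops T S'"
proof -
  have "S' f \<in> L2 \<longleftrightarrow> T' f \<in> L2" "nsq (S' f) = nsq (T' f)" "ip g (S' f) = ip g (T' f)" for f g
    using L2_cong[of "S' f" "T' f"] nsq_cong[of "S' f" "T' f"] ip_cong[of "S' f" "T' f" g] assms(2) by auto
  then show ?thesis using assms(1) by (simp add: adjoint_ops_def bdd_op_def)
qed

lemma bdd_op_weighted_composition:
  fixes m :: "'v \<Rightarrow> real"
  assumes p: "bij_betw p P P" and M: "0 \<le> M" "\<And>l. l \<in> P \<Longrightarrow> (m l)\<^sup>2 * D l \<le> M * D (p l)"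
  shows "bdd_op (\<lambda>f l. complex_of_real (m l) * f (p l))"
proof -
  have "(\<lambda>l. complex_of_real (m l) * f (p l)) \<in> L2 \<and> nsq (\<lambda>l. complex_of_real (m l) * f (p l)) \<le> M * nsq f"
    if f: "f \<in> L2" for f
  proof -
    let ?F = "\<lambda>l. (cmod (f l))\<^sup>2 * D l"
    have s: "(\<lambda>l. ?F (p l)) summable_on P" using summable_on_reindex_bij_betw[OF p, of ?F] L2D[OF f] by blast
    then have h: "(\<lambda>l. M * ?F (p l)) summable_on P" by (rule summable_on_cmult_right)
    have le: "(cmod (complex_of_real (m l) * f (p l)))\<^sup>2 * D l \<le> M * ?F (p l)" if "l \<in> P" for l
      using mult_right_mono[OF M(2)[OF that], of "(cmod (f (p l)))\<^sup>2"] by (simp add: norm_mult power_mult_distrib mult_ac)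
    have "(\<Sum>\<^sub>\<infinity>l\<in>P. M * ?F (p l)) = M * nsq f"
      unfolding normsq_def infsum_cmult_right' using infsum_reindex_bij_betw[OF p, of ?F] by simp
    then show ?thesis using L2_dominated[OF h] le by (metis (no_types, lifting))
  qed
  then show ?thesis unfolding bdd_op_def using M(1) by blast
qed

text \<open>The common form of multiplications, with \<open>p\<close> the identity, and of lattice
  permutations. Condition \<open>adj\<close> is the detailed balance left after reindexing the sum
  of the inner product along \<open>p\<close>.\<close>

lemma adjoint_ops_weighted_composition:
  fixes m m' :: "'v \<Rightarrow> real"
  assumes p: "bij_betw p P P" and p': "bij_betw p' P P" "\<And>l. l \<in> P \<Longrightarrow> p' (p l) = l"
    and M: "0 \<le> M" "\<And>l. l \<in> P \<Longrightarrow> (m l)\<^sup>2 * D l \<le> M * D (p l)"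
    and M': "\<And>l. l \<in> P \<Longrightarrow> (m' l)\<^sup>2 * D l \<le> M * D (p' l)"
    and adj: "\<And>l. l \<in> P \<Longrightarrow> m l * D l = m' (p l) * D (p l)"
  shows "adjoint_ops (\<lambda>f l. complex_of_real (m l) * f (p l)) (\<lambda>f l. complex_of_real (m' l) * f (p' l))"
proof -
  have "ip (\<lambda>l. complex_of_real (m l) * f (p l)) g = ip f (\<lambda>l. complex_of_real (m' l) * g (p' l))" for f g
  proof -
    let ?F = "\<lambda>l. f l * cnj (complex_of_real (m' l) * g (p' l)) * complex_of_real (D l)"
    have e: "complex_of_real (m l) * f (p l) * cnj (g l) * complex_of_real (D l) = ?F (p l)" if "l \<in> P" for l
    proof -
      have "complex_of_real (m l) * complex_of_real (D l) = complex_of_real (m' (p l)) * complex_of_real (D (p l))"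
        using adj[OF that] by (simp flip: of_real_mult)
      then have "f (p l) * cnj (g l) * (complex_of_real (m l) * complex_of_real (D l))
          = f (p l) * cnj (g l) * (complex_of_real (m' (p l)) * complex_of_real (D (p l)))" by simp
      then show ?thesis by (simp add: p'(2)[OF that] mult_ac)
    qed
    have "ip (\<lambda>l. complex_of_real (m l) * f (p l)) g = (\<Sum>\<^sub>\<infinity>l\<in>P. ?F (p l))"
      unfolding inner_delta_def by (intro infsum_cong e)
    also have "\<dots> = (\<Sum>\<^sub>\<infinity>l\<in>P. ?F l)" by (rule infsum_reindex_bij_betw[OF p])
    finally show ?thesis unfolding inner_delta_def .
  qed
  then show ?thesis
    unfolding adjoint_ops_def using bdd_op_weighted_composition[OF p M] bdd_op_weighted_composition[OF p'(1) M(1) M'] by blast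
qed

lemma adjoint_ops_Tgen:
  assumes j: "j \<in> gens R x0"
  shows "adjoint_ops (Tgen R x0 q j) (Tgen R x0 q j)"
proof -
  \<comment> \<open>\<open>M\<close> bounds the possible values \<open>1\<close>, \<open>q\<close>
    and \<open>1 / q\<close> of \<open>rchi\<close> and also their distances from
    \<open>q (sgen j)\<close>.\<close>
  define M where "M = 1 + q (sgen j) + inverse (q (sgen j))"
  have qp: "0 < q (sgen j)" "0 < inverse (q (sgen j))" using q_gen_pos[OF j] by simp_all
  have r: "0 \<le> rchi j l" "rchi j l \<le> M" "\<bar>q (sgen j) - rchi j l\<bar> \<le> M" for l
    using qp unfolding rchi_def M_def by (simp_all only: split: if_split) linarith+
  have M0: "0 \<le> M\<^sup>2" by simp
  have sP: "bij_betw (sgen j) P P" using Wext_bij_weights[OF sgen_Wext[OF j]] .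
  have b1: "(q (sgen j) - rchi j l)\<^sup>2 * D l \<le> M\<^sup>2 * D l" for l
    using r(3)[of l] by (intro mult_right_mono D_nonneg) (metis abs_ge_zero power2_abs power_mono)
  have b2: "(rchi j l)\<^sup>2 * D l \<le> M\<^sup>2 * D (sgen j l)" if "l \<in> P" for l
  proof -
    \<comment> \<open>One factor \<open>rchi j l\<close> is spent on exchanging \<open>D l\<close>
      for \<open>D (sgen j l)\<close>, so the quotient of the two weights needs no separate
      estimate.\<close>
    have "(rchi j l)\<^sup>2 * D l = rchi j l * rchi j (sgen j l) * D (sgen j l)"
      using rchi_D[OF j that] by (simp add: power2_eq_square mult.assoc)
    also have "\<dots> \<le> M * M * D (sgen j l)"
      using r(1,2) by (intro mult_right_mono mult_mono D_nonneg) (auto intro: order_trans)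
    finally show ?thesis by (simp add: power2_eq_square)
  qed
  have id: "bij_betw (\<lambda>l. l) P P" using bij_betw_id[of P] by (simp add: id_def)
  have "adjoint_ops (\<lambda>f l. complex_of_real (q (sgen j) - rchi j l) * f l) (\<lambda>f l. complex_of_real (q (sgen j) - rchi j l) * f l)"
    by (rule adjoint_ops_weighted_composition[OF id id _ M0]) (simp_all add: b1)
  moreover have "adjoint_ops (\<lambda>f l. complex_of_real (rchi j l) * f (sgen j l)) (\<lambda>f l. complex_of_real (rchi j l) * f (sgen j l))"
    by (rule adjoint_ops_weighted_composition[OF sP sP _ M0]) (simp_all add: b2 sgen_sgen[OF j] rchi_D[OF j])
  ultimately have "adjoint_ops (\<lambda>f l. complex_of_real (q (sgen j) - rchi j l) * f l + complex_of_real (rchi j l) * f (sgen j l))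
    (\<lambda>f l. complex_of_real (q (sgen j) - rchi j l) * f l + complex_of_real (rchi j l) * f (sgen j l))"
    by (rule adjoint_ops_add)
  moreover have "Tgen R x0 q j = (\<lambda>f l. complex_of_real (q (sgen j) - rchi j l) * f l + complex_of_real (rchi j l) * f (sgen j l))"
    by (intro ext) (simp add: Tgen_def act_def sgen_inv[OF j] chi_rchi[OF j] algebra_simps)
  ultimately show ?thesis by simp
qed

lemma adjoint_ops_act:
  assumes u: "u \<in> Omega R x0"
  shows "adjoint_ops (act u) (act (inv u))"
proof -
  have uW: "u \<in> Wext R" using Omega_Wext[OF u] .
  have "adjoint_ops (\<lambda>f l. complex_of_real 1 * f (inv u l)) (\<lambda>f l. complex_of_real 1 * f (u l))"
    by (rule adjoint_ops_weighted_composition[where M=1])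
      (simp_all add: Wext_bij_weights Wext_inv uW Wext_inv_simps D_Omega u Omega_inv)
  moreover have "act u = (\<lambda>f l. complex_of_real 1 * f (inv u l))" "act (inv u) = (\<lambda>f l. complex_of_real 1 * f (u l))"
    by (simp_all add: fun_eq_iff act_def Wext_inv_inv[OF uW])
  ultimately show ?thesis by simp
qed

lemma adjoint_ops_Tgen_word: "set js \<subseteq> gens R x0 \<Longrightarrow> adjoint_ops (Tgen_word js) (Tgen_word (rev js))"
  by (induction js) (simp_all only: list.set insert_subset rev.simps Tgen_word_simps adjoint_ops_id adjoint_ops_comp adjoint_ops_Tgen)

lemma adjoint_ops_hatT_basis:
  assumes "w \<in> Wext R"
  shows "adjoint_ops (hatT_basis R x0 q w) (hatT_basis R x0 q (inv w))"
proof -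
  obtain u js where u: "u \<in> Omega R x0" "set js \<subseteq> gens R x0" "length js = len R x0 w" "w = u \<circ> sgen_word js"
    "hatT_basis R x0 q w = act u \<circ> Tgen_word js"
    using hatT_basis_word[OF assms] by blast
  have "adjoint_ops (hatT_basis R x0 q w) (Tgen_word (rev js) \<circ> act (inv u))"
    unfolding u(5) by (intro adjoint_ops_comp adjoint_ops_act adjoint_ops_Tgen_word u)
  then show ?thesis
    by (rule adjoint_ops_cong) (simp only: u(4) hatT_basis_inv[OF u(1,2) u(3)[unfolded u(4)]])
qed

text \<open>Inversion is an involution of the group and maps the support of \<open>c\<close> onto
  that of \<open>hstar R c\<close>, so it reindexes the sum.\<close>

lemma hatT_hstar:
  assumes "hecke_elem R c"
  shows "hatT R x0 q (hstar R c) f l = (\<Sum>w\<in>{w. c w \<noteq> 0}. cnj (c w) * hatT_basis R x0 q (inv w) f l)"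
proof -
  have sub: "w \<in> Wext R" if "c w \<noteq> 0" for w using assms that by (auto simp: hecke_elem_def)
  have supp: "{v. hstar R c v \<noteq> 0} = inv ` {w. c w \<noteq> 0}"
  proof (intro equalityI subsetI)
    fix v assume "v \<in> {v. hstar R c v \<noteq> 0}"
    then have "v \<in> Wext R" "c (inv v) \<noteq> 0" by (auto simp: hstar_def split: if_splits)
    then show "v \<in> inv ` {w. c w \<noteq> 0}" by (intro image_eqI[of _ _ "inv v"]) (simp_all add: Wext_inv_inv)
  next
    fix v assume "v \<in> inv ` {w. c w \<noteq> 0}"
    then obtain w where "c w \<noteq> 0" "v = inv w" by blast
    then show "v \<in> {v. hstar R c v \<noteq> 0}" using sub Wext_inv Wext_inv_inv by (simp add: hstar_def)
  qed
  have "inj_on inv {w. c w \<noteq> 0}" by (rule inj_on_inverseI[of _ inv]) (use sub Wext_inv_inv in blast)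
  then have "hatT R x0 q (hstar R c) f l = (\<Sum>w\<in>{w. c w \<noteq> 0}. hstar R c (inv w) * hatT_basis R x0 q (inv w) f l)"
    unfolding hatT_def supp by (simp add: sum.reindex)
  also have "\<dots> = (\<Sum>w\<in>{w. c w \<noteq> 0}. cnj (c w) * hatT_basis R x0 q (inv w) f l)"
    by (intro sum.cong) (use sub Wext_inv Wext_inv_inv in \<open>auto simp: hstar_def\<close>)
  finally show ?thesis .
qed

lemma adjoint_ops_hatT:
  assumes "hecke_elem R c"
  shows "adjoint_ops (hatT R x0 q c) (hatT R x0 q (hstar R c))"
proof -
  have "adjoint_ops (\<lambda>f l. \<Sum>w\<in>{w. c w \<noteq> 0}. c w * hatT_basis R x0 q w f l)
      (\<lambda>f l. \<Sum>w\<in>{w. c w \<noteq> 0}. cnj (c w) * hatT_basis R x0 q (inv w) f l)"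
    using assms by (intro adjoint_ops_sum adjoint_ops_hatT_basis) (auto simp: hecke_elem_def)
  then show ?thesis unfolding hatT_hstar[OF assms, symmetric] hatT_def[symmetric] .
qed

end

theorem mainTheorem13:
  fixes R :: "'v::euclidean_space set" and x0 :: 'v
    and q :: "('v \<Rightarrow> 'v) \<Rightarrow> real"
    and c :: "('v \<Rightarrow> 'v) \<Rightarrow> complex"
  assumes "root_system R" and "regular R x0"
    and "\<forall>w\<in>Wext R. q w \<noteq> 0"
    and "\<forall>w\<in>Wext R. \<forall>w'\<in>Wext R. len R x0 (w \<circ> w') = len R x0 w + len R x0 w'
            \<longrightarrow> q (w \<circ> w') = q w * q w'"
    and "\<forall>w\<in>Wext R. len R x0 w = 0 \<longrightarrow> q w = 1"
    and "\<forall>j\<in>gens R x0. 0 < q (sgen j) \<and> q (sgen j) < 1"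
    and "hecke_elem R c"
  shows "(\<forall>f\<in>l2 R x0 q. hatT R x0 q c f \<in> l2 R x0 q)
       \<and> (\<exists>C. \<forall>f\<in>l2 R x0 q. normsq R x0 q (hatT R x0 q c f) \<le> C * normsq R x0 q f)
       \<and> (\<forall>f\<in>l2 R x0 q. \<forall>g\<in>l2 R x0 q.
            inner_delta R x0 q (hatT R x0 q c f) g = inner_delta R x0 q f (hatT R x0 q (hstar R c) g))"
proof -
  interpret hecke_data R x0 q
    using assms(1-6) by unfold_locales auto
  show ?thesis
    using adjoint_ops_hatT[OF assms(7)] unfolding adjoint_ops_def bdd_op_def by blast
qed

end
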